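(* Let $$\lambda_1(\Omega)=\inf\left\{\int_\Omega|\nabla u|^p+\int_{\mathbb{R}^N}\int_{\mathbb{R}^N}\frac{|u(x)-u(y)|^p}{|x-y|^{N+sp}}\,dx\,dy-\mu\int_\Omega\frac{|u|^p}{|x|^{p\theta}}\ :\ u\in X(\Omega),\ \int_\Omega|u|^p=1\right\}$$ be the first eigenvalue of $\mathcal{T}$. Then $\lambda_1(\Omega)$ is simple, i.e. any two eigenfunctions of $\mathcal{T}$ associated with $\lambda_1(\Omega)$ are constant multiples of each other.
   Context: Let $N$ be a positive integer, $0<s<1<p<N$, $\theta\in[s,1]$, and let $\Omega\subset\mathbb{R}^N$ be a bounded domain. $W_0^{1,p}(\Omega)$ is the closure of $C_c^\infty(\Omega)$ with respect to $\left(\int_\Omega|\nabla u|^p\right)^{1/p}$, and $X(\Omega)=\{u\in W^{1,p}(\mathbb{R}^N): u|_\Omega\in W_0^{1,p}(\Omega),\ u=0 \text{ a.e. in } \mathbb{R}^N\setminus\Omega\}$. Constants: $C_H=\left(\frac{N-p}{p}\right)^p$; $C_{N,p,s}=2\int_0^1 r^{ps-1}|1-r^{(N-ps)/p}|^p\Psi_{N,s,p}(r)\,dr$ with $\Psi_{N,s,p}(r)=|\mathbb{S}^{N-2}|\int_{-1}^1\frac{(1-t^2)^{(N-3)/2}}{(1-2rt+r^2)^{(N+ps)/2}}\,dt$ ($N\ge2$). Set $\mu_0(\theta)=C_{N,p,s}$ if $\theta=s$; $\mu_0(\theta)=\min\left\{\frac{C_H(1-s)}{\theta-s},\frac{C_{N,p,s}(1-s)}{1-\theta}\right\}$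 if $\theta\in(s,1)$; $\mu_0(\theta)=C_H$ if $\theta=1$. Fix $\mu\in(0,\mu_0(\theta))$. Write $F(t)=|t|^{p-2}t$ ($F(0)=0$). The operator is $\mathcal{T}(u)=-\Delta_p u+(-\Delta_p)^su-\mu\frac{|u|^{p-2}u}{|x|^{p\theta}}$. An eigenfunction of $\mathcal{T}$ associated with $\lambda\in\mathbb{R}$ is a function $u\in X(\Omega)\setminus\{0\}$ such that for all $v\in X(\Omega)$ $$\int_\Omega|\nabla u|^{p-2}\nabla u\cdot\nabla v+\int_{\mathbb{R}^N}\int_{\mathbb{R}^N}\frac{F(u(x)-u(y))(v(x)-v(y))}{|x-y|^{N+ps}}\,dx\,dy-\mu\int_\Omega\frac{|u|^{p-2}uv}{|x|^{p\theta}}=\lambda\int_\Omega|u|^{p-2}uv .$$ *)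

theory Defs
  imports "HOL-Analysis.Analysis"
begin

text \<open>
  Functions on an open subset $U$ of the Euclidean space \<^typ>\<open>'a\<close> (of dimension $N$ = \<open>DIM('a)\<close>) are
  represented by total functions on \<^typ>\<open>'a\<close>. All notions below that take a set \<open>U\<close> depend only on the
  values on \<open>U\<close>, so restriction to \<open>U\<close> is implicit. Elements of Lebesgue and Sobolev spaces are
  representatives, and equality in these spaces is equality almost everywhere.
\<close>

subsection \<open>Sobolev spaces\<close>

primrec Ck :: "nat \<Rightarrow> ('a::euclidean_space \<Rightarrow> real) \<Rightarrow> bool" where
  "Ck 0 f \<longleftrightarrow> continuous_on UNIV f"
| "Ck (Suc k) f \<longleftrightarrow>
     (\<forall>x. f differentiable (at x)) \<and> (\<forall>b\<in>Basis. Ck k (\<lambda>x. frechet_derivative f (at x) b))"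

definition test_functions :: "'a::euclidean_space set \<Rightarrow> ('a \<Rightarrow> real) set" where
  "test_functions U =
     {\<phi>. (\<forall>k. Ck k \<phi>) \<and> compact (closure {x. \<phi> x \<noteq> 0}) \<and> closure {x. \<phi> x \<noteq> 0} \<subseteq> U}"

definition gradient :: "('a::euclidean_space \<Rightarrow> real) \<Rightarrow> 'a \<Rightarrow> 'a" where
  "gradient \<phi> x = (\<Sum>b\<in>Basis. frechet_derivative \<phi> (at x) b *\<^sub>R b)"

definition has_weak_gradient ::
    "'a::euclidean_space set \<Rightarrow> ('a \<Rightarrow> real) \<Rightarrow> ('a \<Rightarrow> 'a) \<Rightarrow> bool" where
  "has_weak_gradient U u g \<longleftrightarrow>
     (\<forall>K. compact K \<and> K \<subseteq> U \<longrightarrow> u absolutely_integrable_on K \<and> g absolutely_integrable_on K) \<and>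
     (\<forall>\<phi>\<in>test_functions U.
        (\<integral>x. u x *\<^sub>R gradient \<phi> x \<partial>lebesgue_on U) = - (\<integral>x. \<phi> x *\<^sub>R g x \<partial>lebesgue_on U))"

text \<open>The weak gradient is unique up to null sets, so the choice of representative is immaterial.\<close>

definition weak_gradient :: "'a::euclidean_space set \<Rightarrow> ('a \<Rightarrow> real) \<Rightarrow> 'a \<Rightarrow> 'a" where
  "weak_gradient U u = (SOME g. has_weak_gradient U u g)"

definition Lp :: "real \<Rightarrow> 'a::euclidean_space set \<Rightarrow> ('a \<Rightarrow> 'b::euclidean_space) set" where
  "Lp p U = {f. f \<in> borel_measurable (lebesgue_on U) \<and>
                integrable (lebesgue_on U) (\<lambda>x. norm (f x) powr p)}"

definition W1p :: "real \<Rightarrow> 'a::euclidean_space set \<Rightarrow> ('a \<Rightarrow> real) set" where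
  "W1p p U = {u \<in> Lp p U. \<exists>g\<in>Lp p U. has_weak_gradient U u g}"

text \<open>
  On $W^{1,p}(U)$ the functional $(\int_U |\nabla u|^p)^{1/p}$ is only a seminorm (it vanishes on locally constant
  functions), whereas it is a norm on the test functions. The closure of the latter is therefore formed
  inside $L^p(U)$: besides convergence of the gradients the approximating sequence has to converge
  in $L^p(U)$. For bounded \<open>U\<close>, by the Poincare inequality, every sequence of test functions that is
  Cauchy for the gradient norm converges in $L^p(U)$, so this is exactly the completion for that norm.
\<close>

definition W01p :: "real \<Rightarrow> 'a::euclidean_space set \<Rightarrow> ('a \<Rightarrow> real) set" where
  "W01p p U = {u \<in> W1p p U. \<exists>\<phi>. (\<forall>k::nat. \<phi> k \<in> test_functions U) \<and>
     (\<lambda>k. \<integral>x. norm (gradient (\<phi> k) x - weak_gradient U u x) powr p \<partial>lebesgue_on U) \<longlonglongrightarrow> 0 \<and>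
     (\<lambda>k. \<integral>x. \<bar>\<phi> k x - u x\<bar> powr p \<partial>lebesgue_on U) \<longlonglongrightarrow> 0}"

definition X_space :: "real \<Rightarrow> 'a::euclidean_space set \<Rightarrow> ('a \<Rightarrow> real) set" where
  "X_space p \<Omega> = {u \<in> W1p p UNIV. u \<in> W01p p \<Omega> \<and> (AE x in lebesgue. x \<notin> \<Omega> \<longrightarrow> u x = 0)}"

subsection \<open>Hardy constants\<close>

definition C_H :: "nat \<Rightarrow> real \<Rightarrow> real" where
  "C_H N p = ((real N - p) / p) powr p"

text \<open>The factor \<open>(N - 1) * unit_ball_vol (N - 1)\<close> is the surface measure of the unit sphere in
  $(N-1)$-dimensional space (which is 2 for \<open>N = 2\<close>).\<close>

definition Psi :: "nat \<Rightarrow> real \<Rightarrow> real \<Rightarrow> real \<Rightarrow> real" where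
  "Psi N s p r = ((real N - 1) * unit_ball_vol (real N - 1)) *
     (\<integral>t. (1 - t\<^sup>2) powr ((real N - 3) / 2) /
           (1 - 2 * r * t + r\<^sup>2) powr ((real N + p * s) / 2) \<partial>lebesgue_on {-1..1})"

definition C_frac :: "nat \<Rightarrow> real \<Rightarrow> real \<Rightarrow> real" where
  "C_frac N p s =
     2 * (\<integral>r. r powr (p * s - 1) * \<bar>1 - r powr ((real N - p * s) / p)\<bar> powr p * Psi N s p r
            \<partial>lebesgue_on {0..1})"

definition mu0 :: "nat \<Rightarrow> real \<Rightarrow> real \<Rightarrow> real \<Rightarrow> real" where
  "mu0 N p s \<theta> =
     (if \<theta> = s then C_frac N p s
      else if \<theta> = 1 then C_H N p
      else min (C_H N p * (1 - s) / (\<theta> - s)) (C_frac N p s * (1 - s) / (1 - \<theta>)))"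

subsection \<open>Eigenfunctions and the first eigenvalue\<close>

text \<open>
  For \<open>u, v\<close> in the space \<^const>\<open>X_space\<close> all integrals below converge absolutely (Hardy inequality and
  the embedding of $W^{1,p}$ into $W^{s,p}$). The values given by \<open>powr\<close> and division at \<open>x = 0\<close> and on
  the diagonal concern null sets only. Since \<open>0 powr a = 0\<close>, the expressions $|t|^{p-2}t$ vanish at
  \<open>t = 0\<close> as required also for \<open>p < 2\<close>.
\<close>

definition F :: "real \<Rightarrow> real \<Rightarrow> real" where
  "F p t = \<bar>t\<bar> powr (p - 2) * t"

definition energy ::
    "real \<Rightarrow> real \<Rightarrow> real \<Rightarrow> real \<Rightarrow> 'a::euclidean_space set \<Rightarrow> ('a \<Rightarrow> real) \<Rightarrow> real" where
  "energy p s \<theta> \<mu> \<Omega> u =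
     (\<integral>x. norm (weak_gradient \<Omega> u x) powr p \<partial>lebesgue_on \<Omega>)
     + (\<integral>(x, y). \<bar>u x - u y\<bar> powr p / norm (x - y) powr (real DIM('a) + s * p)
          \<partial>(lebesgue \<Otimes>\<^sub>M lebesgue))
     - \<mu> * (\<integral>x. \<bar>u x\<bar> powr p / norm x powr (p * \<theta>) \<partial>lebesgue_on \<Omega>)"

definition lambda1 :: "real \<Rightarrow> real \<Rightarrow> real \<Rightarrow> real \<Rightarrow> 'a::euclidean_space set \<Rightarrow> real" where
  "lambda1 p s \<theta> \<mu> \<Omega> =
     Inf {energy p s \<theta> \<mu> \<Omega> u | u. u \<in> X_space p \<Omega> \<and> (\<integral>x. \<bar>u x\<bar> powr p \<partial>lebesgue_on \<Omega>) = 1}"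

definition eigenfunction ::
    "real \<Rightarrow> real \<Rightarrow> real \<Rightarrow> real \<Rightarrow> 'a::euclidean_space set \<Rightarrow> real \<Rightarrow> ('a \<Rightarrow> real) \<Rightarrow> bool" where
  "eigenfunction p s \<theta> \<mu> \<Omega> ev u \<longleftrightarrow>
     u \<in> X_space p \<Omega> \<and> \<not> (AE x in lebesgue. u x = 0) \<and>
     (\<forall>v\<in>X_space p \<Omega>.
        (\<integral>x. norm (weak_gradient \<Omega> u x) powr (p - 2) * (weak_gradient \<Omega> u x \<bullet> weak_gradient \<Omega> v x)
           \<partial>lebesgue_on \<Omega>)
        + (\<integral>(x, y). F p (u x - u y) * (v x - v y) / norm (x - y) powr (real DIM('a) + p * s)
             \<partial>(lebesgue \<Otimes>\<^sub>M lebesgue))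
        - \<mu> * (\<integral>x. F p (u x) * v x / norm x powr (p * \<theta>) \<partial>lebesgue_on \<Omega>)
        = ev * (\<integral>x. F p (u x) * v x \<partial>lebesgue_on \<Omega>))"

end

theory Submission
  imports Defs
begin

text \<open>
  The proof rests on hidden convexity. Let \<open>u\<close> and \<open>v\<close> be eigenfunctions for the first eigenvalue
  \<open>\<Lambda>\<close>; testing the equation with the eigenfunction itself shows \<open>E u = \<Lambda> \<integral>|u|\<^sup>p\<close>, and likewise for \<open>v\<close>.
  Put \<open>W = (|u|\<^sup>p + |v|\<^sup>p)\<^bsup>1/p\<^esup>\<close>, the \<open>\<ell>\<^sup>p\<close> norm of the vector \<open>(u, v)\<close>. The mass and the Hardy term are additive,
  \<open>|W|\<^sup>p = |u|\<^sup>p + |v|\<^sup>p\<close>, and by the reverse triangle inequality in \<open>\<ell>\<^sup>p\<close>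
  \[ |W(x) - W(y)|^p \le |u(x) - u(y)|^p + |v(x) - v(y)|^p , \]
  which for infinitesimally close points also gives \<open>|\<nabla>W|\<^sup>p \<le> |\<nabla>u|\<^sup>p + |\<nabla>v|\<^sup>p\<close>. Hence
  \<open>E W \<le> E u + E v = \<Lambda> \<integral>|W|\<^sup>p \<le> E W\<close>, so the displayed inequality is an equality for almost all pairs
  \<open>(x, y)\<close>. Because the \<open>\<ell>\<^sup>p\<close> norm of the plane is strictly convex, equality forces the vectors \<open>(u(x), v(x))\<close> and
  \<open>(u(y), v(y))\<close> to be linearly dependent (\<open>lp_norm_diff_powr_le\<close>). Fixing one \<open>x\<close> with \<open>v(x) \<noteq> 0\<close> makes \<open>u\<close> a
  multiple of \<open>v\<close>.

  The comparison \<open>\<Lambda> \<integral>|W|\<^sup>p \<le> E W\<close> is carried out along approximations. If test functions \<open>\<phi>\<^sub>k\<close> and \<open>\<psi>\<^sub>k\<close> approximate \<open>u\<close> and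
  \<open>v\<close>, then a smoothed \<open>\<ell>\<^sup>p\<close> norm \<open>w\<^sub>k\<close> of the pair \<open>(\<phi>\<^sub>k, \<psi>\<^sub>k)\<close> (\<open>lp_combination\<close>) is again a test function and satisfies the
  same two inequalities. The estimate \<open>\<Lambda> \<integral>|w\<^sub>k|\<^sup>p \<le> E w\<^sub>k\<close> is valid by the definition of \<open>\<Lambda>\<close>, and it passes to the limit: the
  gradient and Gagliardo energies of \<open>\<phi>\<^sub>k\<close> and \<open>\<psi>\<^sub>k\<close> and the masses converge, while the convexity deficit and the Hardy term, which enter with a favourable
  sign, are controlled by Fatou's lemma (\<open>minimizers_parallel\<close>).

  Three analytic facts support this. The weak gradient is unique almost everywhere
  (\<open>weak_gradient_unique\<close>), so that for test functions it is the classical gradient. The sharp Hardy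
  inequality (\<open>hardy_inequality_C1\<close>) makes the singular term finite and bounds the energy from below
  on the unit sphere of \<open>L\<^sup>p\<close>, which makes the infimum \<open>\<Lambda>\<close> a true lower bound. Finally the Gagliardo energy is
  controlled by the \<open>W\<^bsup>1,p\<^esup>\<close> norm (\<open>gagliardo_C1_bound\<close>), so it is finite and continuous along the approximations.
\<close>

section \<open>Smooth functions and bump functions\<close>

lemma Ck_SucI:
  assumes "\<And>x. (f has_derivative D x) (at x)"
    and "\<And>b. b \<in> Basis \<Longrightarrow> Ck k (\<lambda>x. D x b)"
  shows "Ck (Suc k) f"
proof -
  have "frechet_derivative f (at x) = D x" for x
    using frechet_derivative_at[OF assms(1)] by simp
  then show ?thesis
    using assms by (auto simp: differentiable_def)
qed

lemma Ck_has_derivative: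
  "Ck (Suc k) f \<Longrightarrow> (f has_derivative frechet_derivative f (at x)) (at x)"
  by (simp add: frechet_derivative_works)

lemma Ck_continuous: "Ck k f \<Longrightarrow> continuous_on UNIV f"
  by (cases k)
    (auto simp: continuous_on_eq_continuous_at intro: differentiable_imp_continuous_within)

lemma Ck_Suc_imp_Ck: "Ck (Suc k) f \<Longrightarrow> Ck k f"
proof (induction k arbitrary: f)
  case 0
  then show ?case using Ck_continuous Ck.simps(1) by blast
next
  case (Suc k)
  then show ?case by (metis Ck.simps(2))
qed

lemma Ck_const: "Ck k (\<lambda>x. c)"
  by (induction k arbitrary: c) auto

lemma Ck_inner: "Ck k (\<lambda>x. x \<bullet> a)"
proof (cases k)
  case (Suc j)
  have "((\<lambda>x. x \<bullet> a) has_derivative (\<lambda>h. h \<bullet> a)) (at x)" for x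
    by (auto intro!: derivative_eq_intros)
  then show ?thesis
    unfolding Suc by (rule Ck_SucI) (rule Ck_const)
qed (auto intro: continuous_intros)

lemma Ck_add: "Ck k f \<Longrightarrow> Ck k g \<Longrightarrow> Ck k (\<lambda>x. f x + g x)"
proof (induction k arbitrary: f g)
  case 0
  then show ?case by (auto intro: continuous_intros)
next
  case (Suc k)
  have "((\<lambda>x. f x + g x) has_derivative
      (\<lambda>h. frechet_derivative f (at x) h + frechet_derivative g (at x) h)) (at x)" for x
    using Suc.prems by (intro has_derivative_add Ck_has_derivative)
  then show ?case
    by (rule Ck_SucI) (use Suc in auto)
qed

lemma Ck_mult: "Ck k f \<Longrightarrow> Ck k g \<Longrightarrow> Ck k (\<lambda>x. f x * g x)"
proof (induction k arbitrary: f g)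
  case 0
  then show ?case by (auto intro: continuous_intros)
next
  case (Suc k)
  have "((\<lambda>x. f x * g x) has_derivative
      (\<lambda>h. f x * frechet_derivative g (at x) h + frechet_derivative f (at x) h * g x)) (at x)" for x
    using Suc.prems by (intro has_derivative_mult Ck_has_derivative)
  then show ?case
  proof (rule Ck_SucI)
    show "Ck k (\<lambda>x. f x * frechet_derivative g (at x) b + frechet_derivative f (at x) b * g x)"
      if "b \<in> Basis" for b
      using Suc.prems that by (intro Ck_add Suc.IH) (auto intro: Ck_Suc_imp_Ck)
  qed
qed

lemma Ck_prod:
  "finite I \<Longrightarrow> (\<And>i. i \<in> I \<Longrightarrow> Ck k (f i)) \<Longrightarrow> Ck k (\<lambda>x. \<Prod>i\<in>I. f i x)"
  by (induction I rule: finite_induct) (simp_all add: Ck_const Ck_mult)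

lemma Ck_powr:
  assumes "Ck k f" "\<And>x. f x > 0"
  shows "Ck k (\<lambda>x. f x powr a)"
  using assms
proof (induction k arbitrary: f a)
  case 0
  then show ?case by (auto intro!: continuous_intros simp: less_imp_neq[symmetric])
next
  case (Suc k)
  have "((\<lambda>x. f x powr a) has_derivative
      (\<lambda>h. frechet_derivative f (at x) h * (a * f x powr (a - 1)))) (at x)" for x
    using DERIV_compose_FDERIV[OF has_real_derivative_powr Ck_has_derivative[OF Suc.prems(1)]]
      Suc.prems(2) by blast
  then show ?case
  proof (rule Ck_SucI)
    show "Ck k (\<lambda>x. frechet_derivative f (at x) b * (a * f x powr (a - 1)))" if "b \<in> Basis" for b
      using Suc.prems that
      by (intro Ck_mult Ck_const Suc.IH) (auto intro: Ck_Suc_imp_Ck)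
  qed
qed

lemma test_function_continuous: "\<phi> \<in> test_functions U \<Longrightarrow> continuous_on UNIV \<phi>"
  using Ck_continuous by (auto simp: test_functions_def)

lemma continuous_imp_lebesgue_measurable:
  fixes f :: "'a::euclidean_space \<Rightarrow> 'b::topological_space"
  shows "continuous_on UNIV f \<Longrightarrow> f \<in> borel_measurable lebesgue"
  by (intro measurable_completion) (simp add: borel_measurable_continuous_onI)

text \<open>
  For \<open>m = 0\<close> this is the standard smooth function that is flat at the origin. The derivative of a member of the
  family is a combination of two others, so smoothness of all members follows by a single induction.
\<close>

definition flat :: "nat \<Rightarrow> real \<Rightarrow> real" where
  "flat m t = (if t \<le> 0 then 0 else exp (- (1 / t)) / t ^ m)"

lemma power_le_fact_mult_exp:
  assumes "(x::real) \<ge> 0"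
  shows "x ^ n \<le> fact n * exp x"
proof -
  have "x ^ n /\<^sub>R fact n \<le> exp x"
    unfolding exp_def using assms
    by (intro order_trans[OF _ sum_le_suminf[OF summable_exp_generic, of "{n}"]]) auto
  then show ?thesis by (simp add: field_simps)
qed

text \<open>
  The bound makes the derivative at the origin vanish.
\<close>

lemma flat_quadratic_bound: "\<bar>flat m t\<bar> \<le> fact (m + 2) * t\<^sup>2"
proof (cases "t \<le> 0")
  case False
  then have t: "t > 0" by simp
  have "(1 / t) ^ (m + 2) / fact (m + 2) \<le> exp (1 / t)"
    using power_le_fact_mult_exp[of "1 / t" "m + 2"] t
    by (simp add: field_simps del: fact_Suc)
  then have "exp (- (1 / t)) \<le> fact (m + 2) * t ^ (m + 2)"
    using t unfolding exp_minus power_one_over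
    by (simp add: divide_simps mult.commute del: fact_Suc power_Suc)
  then show ?thesis
    using t by (simp add: flat_def divide_le_eq power_add power2_eq_square mult_ac del: fact_Suc)
qed (simp add: flat_def)

lemma DERIV_flat: "(flat m has_real_derivative flat (m + 2) t - m * flat (m + 1) t) (at t)"
proof -
  consider "t < 0" | "t = 0" | "t > 0" by linarith
  then show ?thesis
  proof cases
    case 1
    have "((\<lambda>t. 0) has_real_derivative 0) (at t)" by simp
    then have "(flat m has_real_derivative 0) (at t)"
      by (rule has_field_derivative_transform_within_open[of _ _ _ "{..<0}"])
        (use 1 in \<open>auto simp: flat_def\<close>)
    then show ?thesis using 1 by (simp add: flat_def)
  next
    case 2
    have "((\<lambda>h. flat m h / h) \<longlongrightarrow> 0) (at 0)"
    proof (rule Lim_null_comparison)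
      show "\<forall>\<^sub>F h in at 0. norm (flat m h / h) \<le> fact (m + 2) * \<bar>h\<bar>"
        using flat_quadratic_bound[of m]
        by (intro eventually_at_filter[THEN iffD2] always_eventually)
          (auto simp: divide_le_eq power2_eq_square mult.assoc simp del: fact_Suc)
      show "((\<lambda>h::real. fact (m + 2) * \<bar>h\<bar>) \<longlongrightarrow> 0) (at 0)"
        by (rule tendsto_eq_intros | simp)+
    qed
    then show ?thesis
      using 2 by (simp add: flat_def[of _ 0] has_field_derivative_iff)
  next
    case 3
    have "((\<lambda>t. exp (- (1 / t)) * inverse (t ^ m)) has_real_derivative
        exp (- (1 / t)) * (1 / t\<^sup>2) * inverse (t ^ m)
          + exp (- (1 / t)) * (- (inverse (t ^ m) * (of_nat m * t ^ (m - Suc 0)) * inverse (t ^ m)))) (at t)"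
      by (rule derivative_eq_intros refl | use 3 in \<open>simp add: power2_eq_square\<close>)+
    also have "exp (- (1 / t)) * (1 / t\<^sup>2) * inverse (t ^ m)
          + exp (- (1 / t)) * (- (inverse (t ^ m) * (of_nat m * t ^ (m - Suc 0)) * inverse (t ^ m)))
        = flat (m + 2) t - m * flat (m + 1) t"
      using 3 by (cases m) (simp_all add: flat_def divide_simps power2_eq_square)
    finally have "((\<lambda>t. exp (- (1 / t)) / t ^ m) has_real_derivative
        flat (m + 2) t - m * flat (m + 1) t) (at t)"
      by (simp only: divide_inverse)
    then show ?thesis
      by (rule has_field_derivative_transform_within_open[of _ _ _ "{0<..}"])
        (use 3 in \<open>auto simp: flat_def\<close>)
  qed
qed

lemma Ck_flat: "Ck k f \<Longrightarrow> Ck k (\<lambda>x. flat m (f x))"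
proof (induction k arbitrary: f m)
  case 0
  have "continuous_on UNIV (flat m)"
    by (rule DERIV_continuous_on[OF DERIV_subset[OF DERIV_flat subset_UNIV]])
  with 0 show ?case
    by (auto intro: continuous_on_compose2[of UNIV "flat m" UNIV f])
next
  case (Suc k)
  have "((\<lambda>x. flat m (f x)) has_derivative
      (\<lambda>h. frechet_derivative f (at x) h * (flat (m + 2) (f x) + (- m) * flat (m + 1) (f x)))) (at x)" for x
    using DERIV_compose_FDERIV[OF DERIV_flat Ck_has_derivative[OF Suc.prems(1)]]
    by simp
  then show ?case
  proof (rule Ck_SucI)
    show "Ck k (\<lambda>x. frechet_derivative f (at x) b * (flat (m + 2) (f x) + (- m) * flat (m + 1) (f x)))"
      if "b \<in> Basis" for b
      using Suc.prems that
      by (intro Ck_mult Ck_add Ck_const Suc.IH) (auto intro: Ck_Suc_imp_Ck)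
  qed
qed

text \<open>
  Dilating the argument by \<open>n + 1\<close> makes every factor converge to the indicator of the half-line \<open>t > 0\<close>, so the
  products converge to the indicator of the open box.
\<close>

definition box_bump :: "'a::euclidean_space \<Rightarrow> 'a \<Rightarrow> nat \<Rightarrow> 'a \<Rightarrow> real" where
  "box_bump a b n x =
     (\<Prod>i\<in>Basis. flat 0 (real (Suc n) * (x \<bullet> i - a \<bullet> i)) * flat 0 (real (Suc n) * (b \<bullet> i - x \<bullet> i)))"

lemma flat_0_eq_0_iff: "flat 0 t = 0 \<longleftrightarrow> t \<le> 0"
  by (simp add: flat_def)

lemma box_bump_eq_0_iff: "box_bump a b n x = 0 \<longleftrightarrow> x \<notin> box a b"
proof -
  have "real (Suc n) * t \<le> 0 \<longleftrightarrow> t \<le> 0" for t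
    by (simp add: mult_le_0_iff del: of_nat_Suc)
  then show ?thesis
    unfolding box_bump_def
    by (simp add: flat_0_eq_0_iff mem_box del: of_nat_Suc) (meson not_less)
qed

lemma box_bump_test_function:
  assumes "cbox a b \<subseteq> U"
  shows "box_bump a b n \<in> test_functions U"
proof -
  have "Ck k (\<lambda>x. r * (x \<bullet> i - c))" "Ck k (\<lambda>x. r * (c - x \<bullet> i))" for k i c and r :: real
    using Ck_mult[OF Ck_const[of k r] Ck_add[OF Ck_inner[of k i] Ck_const[of k "- c"]]]
      Ck_mult[OF Ck_const[of k "- r"] Ck_add[OF Ck_inner[of k i] Ck_const[of k "- c"]]]
    by (simp_all add: algebra_simps)
  then have "Ck k (box_bump a b n)" for k
    unfolding box_bump_def[abs_def] by (intro Ck_prod Ck_mult[OF Ck_flat Ck_flat]) auto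
  moreover have "{x. box_bump a b n x \<noteq> 0} = box a b"
    by (auto simp: box_bump_eq_0_iff)
  moreover have "closure (box a b) \<subseteq> cbox a b"
    by (rule closure_minimal[OF box_subset_cbox closed_cbox])
  moreover have "compact (closure (box a b))"
    by (simp add: bounded_box)
  ultimately show ?thesis
    using assms by (auto simp: test_functions_def)
qed

lemma box_bump_bounds: "0 \<le> box_bump a b n x" "box_bump a b n x \<le> 1"
proof -
  have *: "0 \<le> flat 0 t \<and> flat 0 t \<le> 1" for t
    by (auto simp: flat_def)
  show "0 \<le> box_bump a b n x" "box_bump a b n x \<le> 1"
    unfolding box_bump_def using *
    by (auto intro!: prod_nonneg prod_le_1 mult_le_one)
qed

lemma box_bump_tendsto: "(\<lambda>n. box_bump a b n x) \<longlonglongrightarrow> indicator (box a b) x"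
proof (cases "x \<in> box a b")
  case True
  have "(\<lambda>n. flat 0 (real (Suc n) * t)) \<longlonglongrightarrow> 1" if "t > 0" for t
  proof -
    have "(\<lambda>n. exp (- (inverse (real (Suc n)) * (1 / t)))) \<longlonglongrightarrow> exp (- (0 * (1 / t)))"
      by (intro tendsto_intros LIMSEQ_inverse_real_of_nat)
    moreover have "flat 0 (real (Suc n) * t) = exp (- (inverse (real (Suc n)) * (1 / t)))" for n
    proof -
      have "\<not> real (Suc n) * t \<le> 0"
        using that by (simp add: zero_less_mult_iff not_le del: of_nat_Suc)
      then show ?thesis by (simp add: flat_def field_simps)
    qed
    ultimately show ?thesis by simp
  qed
  then have "(\<lambda>n. box_bump a b n x) \<longlonglongrightarrow> (\<Prod>i\<in>(Basis :: 'a set). 1 * 1)"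
    unfolding box_bump_def using True
    by (intro tendsto_prod tendsto_mult) (auto simp: mem_box)
  then show ?thesis using True by simp
next
  case False
  then have "box_bump a b n x = 0" for n
    using box_bump_eq_0_iff by blast
  then show ?thesis using False by simp
qed

section \<open>Uniqueness of the weak gradient\<close>

lemma sigma_finite_lebesgue: "sigma_finite_measure (lebesgue :: 'a::euclidean_space measure)"
proof
  obtain A :: "'a set set" where "countable A" "A \<subseteq> sets lborel" "\<Union>A = space lborel"
    "\<forall>a\<in>A. emeasure lborel a \<noteq> \<infinity>"
    using lborel.sigma_finite_countable by blast
  then show "\<exists>A :: 'a set set. countable A \<and> A \<subseteq> sets lebesgue \<and> \<Union>A = space lebesgue \<and>
      (\<forall>a\<in>A. emeasure lebesgue a \<noteq> \<infinity>)"
    by (intro exI[of _ A]) (auto simp: subset_eq)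
qed

text \<open>
  Bump functions converge boundedly to the indicator of the box, so orthogonality to test functions passes to
  the box by dominated convergence.
\<close>

lemma integral_box_eq_0:
  fixes h :: "'a::euclidean_space \<Rightarrow> 'b::euclidean_space"
  assumes U: "open U" and K: "cbox a b \<subseteq> U"
    and int: "h absolutely_integrable_on cbox a b"
    and orth: "\<And>\<phi>. \<phi> \<in> test_functions U \<Longrightarrow> (\<integral>x. \<phi> x *\<^sub>R h x \<partial>lebesgue_on U) = 0"
  shows "(\<integral>x. indicator (box a b) x *\<^sub>R h x \<partial>lebesgue) = 0"
proof -
  let ?h = "\<lambda>x. indicator (cbox a b) x *\<^sub>R h x"
  have h: "integrable lebesgue ?h"
    using int by (simp add: set_integrable_def)
  have hm: "?h \<in> borel_measurable lebesgue"
    by (rule borel_measurable_integrable[OF h])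
  have meas: "box_bump a b n \<in> borel_measurable lebesgue" for n
    by (intro continuous_imp_lebesgue_measurable test_function_continuous[OF box_bump_test_function[OF K]])
  have zero: "(\<integral>x. box_bump a b n x *\<^sub>R ?h x \<partial>lebesgue) = 0" for n
  proof -
    have "(\<integral>x. box_bump a b n x *\<^sub>R ?h x \<partial>lebesgue)
        = (\<integral>x. indicator U x *\<^sub>R (box_bump a b n x *\<^sub>R h x) \<partial>lebesgue)"
      using K box_bump_eq_0_iff[of a b n] box_subset_cbox[of a b]
      by (intro Bochner_Integration.integral_cong) (auto split: split_indicator)
    also have "\<dots> = 0"
      using orth[OF box_bump_test_function[OF K]] U
      by (simp add: integral_restrict_space)
    finally show ?thesis .
  qed
  have "(\<lambda>n. \<integral>x. box_bump a b n x *\<^sub>R ?h x \<partial>lebesgue)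
      \<longlonglongrightarrow> (\<integral>x. indicator (box a b) x *\<^sub>R ?h x \<partial>lebesgue)"
  proof (rule integral_dominated_convergence[where w = "\<lambda>x. norm (?h x)"])
    show "AE x in lebesgue. (\<lambda>n. box_bump a b n x *\<^sub>R ?h x)
        \<longlonglongrightarrow> indicat_real (box a b) x *\<^sub>R ?h x"
      by (intro AE_I2 tendsto_intros box_bump_tendsto)
    show "AE x in lebesgue. norm (box_bump a b n x *\<^sub>R ?h x) \<le> norm (?h x)" for n
    proof (rule AE_I2)
      fix x
      have "\<bar>box_bump a b n x\<bar> * norm (?h x) \<le> 1 * norm (?h x)"
        using box_bump_bounds[of a b n x] by (intro mult_right_mono) auto
      then show "norm (box_bump a b n x *\<^sub>R ?h x) \<le> norm (?h x)"
        by (simp only: norm_scaleR real_norm_def mult_1)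
    qed
    show "(\<lambda>x. indicat_real (box a b) x *\<^sub>R ?h x) \<in> borel_measurable lebesgue"
      by (intro borel_measurable_scaleR[OF _ hm] borel_measurable_indicator) auto
    show "(\<lambda>x. box_bump a b n x *\<^sub>R ?h x) \<in> borel_measurable lebesgue" for n
      by (rule borel_measurable_scaleR[OF meas hm])
    show "integrable lebesgue (\<lambda>x. norm (?h x))"
      using h by (rule integrable_norm)
  qed
  then have "(\<integral>x. indicator (box a b) x *\<^sub>R ?h x \<partial>lebesgue) = 0"
    unfolding zero by (simp only: LIMSEQ_const_iff)
  moreover have "indicator (box a b) x *\<^sub>R ?h x = indicator (box a b) x *\<^sub>R h x" for x
    using box_subset_cbox[of a b] by (auto split: split_indicator)
  ultimately show ?thesis
    by (simp del: scaleR_scaleR)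
qed

text \<open>
  Open boxes form an intersection-stable generator of the Borel sets, so by Dynkin's argument the integral of \<open>f\<close>
  vanishes over every measurable set.
\<close>

lemma AE_zero_if_integral_boxes_eq_0:
  fixes f :: "'a::euclidean_space \<Rightarrow> 'b::euclidean_space"
  assumes f: "integrable lebesgue f"
    and total: "integral\<^sup>L lebesgue f = 0"
    and box: "\<And>a b. (\<integral>x. indicator (box a b) x *\<^sub>R f x \<partial>lebesgue) = 0"
  shows "AE x in lebesgue. f x = 0"
proof (rule sigma_finite_measure.density_zero[OF sigma_finite_lebesgue f])
  have ii: "integrable lebesgue (\<lambda>x. indicator A x *\<^sub>R f x)" if "A \<in> sets lebesgue" for A
    using f that by (rule integrable_mult_indicator[rotated])
  have borel: "(\<integral>x. indicator A x *\<^sub>R f x \<partial>lebesgue) = 0" if "A \<in> sets borel" for A :: "'a set"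
  proof -
    let ?E = "range (\<lambda>(a, b). box a b :: 'a set)"
    have "Int_stable ?E"
      by (auto simp: Int_stable_def box_Int_box)
    moreover have "?E \<subseteq> Pow UNIV"
      by simp
    moreover have "A \<in> sigma_sets UNIV ?E"
      using that by (simp add: borel_eq_box)
    ultimately show ?thesis
    proof (induction rule: sigma_sets_induct_disjoint)
      case (compl A)
      then have "A \<in> sets borel" by (simp add: borel_eq_box)
      then have A: "A \<in> sets lebesgue" by simp
      have "(\<integral>x. indicator (UNIV - A) x *\<^sub>R f x \<partial>lebesgue)
          = (\<integral>x. f x - indicator A x *\<^sub>R f x \<partial>lebesgue)"
        by (intro Bochner_Integration.integral_cong) (auto split: split_indicator)
      also have "\<dots> = 0"
        using compl total ii[OF A] f by simp
      finally show ?case .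
    next
      case (union A)
      then have "range A \<subseteq> sets borel"
        by (simp add: borel_eq_box)
      then have A: "A i \<in> sets lebesgue" for i
        by auto
      have "set_integrable lebesgue (\<Union>i. A i) f"
        using ii A unfolding set_integrable_def by auto
      then have "(LINT x:(\<Union>i. A i)|lebesgue. f x) = (\<Sum>i. (LINT x:(A i)|lebesgue. f x))"
        using union(1) A by (intro lebesgue_integral_countable_add) (auto simp: disjoint_family_on_def)
      then show ?case
        using union(3) by (simp add: set_lebesgue_integral_def)
    qed (use box in auto)
  qed
  show "set_lebesgue_integral lebesgue A f = 0" if A: "A \<in> sets lebesgue" for A
  proof -
    obtain S N N' where S: "A = S \<union> N" "N \<subseteq> N'" "N' \<in> null_sets lborel" "S \<in> sets lborel"
      using A by (auto elim: sets_completionE)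
    then have "AE x in lebesgue. x \<notin> N'"
      by (intro AE_completion AE_not_in) 
    then have "AE x in lebesgue. indicator A x *\<^sub>R f x = indicator S x *\<^sub>R f x"
      by eventually_elim (use S in \<open>auto split: split_indicator\<close>)
    then have "(\<integral>x. indicator A x *\<^sub>R f x \<partial>lebesgue) = (\<integral>x. indicator S x *\<^sub>R f x \<partial>lebesgue)"
      using A S by (intro integral_cong_AE borel_measurable_integrable[OF ii]) auto
    then show ?thesis
      using borel[of S] S by (simp add: set_lebesgue_integral_def)
  qed
qed

text \<open>
  The open set is a countable union of closed boxes. On one of them the integrals over all smaller boxes vanish,
  hence so does the function; the boundary of the box is a null set.
\<close>

lemma fundamental_lemma_calculus_of_variations:
  fixes h :: "'a::euclidean_space \<Rightarrow> 'b::euclidean_space"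
  assumes U: "open U"
    and int: "\<And>K. compact K \<Longrightarrow> K \<subseteq> U \<Longrightarrow> h absolutely_integrable_on K"
    and orth: "\<And>\<phi>. \<phi> \<in> test_functions U \<Longrightarrow> (\<integral>x. \<phi> x *\<^sub>R h x \<partial>lebesgue_on U) = 0"
  shows "AE x in lebesgue. x \<in> U \<longrightarrow> h x = 0"
proof -
  have local: "AE x in lebesgue. x \<in> cbox c d \<longrightarrow> h x = 0" if K: "cbox c d \<subseteq> U" for c d
  proof -
    let ?f = "\<lambda>x. indicator (box c d) x *\<^sub>R h x"
    have zero: "(\<integral>x. indicator (box a b) x *\<^sub>R h x \<partial>lebesgue) = 0" if "box a b \<subseteq> box c d" for a b
    proof (cases "box a b = {}")
      case False
      then have "cbox a b \<subseteq> cbox c d"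
        using that by (metis closure_box closure_mono False closure_empty subset_empty)
      then show ?thesis
        using K by (intro integral_box_eq_0[OF U _ _ orth] int) auto
    qed simp
    have "AE x in lebesgue. ?f x = 0"
    proof (rule AE_zero_if_integral_boxes_eq_0)
      have "set_integrable lebesgue (box c d) h"
        by (rule set_integrable_subset[OF int[OF compact_cbox K] _ box_subset_cbox]) simp
      then show "integrable lebesgue ?f"
        by (simp add: set_integrable_def)
      show "integral\<^sup>L lebesgue ?f = 0"
        by (rule zero) simp
      show "(\<integral>x. indicator (box a b) x *\<^sub>R ?f x \<partial>lebesgue) = 0" for a b
      proof -
        obtain a' b' where "box a b \<inter> box c d = box a' b'"
          unfolding box_Int_box by blast
        moreover have "indicator (box a b) x *\<^sub>R ?f x = indicator (box a b \<inter> box c d) x *\<^sub>R h x" for x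
          by (auto split: split_indicator)
        ultimately show ?thesis
          using zero[of a' b'] by (simp del: scaleR_scaleR) blast
      qed
    qed
    moreover have "AE x in lebesgue. x \<notin> cbox c d - box c d"
      using negligible_frontier_interval[of c d] by (intro AE_not_in) (simp add: negligible_iff_null_sets)
    ultimately show ?thesis
      by eventually_elim (auto simp: indicator_def split: if_splits)
  qed
  obtain D where D: "countable D" "D \<subseteq> Pow U" "\<forall>X\<in>D. \<exists>a b. X = cbox a b" "\<Union>D = U"
    by (rule open_countable_Union_open_cbox[OF U], rule that) auto
  have "AE x in lebesgue. \<forall>X\<in>D. x \<in> X \<longrightarrow> h x = 0"
  proof (subst AE_ball_countable[OF D(1)], intro ballI)
    fix X assume X: "X \<in> D"
    then obtain c d where cd: "X = cbox c d"
      using D(3) by blast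
    show "AE x in lebesgue. x \<in> X \<longrightarrow> h x = 0"
      using local[of c d] D(2) X unfolding cd by auto
  qed
  then show ?thesis
    by eventually_elim (use D(4) in auto)
qed

text \<open>
  The difference of two weak gradients is orthogonal to all test functions.
\<close>

lemma weak_gradient_unique:
  fixes u :: "'a::euclidean_space \<Rightarrow> real"
  assumes U: "open U" and g: "has_weak_gradient U u g" and g': "has_weak_gradient U u g'"
  shows "AE x in lebesgue. x \<in> U \<longrightarrow> g x = g' x"
proof -
  have "AE x in lebesgue. x \<in> U \<longrightarrow> g x - g' x = 0"
  proof (rule fundamental_lemma_calculus_of_variations[OF U])
    show "(\<lambda>x. g x - g' x) absolutely_integrable_on K" if "compact K" "K \<subseteq> U" for K
      using g g' that unfolding has_weak_gradient_def by (auto intro: set_integral_diff)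
    fix \<phi> assume \<phi>: "\<phi> \<in> test_functions U"
    have int: "integrable (lebesgue_on U) (\<lambda>x. \<phi> x *\<^sub>R g x)" if g: "has_weak_gradient U u g" for g
    proof -
      let ?K = "closure {x. \<phi> x \<noteq> 0}"
      have K: "compact ?K" "?K \<subseteq> U" and cont: "continuous_on UNIV \<phi>"
        using \<phi> test_function_continuous[OF \<phi>] by (auto simp: test_functions_def)
      have gK: "g absolutely_integrable_on ?K"
        using g K by (auto simp: has_weak_gradient_def)
      obtain B where B: "\<And>x. x \<in> ?K \<Longrightarrow> norm (\<phi> x) \<le> B"
        using compact_imp_bounded[OF compact_continuous_image[OF continuous_on_subset[OF cont] K(1)]]
        by (auto simp: bounded_iff)
      have "integrable lebesgue (\<lambda>x. \<phi> x *\<^sub>R (indicator ?K x *\<^sub>R g x))"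
      proof (rule Bochner_Integration.integrable_bound)
        show "integrable lebesgue (\<lambda>x. B *\<^sub>R (indicator ?K x *\<^sub>R g x))"
          using gK by (intro integrable_scaleR_right) (simp add: set_integrable_def)
        have "\<phi> \<in> borel_measurable lebesgue"
          by (rule continuous_imp_lebesgue_measurable[OF cont])
        then show "(\<lambda>x. \<phi> x *\<^sub>R (indicator ?K x *\<^sub>R g x)) \<in> borel_measurable lebesgue"
          by (rule borel_measurable_scaleR)
            (use gK in \<open>simp add: set_integrable_def borel_measurable_integrable\<close>)
        show "AE x in lebesgue. norm (\<phi> x *\<^sub>R (indicator ?K x *\<^sub>R g x))
            \<le> norm (B *\<^sub>R (indicator ?K x *\<^sub>R g x))"
          using B by (intro AE_I2) (fastforce split: split_indicator intro!: mult_right_mono)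
      qed
      also have "(\<lambda>x. \<phi> x *\<^sub>R (indicator ?K x *\<^sub>R g x)) = (\<lambda>x. indicator U x *\<^sub>R (\<phi> x *\<^sub>R g x))"
        using K closure_subset[of "{x. \<phi> x \<noteq> 0}"] by (auto split: split_indicator simp: fun_eq_iff)
      finally show ?thesis
        using U by (simp add: integrable_restrict_space)
    qed
    have "(\<integral>x. \<phi> x *\<^sub>R g x \<partial>lebesgue_on U) = (\<integral>x. \<phi> x *\<^sub>R g' x \<partial>lebesgue_on U)"
      using g g' \<phi> unfolding has_weak_gradient_def by (metis neg_equal_iff_equal)
    then show "(\<integral>x. \<phi> x *\<^sub>R (g x - g' x) \<partial>lebesgue_on U) = 0"
      using int[OF g] int[OF g'] by (simp add: scaleR_diff_right)
  qed
  then show ?thesis by simp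
qed

lemma AE_weak_gradient_eq:
  assumes "open U" "has_weak_gradient U u g"
  shows "AE x in lebesgue. x \<in> U \<longrightarrow> weak_gradient U u x = g x"
proof -
  have "has_weak_gradient U u (weak_gradient U u)"
    unfolding weak_gradient_def by (rule someI[of _ g]) (rule assms(2))
  then show ?thesis
    using weak_gradient_unique assms by blast
qed

section \<open>Test functions as Sobolev functions\<close>

abbreviation supp :: "('a::topological_space \<Rightarrow> real) \<Rightarrow> 'a set" where
  "supp f \<equiv> closure {x. f x \<noteq> 0}"

lemma AE_eq_imp_lebesgue_measurable:
  fixes f g :: "'a::euclidean_space \<Rightarrow> 'b::topological_space"
  assumes f: "f \<in> borel_measurable lebesgue" and eq: "AE x in lebesgue. g x = f x"
  shows "g \<in> borel_measurable lebesgue"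
proof (rule measurableI)
  fix S :: "'b set" assume S: "S \<in> sets borel"
  obtain N where N: "N \<in> null_sets lebesgue" "{x. g x \<noteq> f x} \<subseteq> N"
    using eq by (auto simp: eventually_ae_filter)
  have "g -` S \<inter> space lebesgue = (f -` S \<inter> space lebesgue - N) \<union> (g -` S \<inter> N)"
  proof (intro set_eqI)
    show "x \<in> g -` S \<inter> space lebesgue \<longleftrightarrow> x \<in> (f -` S \<inter> space lebesgue - N) \<union> (g -` S \<inter> N)" for x
      using N(2) by (cases "x \<in> N"; cases "g x = f x") auto
  qed
  moreover have "g -` S \<inter> N \<in> null_sets lebesgue"
    using N(1) by (rule null_sets_completion_subset[rotated]) simp
  moreover have "f -` S \<inter> space lebesgue - N \<in> sets lebesgue"
    using measurable_sets[OF f S] null_setsD2[OF N(1)] by (rule sets.Diff)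
  ultimately show "g -` S \<inter> space lebesgue \<in> sets lebesgue"
    using null_setsD2 by (metis sets.Un)
qed simp

text \<open>
  Every choice of weak gradient agrees almost everywhere with one in \<open>L\<^sup>p\<close>, and completeness of the Lebesgue measure
  transfers measurability.
\<close>

lemma weak_gradient_works:
  assumes U: "open U" and u: "u \<in> W1p p U"
  shows "has_weak_gradient U u (weak_gradient U u)" "weak_gradient U u \<in> Lp p U"
proof -
  obtain g where g: "g \<in> Lp p U" "has_weak_gradient U u g"
    using u by (auto simp: W1p_def)
  show "has_weak_gradient U u (weak_gradient U u)"
    unfolding weak_gradient_def by (rule someI[of _ g]) (rule g(2))
  have ae: "AE x in lebesgue. x \<in> U \<longrightarrow> weak_gradient U u x = g x"
    by (rule AE_weak_gradient_eq[OF U g(2)])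
  have meas: "weak_gradient U u \<in> borel_measurable (lebesgue_on U)"
  proof -
    have "(\<lambda>x. indicator U x *\<^sub>R g x) \<in> borel_measurable lebesgue"
      using g(1) U by (simp add: Lp_def borel_measurable_restrict_space_iff)
    moreover have "AE x in lebesgue. indicator U x *\<^sub>R weak_gradient U u x = indicator U x *\<^sub>R g x"
      using ae by eventually_elim (auto split: split_indicator)
    ultimately have "(\<lambda>x. indicator U x *\<^sub>R weak_gradient U u x) \<in> borel_measurable lebesgue"
      by (rule AE_eq_imp_lebesgue_measurable)
    then show ?thesis
      using U by (simp add: borel_measurable_restrict_space_iff)
  qed
  moreover have "integrable (lebesgue_on U) (\<lambda>x. norm (weak_gradient U u x) powr p)"
  proof (rule integrable_cong_AE_imp)
    show "integrable (lebesgue_on U) (\<lambda>x. norm (g x) powr p)"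
      using g(1) by (simp add: Lp_def)
    show "AE x in lebesgue_on U. norm (g x) powr p = norm (weak_gradient U u x) powr p"
      using ae U by (subst AE_restrict_space_iff) auto
  qed (use meas in measurable)
  ultimately show "weak_gradient U u \<in> Lp p U"
    by (simp add: Lp_def)
qed

lemma has_derivative_gradient:
  assumes "f differentiable (at x)"
  shows "(f has_derivative (\<lambda>h. gradient f x \<bullet> h)) (at x)"
proof -
  have lin: "linear (frechet_derivative f (at x))"
    by (rule linear_frechet_derivative[OF assms])
  have "frechet_derivative f (at x) h = gradient f x \<bullet> h" for h
  proof -
    have "frechet_derivative f (at x) h = frechet_derivative f (at x) (\<Sum>b\<in>Basis. (h \<bullet> b) *\<^sub>R b)"
      by (simp add: euclidean_representation)
    also have "\<dots> = (\<Sum>b\<in>Basis. (h \<bullet> b) * frechet_derivative f (at x) b)"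
      by (simp add: linear_sum[OF lin] linear_scale[OF lin])
    also have "\<dots> = gradient f x \<bullet> h"
      unfolding gradient_def inner_sum_left inner_scaleR_left
      by (simp add: inner_commute mult.commute)
    finally show ?thesis .
  qed
  then have "frechet_derivative f (at x) = (\<lambda>h. gradient f x \<bullet> h)"
    by blast
  then show ?thesis
    using assms by (simp add: frechet_derivative_works)
qed

lemma gradient_eqI:
  assumes "(f has_derivative (\<lambda>h. g \<bullet> h)) (at x)"
  shows "gradient f x = g"
  by (simp add: gradient_def frechet_derivative_at[OF assms, symmetric] euclidean_representation)

text \<open>
  The derivative is carried along as an explicit function so that products and differences can be formed
  without computing gradients, and the compact set \<open>S\<close> only has to contain the support.
\<close>

definition C1_with_gradient :: "('a::euclidean_space \<Rightarrow> real) \<Rightarrow> ('a \<Rightarrow> 'a) \<Rightarrow> 'a set \<Rightarrow> bool" where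
  "C1_with_gradient f g S \<longleftrightarrow>
     (\<forall>x. (f has_derivative (\<lambda>h. g x \<bullet> h)) (at x)) \<and> continuous_on UNIV g \<and>
     compact S \<and> (\<forall>x. x \<notin> S \<longrightarrow> f x = 0 \<and> g x = 0)"

lemma Ck_continuous_gradient: "(\<And>k. Ck k f) \<Longrightarrow> continuous_on UNIV (gradient f)"
  using Ck.simps(2)[of 0 f] unfolding gradient_def[abs_def]
  by (intro continuous_intros) auto

lemma test_function_has_derivative:
  assumes "\<phi> \<in> test_functions U"
  shows "(\<phi> has_derivative (\<lambda>h. gradient \<phi> x \<bullet> h)) (at x)"
proof -
  have "Ck (Suc 0) \<phi>" using assms unfolding test_functions_def by blast
  then show ?thesis by (intro has_derivative_gradient) simp
qed

lemma gradient_eq_0_outside: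
  assumes d: "(f has_derivative (\<lambda>h. g \<bullet> h)) (at x)" and S: "closed S" "x \<notin> S"
    and z: "\<And>y. y \<notin> S \<Longrightarrow> f y = 0"
  shows "g = 0"
proof -
  have "(f has_derivative (\<lambda>h. 0)) (at x)"
    by (rule has_derivative_transform_within_open[of "\<lambda>_. 0" _ _ _ "- S"]) (use S z in auto)
  from has_derivative_unique[OF d this] show ?thesis
    by (metis inner_eq_zero_iff)
qed

lemma test_function_C1:
  assumes "\<phi> \<in> test_functions U"
  shows "C1_with_gradient \<phi> (gradient \<phi>) (supp \<phi>)"
proof -
  have z: "\<phi> x = 0" if "x \<notin> supp \<phi>" for x
    using that closure_subset[of "{x. \<phi> x \<noteq> 0}"] by auto
  have g: "gradient \<phi> x = 0" if "x \<notin> supp \<phi>" for x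
    by (rule gradient_eq_0_outside[OF test_function_has_derivative[OF assms] _ that z]) auto
  have "continuous_on UNIV (gradient \<phi>)" "compact (supp \<phi>)"
    using assms Ck_continuous_gradient[of \<phi>] unfolding test_functions_def by blast+
  then show ?thesis
    unfolding C1_with_gradient_def using test_function_has_derivative[OF assms] z g by blast
qed

lemma integrable_continuous_compact_support:
  fixes f :: "'a::euclidean_space \<Rightarrow> 'b::euclidean_space"
  assumes "continuous_on UNIV f" "compact S" "\<And>x. x \<notin> S \<Longrightarrow> f x = 0"
  shows "integrable lborel f" "integrable lebesgue f"
proof -
  have "integrable lborel (\<lambda>x. indicator S x *\<^sub>R f x)"
    using assms by (intro borel_integrable_compact) (auto intro: continuous_on_subset)
  also have "(\<lambda>x. indicator S x *\<^sub>R f x) = f"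
    using assms(3) by (auto simp: fun_eq_iff split: split_indicator)
  finally show "integrable lborel f" .
  then show "integrable lebesgue f"
    by (subst integrable_completion) auto
qed

lemma integral_lborel_translate:
  fixes f :: "'a::euclidean_space \<Rightarrow> real"
  assumes [measurable]: "f \<in> borel_measurable borel"
  shows "(\<integral>x. f (x + c) \<partial>lborel) = integral\<^sup>L lborel f"
proof -
  have "integral\<^sup>L lborel f = integral\<^sup>L (distr lborel borel ((+) c)) f"
    by (simp add: lborel_distr_plus)
  also have "\<dots> = (\<integral>x. f (c + x) \<partial>lborel)"
    by (rule integral_distr) auto
  finally show ?thesis by (simp add: add.commute)
qed

lemma C1_Lipschitz:
  assumes "C1_with_gradient f g S" 
  shows "\<exists>B\<ge>0. (\<forall>x. norm (g x) \<le> B) \<and> (\<forall>x y. \<bar>f x - f y\<bar> \<le> B * norm (x - y))"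
proof -
  have S: "compact S" and g: "continuous_on UNIV g" and d: "\<And>x. (f has_derivative (\<lambda>h. g x \<bullet> h)) (at x)"
    and z: "\<And>x. x \<notin> S \<Longrightarrow> g x = 0"
    using assms by (auto simp: C1_with_gradient_def)
  have "bounded (g ` S)"
    by (intro compact_imp_bounded compact_continuous_image continuous_on_subset[OF g] S) auto
  then obtain B where B: "B > 0" "\<And>x. x \<in> S \<Longrightarrow> norm (g x) \<le> B"
    by (auto simp: bounded_pos)
  have gB: "norm (g x) \<le> B" for x
    using B z[of x] by (cases "x \<in> S") auto
  have "norm (f x - f y) \<le> B * norm (x - y)" for x y
  proof (rule differentiable_bound[of UNIV f "\<lambda>x h. g x \<bullet> h"])
    show "onorm (\<lambda>h. g x \<bullet> h) \<le> B" for x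
    proof (rule onorm_le)
      show "norm (g x \<bullet> h) \<le> B * norm h" for h
        using Cauchy_Schwarz_ineq2[of "g x" h] gB[of x]
        by (metis mult_right_mono norm_ge_zero order_trans real_norm_def)
    qed
  qed (use d in auto)
  then show ?thesis
    using B(1) gB by (intro exI[of _ B]) simp
qed

lemma difference_quotient_tendsto:
  fixes f :: "'a::euclidean_space \<Rightarrow> real"
  assumes d: "(f has_derivative (\<lambda>h. g \<bullet> h)) (at x)"
  shows "((\<lambda>t. (f (x + t *\<^sub>R h) - f x) / t) \<longlongrightarrow> g \<bullet> h) (at 0)"
proof -
  have 0: "((\<lambda>t. x + t *\<^sub>R h) has_derivative (\<lambda>t. t *\<^sub>R h)) (at 0)"
    by (auto intro!: derivative_eq_intros)
  have "((\<lambda>t. f (x + t *\<^sub>R h)) has_derivative (\<lambda>t. g \<bullet> (t *\<^sub>R h))) (at 0)"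
    using has_derivative_compose[OF 0, of f "\<lambda>h. g \<bullet> h"] d by simp
  then have "((\<lambda>t. f (x + t *\<^sub>R h)) has_real_derivative g \<bullet> h) (at 0)"
    by (simp add: has_field_derivative_def mult.commute[of _ "g \<bullet> h"])
  then show ?thesis
    by (simp add: has_field_derivative_iff)
qed

text \<open>
  Integration by parts in its simplest form: by translation invariance the difference quotients in a direction \<open>b\<close>
  have integral zero, and they converge to the partial derivative, dominated by the Lipschitz constant on a
  large ball.
\<close>

lemma integral_gradient_eq_0:
  fixes f :: "'a::euclidean_space \<Rightarrow> real"
  assumes C1: "C1_with_gradient f g S"
  shows "integral\<^sup>L lebesgue g = 0"
proof -
  have S: "compact S" and g: "continuous_on UNIV g" and d: "\<And>x. (f has_derivative (\<lambda>h. g x \<bullet> h)) (at x)"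
    and z: "\<And>x. x \<notin> S \<Longrightarrow> f x = 0" "\<And>x. x \<notin> S \<Longrightarrow> g x = 0"
    using C1 by (auto simp: C1_with_gradient_def)
  obtain B where B: "B \<ge> 0" "\<forall>x y. \<bar>f x - f y\<bar> \<le> B * norm (x - y)"
    using C1_Lipschitz[OF C1] by auto
  obtain R where R: "\<And>x. x \<in> S \<Longrightarrow> norm x \<le> R"
    using compact_imp_bounded[OF S] by (auto simp: bounded_iff)
  have f: "continuous_on UNIV f"
    by (rule has_derivative_continuous_on[where f' = "\<lambda>x h. g x \<bullet> h"]) (simp add: d)
  then have fm [measurable]: "f \<in> borel_measurable borel"
    by (rule borel_measurable_continuous_onI)
  have intf: "integrable lborel f" and intg: "integrable lebesgue g"
    using integrable_continuous_compact_support[OF f S z(1)]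
      integrable_continuous_compact_support[OF g S z(2)] by auto
  have comp: "integral\<^sup>L lebesgue g \<bullet> b = 0" if b: "b \<in> Basis" for b
  proof -
    let ?q = "\<lambda>n x. real (Suc n) * (f (x + inverse (real (Suc n)) *\<^sub>R b) - f x)"
    have "(\<lambda>n. \<integral>x. ?q n x \<partial>lborel) \<longlonglongrightarrow> (\<integral>x. g x \<bullet> b \<partial>lborel)"
    proof (rule integral_dominated_convergence[where w = "\<lambda>x. B * indicator (cball 0 (R + 1)) x"])
      have "(\<lambda>x. g x) \<in> borel_measurable borel"
        using g by (rule borel_measurable_continuous_onI)
      then show "(\<lambda>x. g x \<bullet> b) \<in> borel_measurable lborel"
        by measurable
      show "?q n \<in> borel_measurable lborel" for n
        by measurable
      have "emeasure lborel (cball (0::'a) (R + 1)) < \<infinity>"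
        by (rule emeasure_lborel_cball_finite)
      then show "integrable lborel (\<lambda>x::'a. B * indicator (cball 0 (R + 1)) x)"
        by (intro integrable_mult_right integrable_real_indicator) auto
      show "AE x in lborel. (\<lambda>n. ?q n x) \<longlonglongrightarrow> g x \<bullet> b"
      proof (rule AE_I2)
        fix x
        note lim = difference_quotient_tendsto[OF d, of x b]
        have "filterlim (\<lambda>n. inverse (real (Suc n))) (at 0) sequentially"
          using LIMSEQ_inverse_real_of_nat by (simp add: filterlim_at)
        from filterlim_compose[OF lim this] show "(\<lambda>n. ?q n x) \<longlonglongrightarrow> g x \<bullet> b"
          by (simp add: field_simps)
      qed
      show "AE x in lborel. norm (?q n x) \<le> B * indicator (cball 0 (R + 1)) x" for n
      proof (rule AE_I2)
        fix x
        let ?t = "inverse (real (Suc n))"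
        have t: "norm (?t *\<^sub>R b) \<le> 1" "real (Suc n) * norm (?t *\<^sub>R b) = 1"
          using b by (auto simp: inverse_eq_divide)
        show "norm (?q n x) \<le> B * indicator (cball 0 (R + 1)) x"
        proof (cases "x \<in> cball 0 (R + 1)")
          case True
          have "norm (?q n x) = real (Suc n) * \<bar>f (x + ?t *\<^sub>R b) - f x\<bar>"
            by (simp add: abs_mult)
          also have "\<dots> \<le> real (Suc n) * (B * norm (?t *\<^sub>R b))"
            using B(2)[rule_format, of "x + ?t *\<^sub>R b" x] by (intro mult_left_mono) auto
          also have "\<dots> = B" using t(2) by (metis mult.commute mult.left_commute mult.right_neutral)
          finally show ?thesis using True by simp
        next
          case False
          then have "norm x > R + 1" by simp
          moreover have "norm x \<le> norm (x + ?t *\<^sub>R b) + norm (?t *\<^sub>R b)"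
            by (metis add_diff_cancel_right' norm_triangle_ineq4)
          ultimately have "x \<notin> S" "x + ?t *\<^sub>R b \<notin> S"
            using R[of x] R[of "x + ?t *\<^sub>R b"] t(1) by linarith+
          then show ?thesis using z B(1) by simp
        qed
      qed
    qed
    moreover have "(\<integral>x. ?q n x \<partial>lborel) = 0" for n
    proof -
      have "integrable lborel (\<lambda>x. f (x + c))" for c
        using intf by (subst (asm) lborel_distr_plus[symmetric, of c])
          (auto dest!: integrable_distr[rotated] simp: add.commute)
      then show ?thesis
        using intf integral_lborel_translate[OF fm] by simp
    qed
    ultimately have "(\<integral>x. g x \<bullet> b \<partial>lborel) = 0"
      by (simp add: LIMSEQ_const_iff)
    moreover have "(\<lambda>x. g x \<bullet> b) \<in> borel_measurable borel"
      using g by (intro borel_measurable_continuous_onI continuous_intros)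
    ultimately have "(\<integral>x. g x \<bullet> b \<partial>lebesgue) = 0"
      by (simp add: integral_completion)
    then show ?thesis
      using intg by simp
  qed
  show ?thesis
    by (rule euclidean_eqI) (simp only: comp inner_zero_left)
qed

lemma continuous_C1: "C1_with_gradient f g S \<Longrightarrow> continuous_on UNIV f"
  unfolding C1_with_gradient_def
  by (rule has_derivative_continuous_on[where f' = "\<lambda>x h. g x \<bullet> h"]) simp

lemma integral_lebesgue_on_eq_UNIV:
  fixes f :: "'a::euclidean_space \<Rightarrow> 'b::euclidean_space"
  assumes "V \<in> sets lebesgue" "\<And>x. x \<notin> V \<Longrightarrow> f x = 0"
  shows "integral\<^sup>L (lebesgue_on V) f = integral\<^sup>L lebesgue f"
proof -
  have "(\<lambda>x. indicator V x *\<^sub>R f x) = f"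
    using assms(2) by (auto simp: fun_eq_iff split: split_indicator)
  then show ?thesis
    using assms(1) by (simp add: integral_restrict_space)
qed

text \<open>
  The product \<open>f \<psi>\<close> with a test function has compact support, so the integral of its gradient vanishes.
\<close>

lemma C1_has_weak_gradient:
  assumes f: "C1_with_gradient f g S" and V: "open V"
  shows "has_weak_gradient V f g"
proof -
  have d: "(f has_derivative (\<lambda>h. g x \<bullet> h)) (at x)" and g: "continuous_on UNIV g" for x
    using f by (auto simp: C1_with_gradient_def)
  have fc: "continuous_on UNIV f"
    by (rule continuous_C1[OF f])
  show ?thesis
    unfolding has_weak_gradient_def
  proof (intro conjI allI impI ballI)
    fix K assume K: "compact K \<and> K \<subseteq> V"
    have "k absolutely_integrable_on K" if k: "continuous_on UNIV k" for k :: "'a \<Rightarrow> 'b::euclidean_space"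
    proof -
      have "integrable lborel (\<lambda>x. indicator K x *\<^sub>R k x)"
        using K by (intro borel_integrable_compact continuous_on_subset[OF k]) auto
      then show ?thesis
        unfolding set_integrable_def by (subst integrable_completion) (auto dest: borel_measurable_integrable)
    qed
    then show "f absolutely_integrable_on K" "g absolutely_integrable_on K"
      using g fc by blast+
  next
    fix \<psi> assume \<psi>: "\<psi> \<in> test_functions V"
    define T where "T = supp \<psi>"
    have V': "V \<in> sets lebesgue" using V by simp
    have \<psi>1: "C1_with_gradient \<psi> (gradient \<psi>) T"
      unfolding T_def by (rule test_function_C1[OF \<psi>])
    then have \<psi>d: "(\<psi> has_derivative (\<lambda>h. gradient \<psi> x \<bullet> h)) (at x)"
      and z: "x \<notin> T \<Longrightarrow> \<psi> x = 0" "x \<notin> T \<Longrightarrow> gradient \<psi> x = 0"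
      and gc: "continuous_on UNIV (gradient \<psi>)" and S: "compact T" for x
      unfolding C1_with_gradient_def by blast+
    have SV: "T \<subseteq> V"
      using \<psi> by (simp add: test_functions_def T_def)
    note \<psi>c = continuous_C1[OF \<psi>1]
    have "((\<lambda>x. f x * \<psi> x) has_derivative (\<lambda>h. (f x *\<^sub>R gradient \<psi> x + \<psi> x *\<^sub>R g x) \<bullet> h)) (at x)" for x
    proof -
      have "((\<lambda>x. f x * \<psi> x) has_derivative (\<lambda>h. f x * (gradient \<psi> x \<bullet> h) + (g x \<bullet> h) * \<psi> x)) (at x)"
        by (rule has_derivative_mult[OF d \<psi>d])
      then show ?thesis
        by (simp add: inner_add_left mult.commute[of "\<psi> x"])
    qed
    then have "C1_with_gradient (\<lambda>x. f x * \<psi> x) (\<lambda>x. f x *\<^sub>R gradient \<psi> x + \<psi> x *\<^sub>R g x) T"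
      using z S unfolding C1_with_gradient_def
      by (auto intro!: continuous_intros fc \<psi>c gc g)
    then have "(\<integral>x. f x *\<^sub>R gradient \<psi> x + \<psi> x *\<^sub>R g x \<partial>lebesgue) = 0"
      by (rule integral_gradient_eq_0)
    moreover have "integrable lebesgue (\<lambda>x. f x *\<^sub>R gradient \<psi> x)"
      by (rule integrable_continuous_compact_support[OF _ S]) (use z in \<open>auto intro!: continuous_intros fc gc\<close>)
    moreover have "integrable lebesgue (\<lambda>x. \<psi> x *\<^sub>R g x)"
      by (rule integrable_continuous_compact_support[OF _ S]) (use z in \<open>auto intro!: continuous_intros \<psi>c g\<close>)
    ultimately have "(\<integral>x. f x *\<^sub>R gradient \<psi> x \<partial>lebesgue) = - (\<integral>x. \<psi> x *\<^sub>R g x \<partial>lebesgue)"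
      by (simp add: eq_neg_iff_add_eq_0)
    moreover have "(\<integral>x. f x *\<^sub>R gradient \<psi> x \<partial>lebesgue_on V) = (\<integral>x. f x *\<^sub>R gradient \<psi> x \<partial>lebesgue)"
      using SV z by (intro integral_lebesgue_on_eq_UNIV[OF V']) auto
    moreover have "(\<integral>x. \<psi> x *\<^sub>R g x \<partial>lebesgue_on V) = (\<integral>x. \<psi> x *\<^sub>R g x \<partial>lebesgue)"
      using SV z by (intro integral_lebesgue_on_eq_UNIV[OF V']) auto
    ultimately show "(\<integral>x. f x *\<^sub>R gradient \<psi> x \<partial>lebesgue_on V) = - (\<integral>x. \<psi> x *\<^sub>R g x \<partial>lebesgue_on V)"
      by simp
  qed
qed

lemma continuous_compact_support_Lp:
  fixes f :: "'a::euclidean_space \<Rightarrow> 'b::euclidean_space"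
  assumes "continuous_on UNIV f" "compact S" "\<And>x. x \<notin> S \<Longrightarrow> f x = 0" "p > 0" "open V"
  shows "f \<in> Lp p V"
proof -
  have "continuous_on UNIV (\<lambda>x. norm (f x) powr p)"
    using assms(1,4) by (intro continuous_on_powr' continuous_intros) auto
  then have "integrable lebesgue (\<lambda>x. norm (f x) powr p)"
    by (rule integrable_continuous_compact_support[OF _ assms(2)]) (use assms(3) in auto)
  then have "integrable (lebesgue_on V) (\<lambda>x. norm (f x) powr p)"
    using assms(5) by (simp add: integrable_restrict_space integrable_mult_indicator flip: real_scaleR_def)
  moreover have "f \<in> borel_measurable (lebesgue_on V)"
    using continuous_imp_lebesgue_measurable[OF assms(1)] by (rule measurable_restrict_space1)
  ultimately show ?thesis by (simp add: Lp_def)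
qed

lemma test_function_in_Lp:
  assumes \<phi>: "\<phi> \<in> test_functions U" and V: "open V" and p: "p > 0"
  shows "\<phi> \<in> Lp p V" "gradient \<phi> \<in> Lp p V"
proof -
  define T where "T = supp \<phi>"
  have C1: "C1_with_gradient \<phi> (gradient \<phi>) T"
    unfolding T_def by (rule test_function_C1[OF \<phi>])
  from C1 have S: "compact T"
    and z: "\<And>x. x \<notin> T \<Longrightarrow> \<phi> x = 0" "\<And>x. x \<notin> T \<Longrightarrow> gradient \<phi> x = 0"
    and g: "continuous_on UNIV (gradient \<phi>)"
    unfolding C1_with_gradient_def by blast+
  show "\<phi> \<in> Lp p V"
    by (rule continuous_compact_support_Lp[OF continuous_C1[OF C1] S z(1) p V])
  show "gradient \<phi> \<in> Lp p V"
    by (rule continuous_compact_support_Lp[OF g S z(2) p V])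
qed

lemma test_function_Lp:
  assumes \<phi>: "\<phi> \<in> test_functions U" and p: "p > 0"
  shows "\<phi> \<in> borel_measurable lebesgue" "integrable lebesgue (\<lambda>x. \<bar>\<phi> x\<bar> powr p)"
    and "gradient \<phi> \<in> borel_measurable lebesgue" "integrable lebesgue (\<lambda>x. norm (gradient \<phi> x) powr p)"
  using test_function_in_Lp[OF \<phi> open_UNIV p] by (simp_all add: Lp_def lebesgue_on_UNIV_eq)

lemma test_function_W1p:
  assumes \<phi>: "\<phi> \<in> test_functions U" and V: "open V" and p: "p > 0"
  shows "\<phi> \<in> W1p p V"
  using test_function_in_Lp[OF \<phi> V p] C1_has_weak_gradient[OF test_function_C1[OF \<phi>] V]
  by (auto simp: W1p_def)

text \<open>
  The constant sequence approximates the test function, because the chosen weak gradient is the classical one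
  almost everywhere.
\<close>

lemma test_function_X_space:
  assumes \<phi>: "\<phi> \<in> test_functions \<Omega>" and \<Omega>: "open \<Omega>" and p: "p > 0"
  shows "\<phi> \<in> X_space p \<Omega>"
proof -
  have ae: "AE x in lebesgue_on \<Omega>. weak_gradient \<Omega> \<phi> x = gradient \<phi> x"
    using AE_weak_gradient_eq[OF \<Omega> C1_has_weak_gradient[OF test_function_C1[OF \<phi>] \<Omega>]] \<Omega>
    by (simp add: AE_restrict_space_iff)
  have "(\<integral>x. norm (gradient \<phi> x - weak_gradient \<Omega> \<phi> x) powr p \<partial>lebesgue_on \<Omega>) = 0"
    by (rule integral_eq_zero_AE) (use ae in eventually_elim, simp)
  then have "\<phi> \<in> W01p p \<Omega>"
    using test_function_W1p[OF \<phi> \<Omega> p] \<phi> unfolding W01p_def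
    by (auto intro!: exI[of _ "\<lambda>_. \<phi>"])
  moreover have "\<phi> x = 0" if "x \<notin> \<Omega>" for x
    using \<phi> that closure_subset[of "{x. \<phi> x \<noteq> 0}"] by (auto simp: test_functions_def)
  ultimately show ?thesis
    using test_function_W1p[OF \<phi> open_UNIV p] by (auto simp: X_space_def)
qed

lemma test_function_scale:
  assumes "\<phi> \<in> test_functions U"
  shows "(\<lambda>x. c * \<phi> x) \<in> test_functions U"
proof -
  have "{x. c * \<phi> x \<noteq> 0} \<subseteq> {x. \<phi> x \<noteq> 0}" by auto
  from closure_mono[OF this] assms show ?thesis
    by (auto simp: test_functions_def simp del: mult_eq_0_iff
        intro!: Ck_mult Ck_const intro: bounded_subset)
qed

section \<open>Convexity inequalities and convergence of p-th powers\<close>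

text \<open>
  Strict convexity of \<open>t\<^sup>p\<close> on the half-line, obtained from the mean value theorem because \<open>t\<^bsup>p-1\<^esup>\<close> increases strictly.
\<close>

lemma powr_gt_tangent:
  fixes y m p :: real
  assumes p: "p > 1" and y: "y \<ge> 0" and m: "m \<ge> 0" and ne: "y \<noteq> m"
  shows "m powr p + p * m powr (p - 1) * (y - m) < y powr p"
proof -
  have mv: "\<exists>z. a < z \<and> z < b \<and> b powr p - a powr p = (b - a) * (p * z powr (p - 1))"
    if "0 \<le> a" "a < b" for a b :: real
  proof -
    have "continuous_on {a..b} (\<lambda>x. x powr p)"
      using that p by (intro continuous_on_powr' continuous_intros) auto
    moreover have d: "((\<lambda>x. x powr p) has_real_derivative p * x powr (p - 1)) (at x)" if "a < x" for x
      using that \<open>0 \<le> a\<close> by (intro has_real_derivative_powr) simp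
    then have "(\<lambda>x. x powr p) differentiable (at x)" if "a < x" "x < b" for x
      using that real_differentiable_def by blast
    ultimately obtain l z where "a < z" "z < b" "((\<lambda>x. x powr p) has_real_derivative l) (at z)"
      "b powr p - a powr p = (b - a) * l"
      using MVT[OF \<open>a < b\<close>, of "\<lambda>x. x powr p"] by blast
    then show ?thesis
      using DERIV_unique[OF _ d] by blast
  qed
  show ?thesis
  proof (cases "m < y")
    case True
    then obtain z where z: "m < z" "y powr p - m powr p = (y - m) * (p * z powr (p - 1))"
      using mv[OF m] by blast
    have "m powr (p - 1) < z powr (p - 1)"
      using z(1) m p by (intro powr_less_mono2) auto
    then have "(y - m) * (p * m powr (p - 1)) < (y - m) * (p * z powr (p - 1))"
      using True p by simp
    then show ?thesis using z(2) by (simp add: mult_ac)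
  next
    case False
    with ne have ym: "y < m" by simp
    then obtain z where z: "y < z" "z < m" "m powr p - y powr p = (m - y) * (p * z powr (p - 1))"
      using mv[OF y] by blast
    have "z powr (p - 1) < m powr (p - 1)"
      using z y p by (intro powr_less_mono2) auto
    then have "(m - y) * (p * z powr (p - 1)) < (m - y) * (p * m powr (p - 1))"
      using ym p by simp
    then show ?thesis using z(3) by (simp add: algebra_simps)
  qed
qed

lemma powr_ge_tangent:
  fixes y m p :: real
  assumes "p > 1" "y \<ge> 0" "m \<ge> 0"
  shows "m powr p + p * m powr (p - 1) * (y - m) \<le> y powr p"
  using powr_gt_tangent[OF assms] by (cases "y = m") auto

lemma powr_convex_nonneg:
  fixes a b l p :: real
  assumes p: "p > 1" and l: "0 < l" "l < 1" and ab: "a \<ge> 0" "b \<ge> 0"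
  shows "(l * a + (1 - l) * b) powr p \<le> l * a powr p + (1 - l) * b powr p"
    and "a \<noteq> b \<Longrightarrow> (l * a + (1 - l) * b) powr p < l * a powr p + (1 - l) * b powr p"
proof -
  let ?m = "l * a + (1 - l) * b"
  have m: "?m \<ge> 0" using l ab by simp
  have split: "l * (?m powr p + p * ?m powr (p - 1) * (a - ?m))
      + (1 - l) * (?m powr p + p * ?m powr (p - 1) * (b - ?m)) = ?m powr p"
  proof -
    have "l * (q + r * (a - m)) + (1 - l) * (q + r * (b - m)) = q + r * (?m - m)" for q r m
      by (simp add: algebra_simps)
    then show ?thesis by simp
  qed
  have 1: "l * (?m powr p + p * ?m powr (p - 1) * (a - ?m)) \<le> l * a powr p"
    using l powr_ge_tangent[OF p ab(1) m] by (intro mult_left_mono) auto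
  have 2: "(1 - l) * (?m powr p + p * ?m powr (p - 1) * (b - ?m)) \<le> (1 - l) * b powr p"
    using l powr_ge_tangent[OF p ab(2) m] by (intro mult_left_mono) auto
  show "?m powr p \<le> l * a powr p + (1 - l) * b powr p"
    using 1 2 split by linarith
  show "?m powr p < l * a powr p + (1 - l) * b powr p" if "a \<noteq> b"
  proof -
    have "a - ?m = (1 - l) * (a - b)" by algebra
    then have "a \<noteq> ?m" using that l by auto
    then have "l * (?m powr p + p * ?m powr (p - 1) * (a - ?m)) < l * a powr p"
      using l powr_gt_tangent[OF p ab(1) m] by (intro mult_strict_left_mono) auto
    then show ?thesis using 2 split by linarith
  qed
qed

text \<open>
  In case of equality strict convexity on the half-line gives \<open>|a| = |b|\<close>, and opposite signs would make the
  combination strictly shorter.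
\<close>

lemma abs_powr_convex:
  fixes a b l p :: real
  assumes p: "p > 1" and l: "0 < l" "l < 1"
  shows "\<bar>l * a + (1 - l) * b\<bar> powr p \<le> l * \<bar>a\<bar> powr p + (1 - l) * \<bar>b\<bar> powr p"
    and "\<bar>l * a + (1 - l) * b\<bar> powr p = l * \<bar>a\<bar> powr p + (1 - l) * \<bar>b\<bar> powr p \<Longrightarrow> a = b"
proof -
  let ?m = "\<bar>l * a + (1 - l) * b\<bar>" and ?M = "l * \<bar>a\<bar> + (1 - l) * \<bar>b\<bar>"
  have mM: "?m \<le> ?M"
    using abs_triangle_ineq[of "l * a" "(1 - l) * b"] l by (simp add: abs_mult)
  then have 1: "?m powr p \<le> ?M powr p"
    using p by (intro powr_mono2) auto
  note 2 = powr_convex_nonneg[OF p l abs_ge_zero abs_ge_zero, of a b]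
  show "?m powr p \<le> l * \<bar>a\<bar> powr p + (1 - l) * \<bar>b\<bar> powr p"
    using 1 2(1) by linarith
  assume eq: "?m powr p = l * \<bar>a\<bar> powr p + (1 - l) * \<bar>b\<bar> powr p"
  have ab: "\<bar>a\<bar> = \<bar>b\<bar>"
    using 1 2(2) eq by linarith
  have "\<not> ?m < ?M"
    using powr_less_mono2[of p ?m ?M] p eq 2(1) by auto
  with mM have "?m = ?M" by simp
  show "a = b"
  proof (rule ccontr)
    assume "a \<noteq> b"
    with ab have b: "b = - a" "a \<noteq> 0" by (auto simp: abs_if split: if_splits)
    have "?m = \<bar>2 * l - 1\<bar> * \<bar>a\<bar>"
      unfolding b abs_mult[symmetric] by (simp add: algebra_simps)
    moreover have "?M = \<bar>a\<bar>"
      unfolding b by (simp add: algebra_simps)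
    ultimately have "\<bar>2 * l - 1\<bar> = 1"
      using \<open>?m = ?M\<close> b(2) by simp
    then show False using l by linarith
  qed
qed

definition lp_norm :: "real \<Rightarrow> real \<Rightarrow> real \<Rightarrow> real" where
  "lp_norm p a b = (\<bar>a\<bar> powr p + \<bar>b\<bar> powr p) powr (1 / p)"

lemma lp_norm_nonneg: "0 \<le> lp_norm p a b"
  by (simp add: lp_norm_def)

lemma lp_norm_powr: "p > 1 \<Longrightarrow> lp_norm p a b powr p = \<bar>a\<bar> powr p + \<bar>b\<bar> powr p"
  by (simp add: lp_norm_def powr_powr add_nonneg_nonneg)

lemma lp_norm_eq_0_iff: "p > 1 \<Longrightarrow> lp_norm p a b = 0 \<longleftrightarrow> a = 0 \<and> b = 0"
  by (auto simp: lp_norm_def add_nonneg_eq_0_iff)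

lemma lp_norm_le_iff:
  assumes "p > 1" "c \<ge> 0"
  shows "lp_norm p a b \<le> c \<longleftrightarrow> \<bar>a\<bar> powr p + \<bar>b\<bar> powr p \<le> c powr p"
proof -
  have "lp_norm p a b \<le> c \<longleftrightarrow> lp_norm p a b powr p \<le> c powr p"
    using assms lp_norm_nonneg[of p a b]
    by (metis less_trans not_less powr_less_mono2 powr_mono2 less_imp_le zero_less_one)
  then show ?thesis using lp_norm_powr[OF assms(1)] by simp
qed

text \<open>
  With \<open>l\<close> the share of the first vector in the sum of the norms, the normalised sum is a convex combination of two
  unit vectors, and convexity of \<open>|t|\<^sup>p\<close> in each coordinate gives Minkowski's inequality. In case of equality both
  coordinates are equality cases, so the two unit vectors coincide.
\<close>

lemma lp_norm_triangle:
  assumes p: "p > 1"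
  shows "lp_norm p (a + c) (b + d) \<le> lp_norm p a b + lp_norm p c d"
    and "lp_norm p (a + c) (b + d) = lp_norm p a b + lp_norm p c d \<Longrightarrow> a * d = b * c"
proof -
  let ?x = "lp_norm p a b" and ?y = "lp_norm p c d"
  show "lp_norm p (a + c) (b + d) \<le> ?x + ?y"
    and "lp_norm p (a + c) (b + d) = ?x + ?y \<Longrightarrow> a * d = b * c"
  proof (atomize(full), cases "?x = 0 \<or> ?y = 0")
    case True
    then have "(a = 0 \<and> b = 0) \<or> (c = 0 \<and> d = 0)"
      using lp_norm_eq_0_iff[OF p] by blast
    then show "lp_norm p (a + c) (b + d) \<le> ?x + ?y \<and>
        (lp_norm p (a + c) (b + d) = ?x + ?y \<longrightarrow> a * d = b * c)"
      using lp_norm_nonneg[of p] by auto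
  next
    case False
    then have x: "?x > 0" and y: "?y > 0"
      using lp_norm_nonneg[of p] by (auto simp: less_le)
    define l where "l = ?x / (?x + ?y)"
    have l: "0 < l" "l < 1" and l': "1 - l = ?y / (?x + ?y)"
      using x y by (auto simp: l_def field_simps)
    have comb: "l * (r / ?x) + (1 - l) * (t / ?y) = (r + t) / (?x + ?y)" for r t
      unfolding l' unfolding l_def using x y by (simp add: add_divide_distrib)
    have pow: "\<bar>r / z\<bar> powr p = \<bar>r\<bar> powr p / z powr p" if "z > 0" for r z
      using that by (simp add: abs_divide powr_divide)
    have unit: "\<bar>a / ?x\<bar> powr p + \<bar>b / ?x\<bar> powr p = 1" "\<bar>c / ?y\<bar> powr p + \<bar>d / ?y\<bar> powr p = 1"
      unfolding pow[OF x] pow[OF y] add_divide_distrib[symmetric] lp_norm_powr[OF p, symmetric]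
      using x y by auto
    note A = abs_powr_convex[OF p l, of "a / ?x" "c / ?y", unfolded comb]
    note B = abs_powr_convex[OF p l, of "b / ?x" "d / ?y", unfolded comb]
    have tot: "l * \<bar>a / ?x\<bar> powr p + (1 - l) * \<bar>c / ?y\<bar> powr p
        + (l * \<bar>b / ?x\<bar> powr p + (1 - l) * \<bar>d / ?y\<bar> powr p) = 1"
    proof -
      have "l * q1 + (1 - l) * q2 + (l * q3 + (1 - l) * q4) = l * (q1 + q3) + (1 - l) * (q2 + q4)" for q1 q2 q3 q4
        by algebra
      then show ?thesis using unit by simp
    qed
    have xy: "?x + ?y > 0" using x y by simp
    have sum: "\<bar>(a + c) / (?x + ?y)\<bar> powr p + \<bar>(b + d) / (?x + ?y)\<bar> powr p
        = (\<bar>a + c\<bar> powr p + \<bar>b + d\<bar> powr p) / (?x + ?y) powr p"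
      unfolding pow[OF xy] by (simp add: add_divide_distrib)
    have le: "(\<bar>a + c\<bar> powr p + \<bar>b + d\<bar> powr p) / (?x + ?y) powr p \<le> 1"
      using A(1) B(1) tot sum by linarith
    then have 1: "lp_norm p (a + c) (b + d) \<le> ?x + ?y"
      using p xy by (subst lp_norm_le_iff) (auto simp: divide_le_eq)
    have "a * d = b * c" if eq: "lp_norm p (a + c) (b + d) = ?x + ?y"
    proof -
      have "(\<bar>a + c\<bar> powr p + \<bar>b + d\<bar> powr p) / (?x + ?y) powr p = 1"
        unfolding eq[symmetric] lp_norm_powr[OF p, symmetric] using eq xy by simp
      then have "\<bar>(a + c) / (?x + ?y)\<bar> powr p = l * \<bar>a / ?x\<bar> powr p + (1 - l) * \<bar>c / ?y\<bar> powr p"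
        "\<bar>(b + d) / (?x + ?y)\<bar> powr p = l * \<bar>b / ?x\<bar> powr p + (1 - l) * \<bar>d / ?y\<bar> powr p"
        using A(1) B(1) tot sum by linarith+
      then have ac: "a / ?x = c / ?y" "b / ?x = d / ?y"
        using A(2) B(2) by blast+
      have "u * d = v * c" if "u / X = c / Y" "v / X = d / Y" "X > 0" "Y > 0" for u v X Y
      proof -
        have "u = X * (c / Y)" "v = X * (d / Y)"
          using that(3) by (simp_all flip: that(1,2))
        then show ?thesis by simp
      qed
      from this[OF ac x y] show ?thesis .
    qed
    with 1 show "lp_norm p (a + c) (b + d) \<le> ?x + ?y \<and>
        (lp_norm p (a + c) (b + d) = ?x + ?y \<longrightarrow> a * d = b * c)"
      by blast
  qed
qed

lemma lp_norm_minus: "lp_norm p (a - b) (c - d) = lp_norm p (b - a) (d - c)"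
  by (simp add: lp_norm_def abs_minus_commute)

text \<open>
  This is the convexity estimate for the nonlocal energy: the reverse triangle inequality for the vectors
  \<open>(a, b)\<close> and \<open>(c, d)\<close>, with linear dependence in the case of equality.
\<close>

lemma lp_norm_diff_powr_le:
  assumes p: "p > 1"
  shows "\<bar>lp_norm p a b - lp_norm p c d\<bar> powr p \<le> \<bar>a - c\<bar> powr p + \<bar>b - d\<bar> powr p"
    and "\<bar>lp_norm p a b - lp_norm p c d\<bar> powr p = \<bar>a - c\<bar> powr p + \<bar>b - d\<bar> powr p \<Longrightarrow> a * d = b * c"
proof -
  let ?n = "lp_norm p (a - c) (b - d)"
  have 1: "lp_norm p a b \<le> lp_norm p c d + ?n" "lp_norm p a b = lp_norm p c d + ?n \<Longrightarrow> a * d = b * c"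
    using lp_norm_triangle[OF p, of c "a - c" d "b - d"] by (auto simp: algebra_simps)
  have 2: "lp_norm p c d \<le> lp_norm p a b + ?n" "lp_norm p c d = lp_norm p a b + ?n \<Longrightarrow> a * d = b * c"
    using lp_norm_triangle[OF p, of a "c - a" b "d - b"] lp_norm_minus[of p a c b d]
    by (auto simp: algebra_simps)
  have le: "\<bar>lp_norm p a b - lp_norm p c d\<bar> \<le> ?n"
    using 1(1) 2(1) by linarith
  then show "\<bar>lp_norm p a b - lp_norm p c d\<bar> powr p \<le> \<bar>a - c\<bar> powr p + \<bar>b - d\<bar> powr p"
    using p powr_mono2[of p _ ?n] lp_norm_powr[OF p] by (metis abs_ge_zero less_imp_le less_trans zero_less_one)
  assume "\<bar>lp_norm p a b - lp_norm p c d\<bar> powr p = \<bar>a - c\<bar> powr p + \<bar>b - d\<bar> powr p"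
  then have "\<not> \<bar>lp_norm p a b - lp_norm p c d\<bar> < ?n"
    using powr_less_mono2[of p "\<bar>lp_norm p a b - lp_norm p c d\<bar>" ?n] p lp_norm_powr[OF p, of "a - c" "b - d"]
    by auto
  with le have "lp_norm p a b = lp_norm p c d + ?n \<or> lp_norm p c d = lp_norm p a b + ?n"
    by linarith
  with 1(2) 2(2) show "a * d = b * c" by blast
qed

text \<open>
  Convexity applied to \<open>|a| \<le> |b| + |a - b|\<close>. As \<open>l\<close> tends to 1 the factor of \<open>|b|\<^sup>p\<close> tends to 1, which is what makes
  the \<open>p\<close>-th power of the \<open>L\<^sup>p\<close> norm continuous.
\<close>

lemma norm_powr_le_split:
  fixes a b :: "'b::real_normed_vector"
  assumes p: "p > 1" and l: "0 < l" "l < 1"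
  shows "norm a powr p \<le> l powr (1 - p) * norm b powr p + (1 - l) powr (1 - p) * norm (a - b) powr p"
proof -
  have "norm a \<le> l * (norm b / l) + (1 - l) * (norm (a - b) / (1 - l))"
    using l norm_triangle_sub[of a b] by simp
  then have "norm a powr p \<le> (l * (norm b / l) + (1 - l) * (norm (a - b) / (1 - l))) powr p"
    using p by (intro powr_mono2) auto
  also have "\<dots> \<le> l * (norm b / l) powr p + (1 - l) * (norm (a - b) / (1 - l)) powr p"
    using l by (intro powr_convex_nonneg(1)[OF p l]) auto
  also have "\<dots> = l powr (1 - p) * norm b powr p + (1 - l) powr (1 - p) * norm (a - b) powr p"
    using l by (simp add: powr_divide powr_diff)
  finally show ?thesis .
qed

lemma norm_add_powr_le:
  fixes a b :: "'b::real_normed_vector"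
  assumes p: "p > 1"
  shows "norm (a + b) powr p \<le> 2 powr p * (norm a powr p + norm b powr p)"
proof -
  have "norm (a + b) powr p \<le> (1/2) powr (1 - p) * norm a powr p + (1/2) powr (1 - p) * norm b powr p"
    using norm_powr_le_split[OF p, of "1/2" "a + b" a] by simp
  also have "(1/2) powr (1 - p) \<le> (1/2) powr (- p)"
    using powr_mono'[of "- p" "1 - p" "1/2"] by simp
  then have "(1/2) powr (1 - p) * norm a powr p + (1/2) powr (1 - p) * norm b powr p
      \<le> (1/2) powr (- p) * norm a powr p + (1/2) powr (- p) * norm b powr p"
    by (intro add_mono mult_right_mono) auto
  also have "(1/2) powr (- p) = 2 powr p"
    by (simp add: powr_minus powr_divide)
  finally show ?thesis by (simp add: distrib_left)
qed

lemma integrable_norm_diff_powr: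
  fixes f g :: "'b \<Rightarrow> 'c::{banach, second_countable_topology}"
  assumes p: "p > 1"
    and [measurable]: "f \<in> borel_measurable M" "g \<in> borel_measurable M"
    and int: "integrable M (\<lambda>x. norm (f x) powr p)" "integrable M (\<lambda>x. norm (g x) powr p)"
  shows "integrable M (\<lambda>x. norm (f x - g x) powr p)"
proof (rule Bochner_Integration.integrable_bound)
  show "integrable M (\<lambda>x. 2 powr p * (norm (f x) powr p + norm (g x) powr p))"
    using int by (intro integrable_mult_right Bochner_Integration.integrable_add) auto
  show "AE x in M. norm (norm (f x - g x) powr p) \<le> norm (2 powr p * (norm (f x) powr p + norm (g x) powr p))"
  proof (rule AE_I2)
    fix x
    show "norm (norm (f x - g x) powr p) \<le> norm (2 powr p * (norm (f x) powr p + norm (g x) powr p))"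
      using norm_add_powr_le[OF p, of "f x" "- g x"] by simp
  qed
qed measurable

text \<open>
  For a fixed \<open>l\<close> close to 1 the splitting estimate, used in both directions, bounds the difference of the two
  integrals by a small multiple of a bound \<open>B\<close> for both plus a multiple of \<open>\<integral>|f\<^sub>k - f|\<^sup>p\<close>.
\<close>

lemma tendsto_integral_norm_powr:
  fixes f :: "'b \<Rightarrow> 'c::{banach, second_countable_topology}"
  assumes p: "p > 1"
    and [measurable]: "\<And>k. fk k \<in> borel_measurable M" "f \<in> borel_measurable M"
    and int: "\<And>k. integrable M (\<lambda>x. norm (fk k x) powr p)" "integrable M (\<lambda>x. norm (f x) powr p)"
    and lim: "(\<lambda>k. \<integral>x. norm (fk k x - f x) powr p \<partial>M) \<longlonglongrightarrow> 0"
  shows "(\<lambda>k. \<integral>x. norm (fk k x) powr p \<partial>M) \<longlonglongrightarrow> (\<integral>x. norm (f x) powr p \<partial>M)"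
proof -
  define a where "a = (\<lambda>k. \<integral>x. norm (fk k x) powr p \<partial>M)"
  define b where "b = (\<integral>x. norm (f x) powr p \<partial>M)"
  define d where "d = (\<lambda>k. \<integral>x. norm (fk k x - f x) powr p \<partial>M)"
  have intd: "integrable M (\<lambda>x. norm (fk k x - f x) powr p)" for k
    by (rule integrable_norm_diff_powr[OF p _ _ int]) measurable
  have pos: "a k \<ge> 0" "b \<ge> 0" "d k \<ge> 0" for k
    by (auto simp: a_def b_def d_def)
  have d0: "d \<longlonglongrightarrow> 0" using lim by (simp add: d_def)
  define c :: "real \<Rightarrow> real" where "c = (\<lambda>l. (1 - l) powr (1 - p))"
  have up: "a k \<le> l powr (1 - p) * b + c l * d k" "b \<le> l powr (1 - p) * a k + c l * d k"
    if l: "0 < l" "l < 1" for l k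
  proof -
    have "a k \<le> (\<integral>x. l powr (1 - p) * norm (f x) powr p + c l * norm (fk k x - f x) powr p \<partial>M)"
      unfolding a_def c_def
      by (intro integral_mono norm_powr_le_split[OF p l] Bochner_Integration.integrable_add integrable_mult_right int intd)
    then show "a k \<le> l powr (1 - p) * b + c l * d k"
      using int intd by (simp add: b_def d_def)
    have "b \<le> (\<integral>x. l powr (1 - p) * norm (fk k x) powr p + c l * norm (fk k x - f x) powr p \<partial>M)"
      unfolding b_def c_def norm_minus_commute[of "fk k _"]
      by (intro integral_mono norm_powr_le_split[OF p l] Bochner_Integration.integrable_add integrable_mult_right int
          intd[unfolded norm_minus_commute[of "fk k _" for k]])
    then show "b \<le> l powr (1 - p) * a k + c l * d k"
      using int intd by (simp add: a_def d_def)
  qed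
  have "a \<longlonglongrightarrow> b"
  proof (rule LIMSEQ_I)
    fix e :: real assume e: "e > 0"
    \<comment> \<open>A common bound for \<open>b\<close> and, eventually, all \<open>a k\<close>, from the splitting with \<open>l = 1/2\<close>.\<close>
    define B where "B = (1/2) powr (1 - p) * b + 1"
    have B: "B > 0" "b \<le> B"
    proof -
      have "1 \<le> (1/2 :: real) powr (1 - p)"
        using powr_mono'[of "1 - p" 0 "1/2"] p by simp
      from mult_right_mono[OF this pos(2)] show "B > 0" "b \<le> B"
        using pos(2) by (auto simp: B_def)
    qed
    have "((\<lambda>l::real. l powr (1 - p)) \<longlongrightarrow> 1 powr (1 - p)) (at_left 1)"
      by (intro tendsto_intros) auto
    then have "\<forall>\<^sub>F l :: real in at_left 1. l powr (1 - p) < 1 + e / (2 * B)"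
      using e B by (intro order_tendstoD) auto
    moreover have "\<forall>\<^sub>F l :: real in at_left 1. l \<in> {0<..<1}"
      by (rule eventually_at_leftI[of 0]) auto
    ultimately have "\<forall>\<^sub>F l :: real in at_left 1. l powr (1 - p) < 1 + e / (2 * B) \<and> l \<in> {0<..<1}"
      by (rule eventually_conj)
    then obtain l where l: "l powr (1 - p) < 1 + e / (2 * B)" "0 < l" "l < 1"
      using eventually_happens'[of "at_left (1::real)"] by fastforce
    have l1: "(l powr (1 - p) - 1) * B \<le> e / 2"
      using l(1) B by (simp add: field_simps)
    have l0: "0 \<le> l powr (1 - p) - 1"
      using powr_mono'[of "1 - p" 0 l] l p by simp
    have c0: "c q \<ge> 0" for q by (simp add: c_def)
    have "(\<lambda>k. c (1/2) * d k) \<longlonglongrightarrow> 0" "(\<lambda>k. c l * d k) \<longlonglongrightarrow> 0"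
      using tendsto_mult_right_zero[OF d0] by auto
    from order_tendstoD(2)[OF this(1), of 1] order_tendstoD(2)[OF this(2), of "e / 2"]
    have "\<forall>\<^sub>F k in sequentially. c (1/2) * d k < 1" "\<forall>\<^sub>F k in sequentially. c l * d k < e / 2"
      using e by simp_all
    then have "\<forall>\<^sub>F k in sequentially. norm (a k - b) < e"
    proof eventually_elim
      case (elim k)
      have aB: "a k \<le> B" using up(1)[of "1/2" k] elim(1) by (simp add: B_def)
      have "a k - b \<le> (l powr (1 - p) - 1) * b + c l * d k"
        using up(1)[OF l(2,3), of k] by (simp add: algebra_simps)
      moreover have "(l powr (1 - p) - 1) * b \<le> (l powr (1 - p) - 1) * B"
        using B(2) l0 by (rule mult_left_mono)
      moreover have "b - a k \<le> (l powr (1 - p) - 1) * a k + c l * d k"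
        using up(2)[OF l(2,3), of k] by (simp add: algebra_simps)
      moreover have "(l powr (1 - p) - 1) * a k \<le> (l powr (1 - p) - 1) * B"
        using aB l0 by (rule mult_left_mono)
      ultimately show ?case using l1 elim(2) by (simp add: abs_less_iff)
    qed
    then show "\<exists>no. \<forall>n\<ge>no. norm (a n - b) < e"
      by (simp add: eventually_sequentially)
  qed
  then show ?thesis by (simp add: a_def b_def)
qed

section \<open>The sharp Hardy inequality\<close>

text \<open>
  The fundamental theorem of calculus along the segment, followed by Jensen's inequality for the measure with
  density \<open>w\<close>. A general weight \<open>w\<close> serves two purposes: \<open>w = 1\<close> bounds translates of \<open>f\<close>, and a power of \<open>t\<close> on a ray
  leads to the sharp Hardy constant.
\<close>

lemma C1_difference_along_segment:
  assumes C1: "C1_with_gradient f g S" and p: "p > 1" and ab: "a \<le> b"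
    and w: "continuous_on {a..b} w" "\<And>t. t \<in> {a..b} \<Longrightarrow> w t > 0"
    and M: "integral {a..b} w \<le> M" "M > 0"
  shows "ennreal (\<bar>f (x + b *\<^sub>R h) - f (x + a *\<^sub>R h)\<bar> powr p)
    \<le> ennreal (norm h powr p * M powr (p - 1)) *
      (\<integral>\<^sup>+t. ennreal ((norm (g (x + t *\<^sub>R h)) / w t) powr p * w t) * indicator {a..b} t \<partial>lborel)"
proof -
  let ?\<Delta> = "f (x + b *\<^sub>R h) - f (x + a *\<^sub>R h)" and ?\<gamma> = "\<lambda>t. g (x + t *\<^sub>R h)"
  let ?T = "\<lambda>m t. p * m powr (p - 1) * norm (?\<gamma> t) - (p - 1) * m powr p * w t"
  have d: "(f has_derivative (\<lambda>h. g y \<bullet> h)) (at y)" and g: "continuous_on UNIV g" for y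
    using C1 by (auto simp: C1_with_gradient_def)
  define k where "k = (\<lambda>t. norm (?\<gamma> t) / w t)"
  have gl: "continuous_on {a..b} (\<lambda>t. ?\<gamma> t)"
    by (rule continuous_on_compose2[OF g]) (auto intro!: continuous_intros)
  have w0: "\<forall>t\<in>{a..b}. w t \<noteq> 0"
    using w(2) by fastforce
  have kc: "continuous_on {a..b} k"
    unfolding k_def by (intro continuous_intros gl w w0)
  have k0: "k t \<ge> 0" if "t \<in> {a..b}" for t
    using w(2)[OF that] by (simp add: k_def)
  have kpc: "continuous_on {a..b} (\<lambda>t. k t powr p * w t)"
    using kc k0 p by (intro continuous_intros continuous_on_powr' w) auto
  define I where "I = integral {a..b} (\<lambda>t. norm (?\<gamma> t))"
  define K where "K = integral {a..b} (\<lambda>t. k t powr p * w t)"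
  define W where "W = integral {a..b} w"
  have I0: "I \<ge> 0"
    unfolding I_def by (intro integral_nonneg integrable_continuous_interval continuous_intros gl) auto
  have "\<bar>?\<Delta>\<bar> \<le> norm h * I"
  proof -
    have vd: "((\<lambda>t. f (x + t *\<^sub>R h)) has_vector_derivative ?\<gamma> t \<bullet> h) (at t within {a..b})" for t
    proof -
      have 0: "((\<lambda>t. x + t *\<^sub>R h) has_derivative (\<lambda>t. t *\<^sub>R h)) (at t within {a..b})"
        by (auto intro!: derivative_eq_intros)
      have "((\<lambda>t. f (x + t *\<^sub>R h)) has_derivative (\<lambda>r. ?\<gamma> t \<bullet> (r *\<^sub>R h))) (at t within {a..b})"
        by (rule has_derivative_compose[OF 0 d])
      then show ?thesis
        by (simp add: has_vector_derivative_def)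
    qed
    have "((\<lambda>t. ?\<gamma> t \<bullet> h) has_integral (?\<Delta>)) {a..b}"
      by (rule fundamental_theorem_of_calculus[OF ab vd])
    then have "norm (?\<Delta>) = norm (integral {a..b} (\<lambda>t. ?\<gamma> t \<bullet> h))"
      by (simp add: integral_unique)
    also have "\<dots> \<le> integral {a..b} (\<lambda>t. norm h * norm (?\<gamma> t))"
    proof (rule Henstock_Kurzweil_Integration.integral_norm_bound_integral)
      show "norm (?\<gamma> t \<bullet> h) \<le> norm h * norm (?\<gamma> t)" for t
        using Cauchy_Schwarz_ineq2[of "?\<gamma> t" h] by (simp add: mult.commute)
    qed (intro integrable_continuous_interval continuous_intros gl)+
    also have "\<dots> = norm h * I" by (simp add: I_def)
    finally show ?thesis by simp
  qed
  then have "\<bar>?\<Delta>\<bar> powr p \<le> (norm h * I) powr p"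
    using p by (intro powr_mono2) auto
  also have "\<dots> = norm h powr p * I powr p"
    using I0 by (simp add: powr_mult)
  also have "\<dots> \<le> norm h powr p * (M powr (p - 1) * K)"
  proof (rule mult_left_mono)
    \<comment> \<open>Jensen's inequality, by integrating the tangent of \<open>t\<^sup>p\<close> at the mean value \<open>m\<close>.\<close>
    define m where "m = I / M"
    have m: "m \<ge> 0" "I = m * M" using I0 M(2) by (auto simp: m_def)
    have mm: "m powr (p - 1) * m = m powr p"
      using m(1) by (cases "m = 0") (simp_all add: powr_diff)
    have "m powr p * (p * M - (p - 1) * W) \<le> K"
    proof -
      have "integral {a..b} (?T m) \<le> K"
        unfolding K_def
      proof (rule integral_le)
        fix t assume t: "t \<in> {a..b}"
        have "(m powr p + p * m powr (p - 1) * (k t - m)) * w t \<le> k t powr p * w t"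
          using w(2)[OF t] powr_ge_tangent[OF p k0[OF t] m(1)] by (intro mult_right_mono) auto
        moreover have "(m powr p + p * m powr (p - 1) * (k t - m)) * w t
            = p * m powr (p - 1) * (k t * w t) - (p - 1) * m powr p * w t"
          by (simp add: algebra_simps flip: mm)
        moreover have "k t * w t = norm (?\<gamma> t)"
          using w(2)[OF t] by (simp add: k_def)
        ultimately show "?T m t
            \<le> k t powr p * w t" by simp
      qed (intro integrable_continuous_interval continuous_intros gl w kpc)+
      also have "integral {a..b} (?T m)
          = p * m powr (p - 1) * I - (p - 1) * m powr p * W"
        unfolding I_def W_def
        by (subst Henstock_Kurzweil_Integration.integral_diff)
          (auto intro!: integrable_continuous_interval continuous_intros gl w)
      also have "p * m powr (p - 1) * I - (p - 1) * m powr p * W = m powr p * (p * M - (p - 1) * W)"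
        unfolding m(2) by (simp add: algebra_simps flip: mm)
      finally show ?thesis .
    qed
    moreover have "m powr p * M \<le> m powr p * (p * M - (p - 1) * W)"
    proof (rule mult_left_mono)
      have "(p - 1) * W \<le> (p - 1) * M"
        using M p unfolding W_def by (intro mult_left_mono) auto
      then show "M \<le> p * M - (p - 1) * W" by (simp add: algebra_simps)
    qed simp
    ultimately have "m powr p * M \<le> K" by linarith
    then have "M powr (p - 1) * (m powr p * M) \<le> M powr (p - 1) * K"
      by (intro mult_left_mono) auto
    moreover have "I powr p = M powr (p - 1) * (m powr p * M)"
      using M(2) m by (simp add: powr_mult powr_diff)
    ultimately show "I powr p \<le> M powr (p - 1) * K" by simp
  qed simp
  finally have "ennreal (\<bar>?\<Delta>\<bar> powr p)
      \<le> ennreal (norm h powr p * M powr (p - 1)) * ennreal K"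
    by (simp add: mult.assoc ennreal_leI flip: ennreal_mult')
  also have "ennreal K = (\<integral>\<^sup>+t. ennreal (k t powr p * w t) * indicator {a..b} t \<partial>lborel)"
  proof (rule nn_integral_has_integral_lebesgue'[symmetric])
    show "((\<lambda>t. k t powr p * w t) has_integral K) {a..b}"
      unfolding K_def by (intro integrable_integral integrable_continuous_interval kpc)
    show "0 \<le> k t powr p * w t" if "t \<in> {a..b}" for t
      using w(2)[OF that] by simp
  qed
  finally show ?thesis unfolding k_def .
qed

lemma nn_integral_lborel_translate:
  fixes f :: "'a::euclidean_space \<Rightarrow> ennreal"
  assumes [measurable]: "f \<in> borel_measurable borel"
  shows "(\<integral>\<^sup>+x. f (c + x) \<partial>lborel) = integral\<^sup>N lborel f"
proof -
  have "integral\<^sup>N lborel f = integral\<^sup>N (distr lborel borel ((+) c)) f"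
    by (simp add: lborel_distr_plus)
  also have "\<dots> = (\<integral>\<^sup>+x. f (c + x) \<partial>lborel)"
    by (rule nn_integral_distr) auto
  finally show ?thesis by simp
qed

lemma nn_integral_lborel_scale:
  fixes f :: "'a::euclidean_space \<Rightarrow> ennreal"
  assumes [measurable]: "f \<in> borel_measurable borel" and t: "t > 0"
  shows "ennreal (t powr real DIM('a)) * (\<integral>\<^sup>+x. f (t *\<^sub>R x) \<partial>lborel) = integral\<^sup>N lborel f"
proof -
  have "integral\<^sup>N lborel f
      = integral\<^sup>N (density (distr lborel borel (\<lambda>x. 0 + t *\<^sub>R x)) (\<lambda>_. ennreal (\<bar>t\<bar> ^ DIM('a)))) f"
    using lborel_affine[of t "0::'a"] t by (simp add: ennreal_power)
  also have "\<dots> = ennreal (t ^ DIM('a)) * (\<integral>\<^sup>+x. f (t *\<^sub>R x) \<partial>lborel)"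
    using t by (simp add: nn_integral_density nn_integral_distr nn_integral_cmult)
  finally show ?thesis using t by (simp add: powr_realpow)
qed

text \<open>
  A function with compact support is the integral of its radial derivative from \<open>x\<close> to infinity, so
  \<open>|f(x)|/|x| \<le> \<integral>\<^sub>1\<^sup>\<infinity> |g(tx)| dt\<close>. Since dilation by \<open>t\<close> scales the \<open>L\<^sup>p\<close> norm by \<open>t\<^bsup>-N/p\<^esup>\<close>, the right-hand side has \<open>L\<^sup>p\<close>
  norm at most \<open>\<integral>\<^sub>1\<^sup>\<infinity> t\<^bsup>-N/p\<^esup> dt = p/(N - p)\<close> times that of \<open>g\<close>, which is the sharp constant. Minkowski's integral
  inequality is replaced by Jensen's inequality with the weight \<open>t\<^bsup>-N/p\<^esup>\<close> and Tonelli's theorem.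
\<close>

lemma hardy_inequality_C1:
  fixes f :: "'a::euclidean_space \<Rightarrow> real"
  assumes C1: "C1_with_gradient f g S" and p: "1 < p" "p < real DIM('a)"
  shows "(\<integral>\<^sup>+x. ennreal (\<bar>f x\<bar> powr p / norm x powr p) \<partial>lebesgue)
    \<le> ennreal ((p / (real DIM('a) - p)) powr p) * (\<integral>\<^sup>+x. ennreal (norm (g x) powr p) \<partial>lebesgue)"
proof -
  let ?N = "real DIM('a)"
  \<comment> \<open>\<open>M\<close> is the total mass of the weight \<open>t\<^bsup>-q\<^esup>\<close> on the half-line \<open>t \<ge> 1\<close>.\<close>
  define q where "q = ?N / p"
  define M where "M = p / (?N - p)"
  let ?u = "\<lambda>x. ennreal (\<bar>f x\<bar> powr p / norm x powr p)" and ?n = "\<lambda>x. ennreal (norm (g x) powr p)"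
    and ?k = "\<lambda>x t. ennreal (norm (g (t *\<^sub>R x)) powr p * t powr (?N - q)) * indicator {1..} t"
    and ?j = "\<lambda>T x t. ennreal ((norm (g (0 + t *\<^sub>R x)) / t powr - q) powr p * t powr - q) * indicator {1..T} t"
  have q: "q > 1" and M: "M > 0" "M = 1 / (q - 1)"
    using p by (auto simp: q_def M_def field_simps)
  have S: "compact S" and z: "\<And>x. x \<notin> S \<Longrightarrow> f x = 0" and g: "continuous_on UNIV g"
    using C1 by (auto simp: C1_with_gradient_def)
  have gm [measurable]: "g \<in> borel_measurable borel"
    using g by (rule borel_measurable_continuous_onI)
  obtain R where R: "R > 0" "\<And>x. x \<in> S \<Longrightarrow> norm x \<le> R"
    using compact_imp_bounded[OF S] by (auto simp: bounded_pos)
  have weight: "((\<lambda>t. t powr - q) has_integral M) {1..}"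
    using has_integral_powr_to_inf[of "- q" 1] q minus_divide_right[of 1 "1 - q"] by (simp add: M(2))
  define K where "K = (\<lambda>x. \<integral>\<^sup>+t. ?k x t \<partial>lborel)"
  have pt: "?u x \<le> ennreal (M powr (p - 1)) * K x" for x
  proof (cases "x = 0")
    case False
    \<comment> \<open>The ray through \<open>x\<close> has left the support at parameter \<open>T\<close>.\<close>
    define T where "T = 1 + R / norm x"
    have T: "T \<ge> 1" "T > 0" using R(1) by (auto simp: T_def intro: add_pos_nonneg)
    have "norm (T *\<^sub>R x) = norm x + R"
      using T(2) False by (simp add: T_def field_simps)
    then have "norm (T *\<^sub>R x) > R" using False by simp
    then have fT: "f (T *\<^sub>R x) = 0"
      using R(2)[of "T *\<^sub>R x"] z by fastforce
    have wc: "continuous_on {1..T} (\<lambda>t. t powr - q)"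
      by (intro continuous_intros) auto
    have wM: "integral {1..T} (\<lambda>t. t powr - q) \<le> M"
      using integral_subset_le[of "{1..T}" "{1..}" "\<lambda>t. t powr - q"]
        integrable_continuous_interval[OF wc] weight
      by (auto simp: integral_unique[OF weight] intro: has_integral_integrable)
    have "ennreal (\<bar>f (0 + T *\<^sub>R x) - f (0 + 1 *\<^sub>R x)\<bar> powr p)
      \<le> ennreal (norm x powr p * M powr (p - 1)) *
        (\<integral>\<^sup>+t. ?j T x t \<partial>lborel)"
      by (rule C1_difference_along_segment[OF C1 p(1) T(1) wc _ wM M(1)]) auto
    also have "(\<integral>\<^sup>+t. ?j T x t \<partial>lborel)
        \<le> K x"
      unfolding K_def
    proof (intro nn_integral_mono)
      fix t :: real
      have "(n / t powr - q) powr p * t powr - q = n powr p * t powr (?N - q)" if "t \<ge> 1" "n \<ge> 0" for n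
      proof -
        have "(n / t powr - q) powr p = n powr p * t powr (q * p)"
          using that by (simp add: powr_minus divide_inverse powr_mult powr_powr)
        moreover have "q * p = ?N" using p by (simp add: q_def)
        ultimately show ?thesis by (simp add: powr_diff powr_minus field_simps)
      qed
      then show "?j T x t
          \<le> ?k x t"
        by (auto split: split_indicator)
    qed
    finally have "ennreal (\<bar>f x\<bar> powr p) \<le> ennreal (norm x powr p * M powr (p - 1)) * K x"
      by (simp add: fT mult_left_mono)
    then have "ennreal (1 / norm x powr p) * ennreal (\<bar>f x\<bar> powr p)
        \<le> ennreal (1 / norm x powr p) * (ennreal (norm x powr p * M powr (p - 1)) * K x)"
      by (rule mult_left_mono) simp
    then show ?thesis
      using False by (simp add: mult.assoc[symmetric] flip: ennreal_mult)
  qed simp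
  have Km [measurable]: "K \<in> borel_measurable borel"
    unfolding K_def by measurable
  have fm: "(\<lambda>x. ?u x) \<in> borel_measurable borel"
    using borel_measurable_continuous_onI[OF continuous_C1[OF C1]] by measurable
  let ?G = "\<integral>\<^sup>+x. ennreal (norm (g x) powr p) \<partial>lborel"
  have "(\<integral>\<^sup>+x. K x \<partial>lborel)
      = (\<integral>\<^sup>+t. (\<integral>\<^sup>+x. ?k x t \<partial>lborel) \<partial>lborel)"
    unfolding K_def by (rule lborel_pair.Fubini') measurable
  also have "\<dots> = (\<integral>\<^sup>+t. ennreal (t powr - q) * indicator {1..} t * ?G \<partial>lborel)"
  proof (rule nn_integral_cong)
    fix t :: real
    show "(\<integral>\<^sup>+x. ?k x t \<partial>lborel)
        = ennreal (t powr - q) * indicator {1..} t * ?G"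
    proof (cases "t \<ge> 1")
      case True
      then have "(\<integral>\<^sup>+x. ?k x t \<partial>lborel)
          = (\<integral>\<^sup>+x. ennreal (t powr (?N - q)) * ?n (t *\<^sub>R x) \<partial>lborel)"
        by (simp add: ennreal_mult mult.commute)
      also have "\<dots> = ennreal (t powr (?N - q)) * (\<integral>\<^sup>+x. ?n (t *\<^sub>R x) \<partial>lborel)"
        by (rule nn_integral_cmult) measurable
      also have e: "t powr (?N - q) = t powr - q * t powr ?N"
        by (simp add: powr_add[symmetric])
      also have "ennreal (t powr - q * t powr ?N) = ennreal (t powr - q) * ennreal (t powr ?N)"
        by (simp add: ennreal_mult)
      also have "\<dots> * (\<integral>\<^sup>+x. ?n (t *\<^sub>R x) \<partial>lborel) = ennreal (t powr - q) * ?G"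
        using nn_integral_lborel_scale[of "\<lambda>x. ennreal (norm (g x) powr p)" t] True
        by (simp add: mult.assoc)
      finally show ?thesis using True by (simp add: e)
    qed simp
  qed
  also have "\<dots> = (\<integral>\<^sup>+t. ennreal (t powr - q) * indicator {1..} t \<partial>lborel) * ?G"
    by (rule nn_integral_multc) measurable
  also have "(\<integral>\<^sup>+t. ennreal (t powr - q) * indicator {1..} t \<partial>lborel) = ennreal M"
    by (rule nn_integral_has_integral_lebesgue'[OF _ weight]) simp
  finally have KG: "(\<integral>\<^sup>+x. K x \<partial>lborel) = ennreal M * ?G" .
  have "(\<integral>\<^sup>+x. ?u x \<partial>lebesgue)
      = (\<integral>\<^sup>+x. ?u x \<partial>lborel)"
    by (rule nn_integral_completion)
  also have "\<dots> \<le> (\<integral>\<^sup>+x. ennreal (M powr (p - 1)) * K x \<partial>lborel)"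
    by (intro nn_integral_mono pt)
  also have "\<dots> = ennreal (M powr (p - 1)) * (ennreal M * ?G)"
    by (simp add: nn_integral_cmult KG)
  also have "\<dots> = ennreal (M powr p) * ?G"
    using M(1) by (simp add: mult.assoc[symmetric] powr_diff flip: ennreal_mult)
  also have "?G = (\<integral>\<^sup>+x. ennreal (norm (g x) powr p) \<partial>lebesgue)"
    by (rule nn_integral_completion[symmetric])
  finally show ?thesis unfolding M_def .
qed

section \<open>The Gagliardo energy of smooth functions\<close>

text \<open>
  Layer-cake argument: the kernel is dominated by a superposition \<open>\<integral> k(r) 1\<^bsub>|h| \<le> r\<^esub> dr\<close> of indicators of balls. After
  integrating in \<open>h\<close> first, convergence is a matter of two one-dimensional integrals, over \<open>r \<le> 1\<close> with exponent
  \<open>p - sp - 1 > -1\<close> and over \<open>r \<ge> 1\<close> with exponent \<open>-sp - 1 < -1\<close>.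
\<close>

lemma fractional_kernel_finite:
  assumes s: "0 < s" "s < 1" and p: "p > 1"
  shows "(\<integral>\<^sup>+(h::'a::euclidean_space). ennreal (min (norm h powr p) 1 / norm h powr (real DIM('a) + s * p)) \<partial>lborel) < \<infinity>"
proof -
  let ?N = "real DIM('a)"
  define \<alpha> where "\<alpha> = ?N + s * p"
  have \<alpha>: "\<alpha> > 0" using s p by (simp add: \<alpha>_def add_pos_pos)
  define V where "V = unit_ball_vol ?N"
  have V: "V \<ge> 0" by (simp add: V_def)
  define k where "k = (\<lambda>r. \<alpha> * (min (r powr p) 1 * r powr (- \<alpha> - 1)))"
  have km [measurable]: "k \<in> borel_measurable borel"
    unfolding k_def by measurable
  let ?K = "\<lambda>r (h :: 'a). ennreal (k r) * indicator {0<..} r * indicator (cball 0 r) h"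
    and ?J = "\<lambda>h :: 'a. ennreal (min (norm h powr p) 1 / norm h powr \<alpha>)"
    and ?B = "\<lambda>r. ennreal (\<alpha> * V) * (ennreal (r powr (p - s * p - 1)) * indicator {0..1} r
      + ennreal (r powr (- s * p - 1)) * indicator {1..} r)"
  have pt: "?J h
      \<le> (\<integral>\<^sup>+r. ?K r h \<partial>lborel)" for h :: 'a
  proof (cases "h = 0")
    case False
    let ?\<rho> = "norm h"
    let ?c = "\<alpha> * min (?\<rho> powr p) 1"
    have \<rho>: "?\<rho> > 0" using False by simp
    have "((\<lambda>r. r powr (- \<alpha> - 1)) has_integral - (?\<rho> powr (- \<alpha> - 1 + 1)) / (- \<alpha> - 1 + 1)) {?\<rho>..}"
      by (rule has_integral_powr_to_inf) (use \<alpha> \<rho> in auto)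
    then have "((\<lambda>r. r powr (- \<alpha> - 1)) has_integral (?\<rho> powr - \<alpha> / \<alpha>)) {?\<rho>..}"
      by simp
    then have "((\<lambda>r. ?c * r powr (- \<alpha> - 1)) has_integral
        (?c * (?\<rho> powr - \<alpha> / \<alpha>))) {?\<rho>..}"
      by (rule has_integral_mult_right)
    then have "ennreal (?c * (?\<rho> powr - \<alpha> / \<alpha>))
        = (\<integral>\<^sup>+r. ennreal (?c * r powr (- \<alpha> - 1)) * indicator {?\<rho>..} r \<partial>lborel)"
      by (intro nn_integral_has_integral_lebesgue'[symmetric]) (use \<alpha> in auto)
    also have "\<dots> \<le> (\<integral>\<^sup>+r. ?K r h \<partial>lborel)"
    proof (rule nn_integral_mono)
      fix r :: real
      show "ennreal (?c * r powr (- \<alpha> - 1)) * indicator {?\<rho>..} r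
          \<le> ?K r h"
      proof (cases "?\<rho> \<le> r")
        case True
        then have "?\<rho> powr p \<le> r powr p" using p by (intro powr_mono2) auto
        then have "min (?\<rho> powr p) 1 \<le> min (r powr p) 1" by simp
        then have "\<alpha> * (min (?\<rho> powr p) 1 * r powr (- \<alpha> - 1)) \<le> k r"
          unfolding k_def using \<alpha> by (intro mult_left_mono mult_right_mono) auto
        moreover have "r > 0" using True \<rho> by linarith
        ultimately show ?thesis using True by (simp add: ennreal_leI mult.assoc)
      qed simp
    qed
    also have "?c * (?\<rho> powr - \<alpha> / \<alpha>) = min (?\<rho> powr p) 1 / ?\<rho> powr \<alpha>"
      using \<alpha> by (simp add: powr_minus divide_inverse)
    finally show ?thesis .
  qed (simp add: \<alpha>)
  have "(\<integral>\<^sup>+(h::'a). ?J h \<partial>lborel)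
      \<le> (\<integral>\<^sup>+(h::'a). (\<integral>\<^sup>+r. ?K r h \<partial>lborel) \<partial>lborel)"
    by (intro nn_integral_mono pt)
  also have "\<dots> = (\<integral>\<^sup>+r. (\<integral>\<^sup>+(h::'a). ?K r h \<partial>lborel) \<partial>lborel)"
  proof (rule lborel_pair.Fubini')
    have "(\<lambda>(r, h::'a). ?K r h)
        = (\<lambda>x. ennreal (k (fst x)) * indicator {0<..} (fst x) * indicator {x. norm (snd x :: 'a) \<le> fst x} x)"
      by (auto simp: fun_eq_iff split: split_indicator)
    also have "\<dots> \<in> borel_measurable (lborel \<Otimes>\<^sub>M lborel)"
    proof -
      have "{x. norm (snd x :: 'a) \<le> fst x} \<in> sets (borel :: (real \<times> 'a) measure)"
        by (intro borel_closed closed_Collect_le continuous_intros)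
      then have [measurable]: "{x. norm (snd x :: 'a) \<le> fst x} \<in> sets (lborel \<Otimes>\<^sub>M lborel)"
        by (subst lborel_prod) simp
      show ?thesis by measurable
    qed
    finally show "(\<lambda>(r, h::'a). ?K r h)
        \<in> borel_measurable (lborel \<Otimes>\<^sub>M lborel)" .
  qed
  also have "\<dots> \<le> (\<integral>\<^sup>+r. ?B r \<partial>lborel)"
  proof (rule nn_integral_mono)
    fix r :: real
    show "(\<integral>\<^sup>+(h::'a). ?K r h \<partial>lborel)
      \<le> ?B r"
    proof (cases "r > 0")
      case True
      have "(\<integral>\<^sup>+(h::'a). ?K r h \<partial>lborel)
          = ennreal (k r) * emeasure lborel (cball (0::'a) r)"
        using True by (simp add: nn_integral_cmult_indicator)
      also have "\<dots> = ennreal (k r * (V * r powr ?N))"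
        using True \<alpha> V by (simp add: emeasure_cball V_def powr_realpow k_def flip: ennreal_mult)
      also have "k r * (V * r powr ?N) = \<alpha> * V * (min (r powr p) 1 * r powr (- s * p - 1))"
      proof -
        have e: "r powr (- \<alpha> - 1) * r powr ?N = r powr (- s * p - 1)"
          by (simp add: \<alpha>_def flip: powr_add)
        show ?thesis unfolding k_def e[symmetric] by (simp only: mult_ac)
      qed
      also have "ennreal \<dots> \<le> ?B r"
      proof (cases "r \<le> 1")
        case True
        have "min (r powr p) 1 * r powr (- s * p - 1) \<le> r powr p * r powr (- s * p - 1)"
          by (intro mult_right_mono) auto
        also have "\<dots> = r powr (p - s * p - 1)"
          by (simp add: algebra_simps flip: powr_add)
        finally have "ennreal (\<alpha> * V * (min (r powr p) 1 * r powr (- s * p - 1)))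
            \<le> ennreal (\<alpha> * V) * ennreal (r powr (p - s * p - 1))"
          using \<alpha> V by (simp add: ennreal_leI mult_left_mono flip: ennreal_mult)
        also have "\<dots> \<le> ?B r"
          using True \<open>r > 0\<close> by (intro mult_left_mono) auto
        finally show ?thesis .
      next
        case False
        have "min (r powr p) 1 * r powr (- s * p - 1) \<le> 1 * r powr (- s * p - 1)"
          by (intro mult_right_mono) auto
        then have "ennreal (\<alpha> * V * (min (r powr p) 1 * r powr (- s * p - 1)))
            \<le> ennreal (\<alpha> * V) * ennreal (r powr (- s * p - 1))"
          using \<alpha> V by (simp add: ennreal_leI mult_left_mono flip: ennreal_mult)
        then show ?thesis using False by simp
      qed
      finally show ?thesis .
    qed simp
  qed
  also have "\<dots> = ennreal (\<alpha> * V) *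
      ((\<integral>\<^sup>+r. ennreal (r powr (p - s * p - 1)) * indicator {0..1} r \<partial>lborel)
       + (\<integral>\<^sup>+r. ennreal (r powr (- s * p - 1)) * indicator {1..} r \<partial>lborel))"
    by (subst nn_integral_cmult, measurable, subst nn_integral_add, measurable)
  also have "(\<integral>\<^sup>+r. ennreal (r powr (p - s * p - 1)) * indicator {0..1} r \<partial>lborel)
      = ennreal (1 powr (p - s * p - 1 + 1) / (p - s * p - 1 + 1))"
    by (intro nn_integral_has_integral_lebesgue' has_integral_powr_from_0) (use s p in auto)
  also have "(\<integral>\<^sup>+r. ennreal (r powr (- s * p - 1)) * indicator {1..} r \<partial>lborel)
      = ennreal (- (1 powr (- s * p - 1 + 1)) / (- s * p - 1 + 1))"
    by (intro nn_integral_has_integral_lebesgue' has_integral_powr_to_inf) (use s p in auto)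
  finally show ?thesis
    unfolding \<alpha>_def[symmetric] by (simp add: ennreal_mult_less_top less_top[symmetric] top_unique
        flip: ennreal_plus) (metis ennreal_add_eq_top ennreal_mult_eq_top_iff ennreal_neq_top leD top_unique top.not_eq_extremum)
qed

text \<open>
  The weight enters as a \<open>p\<close>-th root, so that the nonlocal energy is the \<open>p\<close>-th power of an \<open>L\<^sup>p\<close> norm of a linear
  expression in \<open>u\<close> and results about convergence in \<open>L\<^sup>p\<close> apply to it.
\<close>

definition gagliardo :: "real \<Rightarrow> real \<Rightarrow> ('a::euclidean_space \<Rightarrow> real) \<Rightarrow> 'a \<times> 'a \<Rightarrow> real" where
  "gagliardo p s u z = (u (fst z) - u (snd z)) / norm (fst z - snd z) powr ((real DIM('a) + s * p) / p)"

lemma gagliardo_powr: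
  fixes x y :: "'a::euclidean_space"
  assumes "p > 1"
  shows "\<bar>gagliardo p s u (x, y)\<bar> powr p = \<bar>u x - u y\<bar> powr p / norm (x - y) powr (real DIM('a) + s * p)"
  using assms by (simp add: gagliardo_def abs_divide powr_divide powr_powr)

lemma measurable_fst_snd_lebesgue:
  "fst \<in> borel_measurable ((lebesgue :: 'a::euclidean_space measure) \<Otimes>\<^sub>M (lebesgue :: 'a measure))"
  "snd \<in> borel_measurable ((lebesgue :: 'a::euclidean_space measure) \<Otimes>\<^sub>M (lebesgue :: 'a measure))"
proof -
  have id: "(\<lambda>x::'a. x) \<in> borel_measurable lebesgue"
    by (intro measurable_completion) simp
  show "fst \<in> borel_measurable ((lebesgue :: 'a measure) \<Otimes>\<^sub>M (lebesgue :: 'a measure))"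
    by (rule measurable_compose[OF measurable_fst id])
  show "snd \<in> borel_measurable ((lebesgue :: 'a measure) \<Otimes>\<^sub>M (lebesgue :: 'a measure))"
    by (rule measurable_compose[OF measurable_snd id])
qed

lemma gagliardo_measurable [measurable]:
  assumes u: "u \<in> borel_measurable lebesgue"
  shows "gagliardo p s u \<in> borel_measurable (lebesgue \<Otimes>\<^sub>M lebesgue)"
proof -
  note [measurable] = measurable_fst_snd_lebesgue
    measurable_compose[OF measurable_fst u] measurable_compose[OF measurable_snd u]
  show ?thesis unfolding gagliardo_def[abs_def] by measurable
qed

text \<open>
  With \<open>h = y - x\<close> the inner integral is \<open>\<integral>|f(x+h) - f(x)|\<^sup>p dx\<close>, which is at most \<open>|h|\<^sup>p \<integral>|g|\<^sup>p\<close> and at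
  most a multiple of \<open>\<integral>|f|\<^sup>p\<close>. The first bound is integrable against the kernel near the origin, the second at
  infinity.
\<close>

lemma gagliardo_C1_bound:
  fixes f :: "'a::euclidean_space \<Rightarrow> real"
  assumes C1: "C1_with_gradient f g S" and p: "p > 1"
  shows "(\<integral>\<^sup>+z. ennreal (\<bar>gagliardo p s f z\<bar> powr p) \<partial>(lebesgue \<Otimes>\<^sub>M lebesgue))
    \<le> (\<integral>\<^sup>+(h::'a). ennreal (min (norm h powr p) 1 / norm h powr (real DIM('a) + s * p)) \<partial>lborel)
      * (ennreal (2 powr p * 2) * ((\<integral>\<^sup>+x. ennreal (norm (g x) powr p) \<partial>lebesgue)
      + (\<integral>\<^sup>+x. ennreal (\<bar>f x\<bar> powr p) \<partial>lebesgue)))"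
proof -
  let ?\<alpha> = "real DIM('a) + s * p"
  have fm [measurable]: "f \<in> borel_measurable borel" and gm [measurable]: "g \<in> borel_measurable borel"
    using C1 continuous_C1[OF C1] borel_measurable_continuous_onI
    by (auto simp: C1_with_gradient_def)
  define G where "G = (\<integral>\<^sup>+x. ennreal (norm (g x) powr p) \<partial>lborel)"
  define F where "F = (\<integral>\<^sup>+x. ennreal (\<bar>f x\<bar> powr p) \<partial>lborel)"
  let ?C = "ennreal (2 powr p * 2) * (G + F)"
    and ?k = "\<lambda>x (t :: real) h. ennreal (norm (g (x + t *\<^sub>R h)) powr p) * indicator {0..1} t"
    and ?\<Gamma> = "\<lambda>z. ennreal (\<bar>gagliardo p s f z\<bar> powr p)"
    and ?q = "\<lambda>x h. ennreal (\<bar>f (x + h) - f x\<bar> powr p / norm h powr ?\<alpha>)"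
    and ?r = "\<lambda>x y. ennreal (\<bar>f x - f y\<bar> powr p / norm (x - y) powr ?\<alpha>)"
    and ?J = "\<lambda>h :: 'a. ennreal (min (norm h powr p) 1 / norm h powr ?\<alpha>)"
    and ?i = "\<lambda>h :: 'a. ennreal (1 / norm h powr ?\<alpha>)"
  define D where "D = (\<lambda>h. \<integral>\<^sup>+x. ennreal (\<bar>f (x + h) - f x\<bar> powr p) \<partial>lborel)"
  have DG: "D h \<le> ennreal (norm h powr p) * G" for h
  proof -
    have "D h \<le> (\<integral>\<^sup>+x. ennreal (norm h powr p) * (\<integral>\<^sup>+t. ?k x t h \<partial>lborel) \<partial>lborel)"
      unfolding D_def
    proof (rule nn_integral_mono)
      fix x
      show "ennreal (\<bar>f (x + h) - f x\<bar> powr p)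
          \<le> ennreal (norm h powr p) * (\<integral>\<^sup>+t. ?k x t h \<partial>lborel)"
        using C1_difference_along_segment[OF C1 p, of 0 1 "\<lambda>_. 1" 1 x h] by simp
    qed
    also have "\<dots> = ennreal (norm h powr p) * (\<integral>\<^sup>+x. (\<integral>\<^sup>+t. ?k x t h \<partial>lborel) \<partial>lborel)"
      by (rule nn_integral_cmult) measurable
    also have "(\<integral>\<^sup>+x. (\<integral>\<^sup>+t. ?k x t h \<partial>lborel) \<partial>lborel)
        = (\<integral>\<^sup>+t. (\<integral>\<^sup>+x. ?k x t h \<partial>lborel) \<partial>lborel)"
      by (rule lborel_pair.Fubini') measurable
    also have "\<dots> = (\<integral>\<^sup>+t. G * indicator {0..1} (t::real) \<partial>lborel)"
    proof (rule nn_integral_cong)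
      fix t :: real
      show "(\<integral>\<^sup>+x. ?k x t h \<partial>lborel) = G * indicator {0..1} t"
        using nn_integral_lborel_translate[of "\<lambda>x. ennreal (norm (g x) powr p)" "t *\<^sub>R h"]
        by (simp add: nn_integral_multc G_def add.commute)
    qed
    also have "\<dots> = G"
      by (simp add: nn_integral_cmult)
    finally show ?thesis .
  qed
  have DF: "D h \<le> ennreal (2 powr p * 2) * F" for h
  proof -
    have "D h \<le> (\<integral>\<^sup>+x. ennreal (2 powr p) * (ennreal (\<bar>f (h + x)\<bar> powr p) + ennreal (\<bar>f x\<bar> powr p)) \<partial>lborel)"
      unfolding D_def
    proof (rule nn_integral_mono)
      fix x
      show "ennreal (\<bar>f (x + h) - f x\<bar> powr p)
        \<le> ennreal (2 powr p) * (ennreal (\<bar>f (h + x)\<bar> powr p) + ennreal (\<bar>f x\<bar> powr p))"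
        using norm_add_powr_le[OF p, of "f (x + h)" "- f x"]
        by (simp add: ennreal_leI add.commute[of h] flip: ennreal_mult ennreal_plus)
    qed
    also have "\<dots> = ennreal (2 powr p) * ((\<integral>\<^sup>+x. ennreal (\<bar>f (h + x)\<bar> powr p) \<partial>lborel) + F)"
      unfolding F_def by (subst nn_integral_cmult, measurable, subst nn_integral_add, measurable)
    also have "(\<integral>\<^sup>+x. ennreal (\<bar>f (h + x)\<bar> powr p) \<partial>lborel) = F"
      unfolding F_def by (rule nn_integral_lborel_translate) measurable
    also have "ennreal (2 powr p) * (F + F) = ennreal (2 powr p * 2) * F"
      by (simp add: ennreal_mult mult.assoc flip: mult_2)
    finally show ?thesis .
  qed
  have D: "D h \<le> ennreal (min (norm h powr p) 1) * ?C" for h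
  proof (cases "norm h powr p \<le> 1")
    case True
    have "1 \<le> ennreal (2 powr p * 2)"
    proof -
      have "1 \<le> 2 powr p * (2::real)"
        using powr_mono[of 0 p 2] p by simp
      then show ?thesis by (metis ennreal_1 ennreal_leI)
    qed
    then have "1 * G \<le> ennreal (2 powr p * 2) * (G + F)"
      by (intro mult_mono) auto
    then have "ennreal (norm h powr p) * G \<le> ennreal (norm h powr p) * ?C"
      by (intro mult_left_mono) auto
    with DG[of h] True show ?thesis by (simp add: min_absorb1)
  next
    case False
    have "ennreal (2 powr p * 2) * F \<le> ennreal (2 powr p * 2) * (G + F)"
      by (intro mult_left_mono) auto
    with DF[of h] False show ?thesis by (simp add: min_absorb2)
  qed
  have Dm [measurable]: "D \<in> borel_measurable borel"
    unfolding D_def by measurable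
  have sfl: "sigma_finite_measure (lebesgue :: 'a measure)"
    by (rule sigma_finite_lebesgue)
  have fml: "f \<in> borel_measurable lebesgue"
    by (rule continuous_imp_lebesgue_measurable[OF continuous_C1[OF C1]])
  have "(\<lambda>z. ?\<Gamma> z) \<in> borel_measurable (lebesgue \<Otimes>\<^sub>M lebesgue)"
    using gagliardo_measurable[OF fml] by measurable
  then have "(\<integral>\<^sup>+z. ?\<Gamma> z \<partial>(lebesgue \<Otimes>\<^sub>M lebesgue))
      = (\<integral>\<^sup>+x. (\<integral>\<^sup>+y. ennreal (\<bar>gagliardo p s f (x, y)\<bar> powr p) \<partial>lebesgue) \<partial>lebesgue)"
    by (rule sigma_finite_measure.nn_integral_fst[OF sfl, symmetric])
  also have "\<dots> = (\<integral>\<^sup>+x. (\<integral>\<^sup>+y. ?r x y \<partial>lborel) \<partial>lborel)"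
    by (simp only: nn_integral_completion gagliardo_powr[OF p])
  also have "\<dots> = (\<integral>\<^sup>+x. (\<integral>\<^sup>+h. ?q x h \<partial>lborel) \<partial>lborel)"
  proof (rule nn_integral_cong)
    fix x
    have "(\<integral>\<^sup>+h. ennreal (\<bar>f x - f (x + h)\<bar> powr p / norm (x - (x + h)) powr ?\<alpha>) \<partial>lborel)
        = (\<integral>\<^sup>+y. ?r x y \<partial>lborel)"
      by (rule nn_integral_lborel_translate) measurable
    then show "(\<integral>\<^sup>+y. ?r x y \<partial>lborel)
        = (\<integral>\<^sup>+h. ?q x h \<partial>lborel)"
      by (simp add: abs_minus_commute)
  qed
  also have "\<dots> = (\<integral>\<^sup>+h. (\<integral>\<^sup>+x. ?q x h \<partial>lborel) \<partial>lborel)"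
    by (rule lborel_pair.Fubini') measurable
  also have "\<dots> = (\<integral>\<^sup>+h. ?i h * D h \<partial>lborel)"
  proof (rule nn_integral_cong)
    fix h :: 'a
    have "(\<integral>\<^sup>+x. ?q x h \<partial>lborel)
        = (\<integral>\<^sup>+x. ?i h * ennreal (\<bar>f (x + h) - f x\<bar> powr p) \<partial>lborel)"
      by (simp flip: ennreal_mult)
    also have "\<dots> = ?i h * D h"
      unfolding D_def by (rule nn_integral_cmult) measurable
    finally show "(\<integral>\<^sup>+x. ?q x h \<partial>lborel)
        = ?i h * D h" .
  qed
  also have "\<dots> \<le> (\<integral>\<^sup>+(h::'a). ?J h
      * ?C \<partial>lborel)"
  proof (rule nn_integral_mono)
    fix h :: 'a
    have "?i h * D h
        \<le> ?i h * (ennreal (min (norm h powr p) 1) * ?C)"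
      by (intro mult_left_mono D) simp
    also have "\<dots> = (?i h * ennreal (min (norm h powr p) 1)) * ?C"
      by (simp only: mult.assoc)
    also have "?i h * ennreal (min (norm h powr p) 1)
        = ?J h"
      by (simp flip: ennreal_mult)
    finally show "?i h * D h
        \<le> ?J h * ?C" .
  qed
  also have "\<dots> = (\<integral>\<^sup>+(h::'a). ?J h \<partial>lborel)
      * ?C"
    by (rule nn_integral_multc) measurable
  finally show ?thesis
    unfolding G_def F_def nn_integral_completion .
qed

section \<open>Approximation by test functions\<close>

lemma test_function_outside:
  assumes "\<phi> \<in> test_functions U" "x \<notin> U"
  shows "\<phi> x = 0" "gradient \<phi> x = 0"
proof -
  have "x \<notin> supp \<phi>"
    using assms by (auto simp: test_functions_def)
  with test_function_C1[OF assms(1)] show "\<phi> x = 0" "gradient \<phi> x = 0"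
    unfolding C1_with_gradient_def by blast+
qed

text \<open>
  Extension by zero turns all integrals over \<open>\<Omega>\<close> into integrals over the whole space.
\<close>

definition ext_gradient :: "'a::euclidean_space set \<Rightarrow> ('a \<Rightarrow> real) \<Rightarrow> 'a \<Rightarrow> 'a" where
  "ext_gradient \<Omega> u x = indicator \<Omega> x *\<^sub>R weak_gradient \<Omega> u x"

lemma X_space_Lp:
  assumes u: "u \<in> X_space p \<Omega>" and \<Omega>: "open \<Omega>"
  shows "u \<in> borel_measurable lebesgue" "integrable lebesgue (\<lambda>x. \<bar>u x\<bar> powr p)"
    and "ext_gradient \<Omega> u \<in> borel_measurable lebesgue"
    and "integrable lebesgue (\<lambda>x. norm (ext_gradient \<Omega> u x) powr p)"
proof -
  have "u \<in> Lp p UNIV" using u by (auto simp: X_space_def W1p_def)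
  then show "u \<in> borel_measurable lebesgue" "integrable lebesgue (\<lambda>x. \<bar>u x\<bar> powr p)"
    by (simp_all add: Lp_def lebesgue_on_UNIV_eq)
  have "u \<in> W1p p \<Omega>" using u by (auto simp: X_space_def W01p_def)
  from weak_gradient_works(2)[OF \<Omega> this]
  have L: "weak_gradient \<Omega> u \<in> borel_measurable (lebesgue_on \<Omega>)"
    "integrable (lebesgue_on \<Omega>) (\<lambda>x. norm (weak_gradient \<Omega> u x) powr p)"
    by (auto simp: Lp_def)
  show "ext_gradient \<Omega> u \<in> borel_measurable lebesgue"
    using L(1) \<Omega> by (simp add: borel_measurable_restrict_space_iff ext_gradient_def[abs_def])
  have "(\<lambda>x. indicator \<Omega> x *\<^sub>R norm (weak_gradient \<Omega> u x) powr p) = (\<lambda>x. norm (ext_gradient \<Omega> u x) powr p)"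
    by (auto simp: fun_eq_iff ext_gradient_def split: split_indicator)
  then show "integrable lebesgue (\<lambda>x. norm (ext_gradient \<Omega> u x) powr p)"
    using L(2) \<Omega> by (simp add: integrable_restrict_space)
qed

lemma X_space_vanishes_outside:
  "u \<in> X_space p \<Omega> \<Longrightarrow> AE x in lebesgue. x \<notin> \<Omega> \<longrightarrow> u x = 0"
  by (simp add: X_space_def)

definition approximates :: "real \<Rightarrow> 'a::euclidean_space set \<Rightarrow> (nat \<Rightarrow> 'a \<Rightarrow> real) \<Rightarrow> ('a \<Rightarrow> real) \<Rightarrow> bool" where
  "approximates p \<Omega> \<phi> u \<longleftrightarrow>
     (\<forall>k. \<phi> k \<in> test_functions \<Omega>) \<and>
     (\<lambda>k. \<integral>x. norm (gradient (\<phi> k) x - ext_gradient \<Omega> u x) powr p \<partial>lebesgue) \<longlonglongrightarrow> 0 \<and>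
     (\<lambda>k. \<integral>x. \<bar>\<phi> k x - u x\<bar> powr p \<partial>lebesgue) \<longlonglongrightarrow> 0 \<and>
     (AE x in lebesgue. (\<lambda>k. \<phi> k x) \<longlonglongrightarrow> u x)"

text \<open>
  Convergence in \<open>L\<^sup>p\<close> holds by definition of the space; a subsequence converges almost everywhere.
\<close>

lemma ex_approximates:
  assumes u: "u \<in> X_space p \<Omega>" and \<Omega>: "open \<Omega>" and p: "p > 1"
  shows "\<exists>\<phi>. approximates p \<Omega> \<phi> u"
proof -
  obtain \<phi> where \<phi>: "\<And>k::nat. \<phi> k \<in> test_functions \<Omega>"
    and gl: "(\<lambda>k. \<integral>x. norm (gradient (\<phi> k) x - weak_gradient \<Omega> u x) powr p \<partial>lebesgue_on \<Omega>) \<longlonglongrightarrow> 0"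
    and ul: "(\<lambda>k. \<integral>x. \<bar>\<phi> k x - u x\<bar> powr p \<partial>lebesgue_on \<Omega>) \<longlonglongrightarrow> 0"
    using u unfolding X_space_def W01p_def by blast
  let ?w = "\<lambda>k x. norm (gradient (\<phi> k) x - weak_gradient \<Omega> u x) powr p"
    and ?e = "\<lambda>k x. norm (gradient (\<phi> k) x - ext_gradient \<Omega> u x) powr p"
    and ?d = "\<lambda>k x. \<bar>\<phi> k x - u x\<bar> powr p"
  note X = X_space_Lp[OF u \<Omega>]
  have p0: "p > 0" using p by simp
  note T = test_function_Lp[OF \<phi> p0]
  have "(\<integral>x. ?w k x \<partial>lebesgue_on \<Omega>)
      = (\<integral>x. ?e k x \<partial>lebesgue)" for k
  proof -
    have "(\<integral>x. ?w k x \<partial>lebesgue_on \<Omega>)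
        = (\<integral>x. indicator \<Omega> x *\<^sub>R ?w k x \<partial>lebesgue)"
      using \<Omega> by (intro integral_restrict_space) simp
    also have "\<dots> = (\<integral>x. ?e k x \<partial>lebesgue)"
      using test_function_outside(2)[OF \<phi>]
      by (intro Bochner_Integration.integral_cong) (auto simp: ext_gradient_def split: split_indicator)
    finally show ?thesis .
  qed
  with gl have g: "(\<lambda>k. \<integral>x. ?e k x \<partial>lebesgue) \<longlonglongrightarrow> 0"
    by simp
  have "(\<integral>x. ?d k x \<partial>lebesgue_on \<Omega>) = (\<integral>x. ?d k x \<partial>lebesgue)" for k
  proof -
    have "(\<integral>x. ?d k x \<partial>lebesgue_on \<Omega>)
        = (\<integral>x. indicator \<Omega> x *\<^sub>R ?d k x \<partial>lebesgue)"
      using \<Omega> by (intro integral_restrict_space) simp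
    also have "\<dots> = (\<integral>x. ?d k x \<partial>lebesgue)"
    proof (rule integral_cong_AE)
      have [measurable]: "u \<in> borel_measurable lebesgue" "\<phi> k \<in> borel_measurable lebesgue"
        "\<Omega> \<in> sets lebesgue"
        using X T \<Omega> by auto
      show "(\<lambda>x. indicator \<Omega> x *\<^sub>R ?d k x) \<in> borel_measurable lebesgue"
        "(\<lambda>x. ?d k x) \<in> borel_measurable lebesgue"
        by measurable
      show "AE x in lebesgue. indicator \<Omega> x *\<^sub>R ?d k x = ?d k x"
        using X_space_vanishes_outside[OF u]
        by eventually_elim (use test_function_outside(1)[OF \<phi>] in \<open>auto split: split_indicator\<close>)
    qed
    finally show ?thesis .
  qed
  with ul have l: "(\<lambda>k. \<integral>x. ?d k x \<partial>lebesgue) \<longlonglongrightarrow> 0"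
    by simp
  have int: "integrable lebesgue (\<lambda>x. norm (\<phi> k x - u x) powr p)" for k
    by (rule integrable_norm_diff_powr[OF p T(1) X(1)]) (use T(2) X(2) in simp_all)
  have "\<exists>r::nat\<Rightarrow>nat. strict_mono r \<and> (AE x in lebesgue. (\<lambda>n. \<bar>\<phi> (r n) x - u x\<bar> powr p) \<longlonglongrightarrow> 0)"
    by (rule tendsto_L1_AE_subseq) (use int l in simp_all)
  then obtain r :: "nat \<Rightarrow> nat" where r: "strict_mono r"
    "AE x in lebesgue. (\<lambda>n. \<bar>\<phi> (r n) x - u x\<bar> powr p) \<longlonglongrightarrow> 0"
    by blast
  have ae: "AE x in lebesgue. (\<lambda>n. \<phi> (r n) x) \<longlonglongrightarrow> u x"
    using r(2)
  proof eventually_elim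
    case (elim x)
    have "(\<lambda>n. (\<bar>\<phi> (r n) x - u x\<bar> powr p) powr (1 / p)) \<longlonglongrightarrow> 0 powr (1 / p)"
      by (rule tendsto_powr2[OF elim tendsto_const]) (use p in auto)
    then have "(\<lambda>n. \<bar>\<phi> (r n) x - u x\<bar>) \<longlonglongrightarrow> 0"
      using p by (simp add: powr_powr)
    then show ?case by (simp add: tendsto_rabs_zero_iff LIM_zero_iff)
  qed
  have "approximates p \<Omega> (\<lambda>k. \<phi> (r k)) u"
    unfolding approximates_def
    using \<phi> ae LIMSEQ_subseq_LIMSEQ[OF g r(1)] LIMSEQ_subseq_LIMSEQ[OF l r(1)]
    by (simp add: comp_def)
  then show ?thesis by blast
qed

lemma fatou_AE_tendsto:
  fixes f :: "'b \<Rightarrow> ennreal"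
  assumes [measurable]: "\<And>k. fk k \<in> borel_measurable M"
    and ae: "AE x in M. (\<lambda>k. fk k x) \<longlonglongrightarrow> f x"
  shows "integral\<^sup>N M f \<le> liminf (\<lambda>k. integral\<^sup>N M (fk k))"
proof -
  have "integral\<^sup>N M f = (\<integral>\<^sup>+x. liminf (\<lambda>k. fk k x) \<partial>M)"
    by (rule nn_integral_cong_AE) (use ae in \<open>eventually_elim, simp add: lim_imp_Liminf\<close>)
  also have "\<dots> \<le> liminf (\<lambda>k. integral\<^sup>N M (fk k))"
    by (rule nn_integral_liminf) measurable
  finally show ?thesis .
qed

lemma nn_integral_le_of_AE_tendsto:
  fixes f :: "'b \<Rightarrow> ennreal"
  assumes "\<And>k. fk k \<in> borel_measurable M" "AE x in M. (\<lambda>k. fk k x) \<longlonglongrightarrow> f x"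
    and le: "\<And>k. integral\<^sup>N M (fk k) \<le> c k" and c: "c \<longlonglongrightarrow> c0"
  shows "integral\<^sup>N M f \<le> c0"
proof -
  have "integral\<^sup>N M f \<le> liminf (\<lambda>k. integral\<^sup>N M (fk k))"
    by (rule fatou_AE_tendsto[OF assms(1,2)])
  also have "\<dots> \<le> liminf c"
    by (intro Liminf_mono always_eventually allI le)
  also have "\<dots> = c0"
    using c by (simp add: lim_imp_Liminf)
  finally show ?thesis .
qed

lemma approximates_Lp_limits:
  assumes u: "u \<in> X_space p \<Omega>" and \<Omega>: "open \<Omega>" and p: "p > 1" and ap: "approximates p \<Omega> \<phi> u"
  shows "(\<lambda>k. \<integral>x. norm (gradient (\<phi> k) x) powr p \<partial>lebesgue) \<longlonglongrightarrow> (\<integral>x. norm (ext_gradient \<Omega> u x) powr p \<partial>lebesgue)"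
    and "(\<lambda>k. \<integral>x. \<bar>\<phi> k x\<bar> powr p \<partial>lebesgue) \<longlonglongrightarrow> (\<integral>x. \<bar>u x\<bar> powr p \<partial>lebesgue)"
proof -
  have p0: "p > 0" using p by simp
  have \<phi>: "\<phi> k \<in> test_functions \<Omega>" for k
    using ap by (simp add: approximates_def)
  note X = X_space_Lp[OF u \<Omega>] and T = test_function_Lp[OF \<phi> p0]
  show "(\<lambda>k. \<integral>x. norm (gradient (\<phi> k) x) powr p \<partial>lebesgue) \<longlonglongrightarrow> (\<integral>x. norm (ext_gradient \<Omega> u x) powr p \<partial>lebesgue)"
    by (rule tendsto_integral_norm_powr[OF p T(3) X(3) T(4) X(4)]) (use ap in \<open>simp add: approximates_def\<close>)
  show "(\<lambda>k. \<integral>x. \<bar>\<phi> k x\<bar> powr p \<partial>lebesgue) \<longlonglongrightarrow> (\<integral>x. \<bar>u x\<bar> powr p \<partial>lebesgue)"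
    using tendsto_integral_norm_powr[OF p T(1) X(1)] T(2) X(2) ap by (simp add: approximates_def)
qed

text \<open>
  Fatou's lemma on the left, convergence of the gradients in \<open>L\<^sup>p\<close> on the right.
\<close>

lemma hardy_inequality_X_space:
  fixes u :: "'a::euclidean_space \<Rightarrow> real"
  assumes u: "u \<in> X_space p \<Omega>" and \<Omega>: "open \<Omega>" and p: "1 < p" "p < real DIM('a)"
  shows "(\<integral>\<^sup>+x. ennreal (\<bar>u x\<bar> powr p / norm x powr p) \<partial>lebesgue)
    \<le> ennreal ((p / (real DIM('a) - p)) powr p * (\<integral>x. norm (ext_gradient \<Omega> u x) powr p \<partial>lebesgue))"
proof -
  obtain \<phi> where ap: "approximates p \<Omega> \<phi> u"
    using ex_approximates[OF u \<Omega> p(1)] by blast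
  have p0: "p > 0" using p by simp
  have \<phi>: "\<phi> k \<in> test_functions \<Omega>" for k
    using ap by (simp add: approximates_def)
  note T = test_function_Lp[OF \<phi> p0]
  let ?C = "(p / (real DIM('a) - p)) powr p"
  show ?thesis
  proof (rule nn_integral_le_of_AE_tendsto[where fk = "\<lambda>k x. ennreal (\<bar>\<phi> k x\<bar> powr p / norm x powr p)"
        and c = "\<lambda>k. ennreal (?C * (\<integral>x. norm (gradient (\<phi> k) x) powr p \<partial>lebesgue))"])
    have id: "(\<lambda>x::'a. x) \<in> borel_measurable lebesgue"
      by (intro measurable_completion) simp
    note [measurable] = id T(1)
    show "(\<lambda>x. ennreal (\<bar>\<phi> k x\<bar> powr p / norm x powr p)) \<in> borel_measurable lebesgue" for k
      by measurable
    have "AE x in lebesgue. (\<lambda>k. \<phi> k x) \<longlonglongrightarrow> u x"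
      using ap by (simp add: approximates_def)
    then show "AE x in lebesgue. (\<lambda>k. ennreal (\<bar>\<phi> k x\<bar> powr p / norm x powr p))
        \<longlonglongrightarrow> ennreal (\<bar>u x\<bar> powr p / norm x powr p)"
    proof eventually_elim
      case (elim x)
      have "(\<lambda>k. \<bar>\<phi> k x\<bar> powr p) \<longlonglongrightarrow> \<bar>u x\<bar> powr p"
        by (rule tendsto_powr2[OF tendsto_rabs[OF elim] tendsto_const]) (use p0 in auto)
      from tendsto_mult[OF this tendsto_const[of "1 / norm x powr p"]]
      show ?case by (intro tendsto_ennrealI) simp
    qed
    show "(\<integral>\<^sup>+x. ennreal (\<bar>\<phi> k x\<bar> powr p / norm x powr p) \<partial>lebesgue)
        \<le> ennreal (?C * (\<integral>x. norm (gradient (\<phi> k) x) powr p \<partial>lebesgue))" for k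
      using hardy_inequality_C1[OF test_function_C1[OF \<phi>] p, of k] T(4)[of k]
      by (simp add: nn_integral_eq_integral ennreal_mult)
    show "(\<lambda>k. ennreal (?C * (\<integral>x. norm (gradient (\<phi> k) x) powr p \<partial>lebesgue)))
        \<longlonglongrightarrow> ennreal (?C * (\<integral>x. norm (ext_gradient \<Omega> u x) powr p \<partial>lebesgue))"
      by (intro tendsto_ennrealI tendsto_mult tendsto_const approximates_Lp_limits(1)[OF u \<Omega> p(1) ap])
  qed
qed

lemma AE_lebesgue_pair:
  assumes "AE x in lebesgue. P (x::'a::euclidean_space)"
  shows "AE z in lebesgue \<Otimes>\<^sub>M lebesgue. P (fst z) \<and> P (snd z)"
proof -
  interpret L: sigma_finite_measure "lebesgue :: 'a measure" by (rule sigma_finite_lebesgue)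
  interpret LL: pair_sigma_finite "lebesgue :: 'a measure" "lebesgue :: 'a measure" ..
  obtain N where N: "N \<in> null_sets lebesgue" "{x. \<not> P x} \<subseteq> N"
    using assms by (auto simp: eventually_ae_filter)
  have [measurable]: "N \<in> sets lebesgue" using N(1) by auto
  have aeN: "AE x in lebesgue. x \<notin> N" by (rule AE_not_in[OF N(1)])
  have "AE z in lebesgue \<Otimes>\<^sub>M lebesgue. fst z \<notin> N \<and> snd z \<notin> N"
  proof (rule LL.AE_pair_measure)
    show "{z \<in> space (lebesgue \<Otimes>\<^sub>M lebesgue). fst z \<notin> N \<and> snd z \<notin> N} \<in> sets (lebesgue \<Otimes>\<^sub>M lebesgue)"
      by measurable
    show "AE x in lebesgue. AE y in lebesgue. fst (x, y) \<notin> N \<and> snd (x, y) \<notin> N"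
      using aeN by eventually_elim (use aeN in simp)
  qed
  then show ?thesis by eventually_elim (use N(2) in auto)
qed

lemma test_function_gagliardo_integrable:
  fixes \<phi> :: "'a::euclidean_space \<Rightarrow> real"
  assumes \<phi>: "\<phi> \<in> test_functions \<Omega>" and p: "p > 1" and s: "0 < s" "s < 1"
  shows "integrable (lebesgue \<Otimes>\<^sub>M lebesgue) (\<lambda>z. \<bar>gagliardo p s \<phi> z\<bar> powr p)"
proof (rule integrableI_bounded)
  have p0: "p > 0" using p by simp
  note T = test_function_Lp[OF \<phi> p0]
  note [measurable] = gagliardo_measurable[OF T(1)]
  show "(\<lambda>z. \<bar>gagliardo p s \<phi> z\<bar> powr p) \<in> borel_measurable (lebesgue \<Otimes>\<^sub>M lebesgue)"
    by measurable
  have fin: "(\<integral>\<^sup>+x. ennreal (norm (gradient \<phi> x) powr p) \<partial>lebesgue) < \<infinity>"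
    "(\<integral>\<^sup>+x. ennreal (\<bar>\<phi> x\<bar> powr p) \<partial>lebesgue) < \<infinity>"
    using T(2,4) by (simp_all add: nn_integral_eq_integral)
  note gagliardo_C1_bound[OF test_function_C1[OF \<phi>] p, of s]
  also have "(\<integral>\<^sup>+(h::'a). ennreal (min (norm h powr p) 1 / norm h powr (real DIM('a) + s * p)) \<partial>lborel)
      * (ennreal (2 powr p * 2) * ((\<integral>\<^sup>+x. ennreal (norm (gradient \<phi> x) powr p) \<partial>lebesgue)
      + (\<integral>\<^sup>+x. ennreal (\<bar>\<phi> x\<bar> powr p) \<partial>lebesgue))) < \<infinity>"
    using fin fractional_kernel_finite[OF s p, where 'a = 'a]
    by (simp add: ennreal_mult_less_top)
  finally show "(\<integral>\<^sup>+z. ennreal (norm (\<bar>gagliardo p s \<phi> z\<bar> powr p)) \<partial>(lebesgue \<Otimes>\<^sub>M lebesgue)) < \<infinity>"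
    by simp
qed

lemma gagliardo_diff: "gagliardo p s (\<lambda>x. f x - g x) z = gagliardo p s f z - gagliardo p s g z"
  by (simp add: gagliardo_def diff_divide_distrib[symmetric])

text \<open>
  The estimate for smooth functions, applied to \<open>\<phi>\<^sub>j - \<phi>\<^sub>k\<close>, bounds the Gagliardo energy of the difference by the
  errors \<open>e j + e k\<close>. Letting \<open>j\<close> tend to infinity with Fatou's lemma replaces \<open>\<phi>\<^sub>j\<close> by \<open>u\<close>.
\<close>

lemma approximates_gagliardo:
  fixes u :: "'a::euclidean_space \<Rightarrow> real"
  assumes u: "u \<in> X_space p \<Omega>" and \<Omega>: "open \<Omega>" and p: "p > 1" and s: "0 < s" "s < 1"
    and ap: "approximates p \<Omega> \<phi> u"
  shows "integrable (lebesgue \<Otimes>\<^sub>M lebesgue) (\<lambda>z. \<bar>gagliardo p s u z\<bar> powr p)"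
    and "(\<lambda>k. \<integral>z. \<bar>gagliardo p s (\<phi> k) z\<bar> powr p \<partial>(lebesgue \<Otimes>\<^sub>M lebesgue))
      \<longlonglongrightarrow> (\<integral>z. \<bar>gagliardo p s u z\<bar> powr p \<partial>(lebesgue \<Otimes>\<^sub>M lebesgue))"
proof -
  let ?LL = "lebesgue \<Otimes>\<^sub>M lebesgue :: ('a \<times> 'a) measure"
  let ?g = "gagliardo p s"
  let ?dg = "\<lambda>k x. norm (gradient (\<phi> k) x - ext_gradient \<Omega> u x) powr p"
    and ?du = "\<lambda>k x. \<bar>\<phi> k x - u x\<bar> powr p"
  let ?G = "\<lambda>k. \<integral>x. ?dg k x \<partial>lebesgue" and ?U = "\<lambda>k. \<integral>x. ?du k x \<partial>lebesgue"
  have p0: "p > 0" using p by simp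
  have \<phi>: "\<phi> k \<in> test_functions \<Omega>" for k
    using ap by (simp add: approximates_def)
  note X = X_space_Lp[OF u \<Omega>] and T = test_function_Lp[OF \<phi> p0]
  note gm [measurable] = gagliardo_measurable[OF T(1)] gagliardo_measurable[OF X(1)]
  define e where "e = (\<lambda>k. ?G k
      + ?U k)"
  have e0: "e k \<ge> 0" for k by (simp add: e_def)
  have e: "e \<longlonglongrightarrow> 0"
    using ap unfolding e_def approximates_def by (auto intro: tendsto_add_zero)
  have intg: "integrable lebesgue (\<lambda>x. ?dg k x)" for k
    by (rule integrable_norm_diff_powr[OF p T(3) X(3) T(4) X(4)])
  have intu: "integrable lebesgue (\<lambda>x. ?du k x)" for k
    using integrable_norm_diff_powr[OF p T(1) X(1), of k] T(2)[of k] X(2) by simp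
  define K where "K = (\<integral>\<^sup>+(h::'a). ennreal (min (norm h powr p) 1 / norm h powr (real DIM('a) + s * p)) \<partial>lborel)"
  have K: "K < \<infinity>" unfolding K_def by (rule fractional_kernel_finite[OF s p])
  then obtain K' where K': "K' \<ge> 0" "K = ennreal K'"
    by (cases K) auto
  define B where "B = K' * (2 powr p * 2 * 2 powr p)"
  have B: "B \<ge> 0" using K' by (simp add: B_def)
  have cauchy: "(\<integral>\<^sup>+z. ennreal (\<bar>?g (\<phi> j) z - ?g (\<phi> k) z\<bar> powr p) \<partial>?LL)
      \<le> ennreal (B * (e j + e k))" for j k
  proof -
    let ?f = "\<lambda>x. \<phi> j x - \<phi> k x" and ?f' = "\<lambda>x. gradient (\<phi> j) x - gradient (\<phi> k) x"
    define T1 T2 where "T1 = supp (\<phi> j)" and "T2 = supp (\<phi> k)"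
    have "C1_with_gradient (\<phi> j) (gradient (\<phi> j)) T1" "C1_with_gradient (\<phi> k) (gradient (\<phi> k)) T2"
      unfolding T1_def T2_def by (rule test_function_C1[OF \<phi>])+
    then have C1: "C1_with_gradient ?f ?f' (T1 \<union> T2)"
      unfolding C1_with_gradient_def inner_diff_left
      by (auto intro!: has_derivative_diff continuous_on_diff compact_Un)
    have "\<bar>?g (\<phi> j) z - ?g (\<phi> k) z\<bar> = \<bar>?g ?f z\<bar>" for z
      by (simp add: gagliardo_diff)
    then have "(\<integral>\<^sup>+z. ennreal (\<bar>?g (\<phi> j) z - ?g (\<phi> k) z\<bar> powr p) \<partial>?LL)
        \<le> K * (ennreal (2 powr p * 2) * ((\<integral>\<^sup>+x. ennreal (norm (?f' x) powr p) \<partial>lebesgue)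
          + (\<integral>\<^sup>+x. ennreal (\<bar>?f x\<bar> powr p) \<partial>lebesgue)))"
      using gagliardo_C1_bound[OF C1 p, of s] unfolding K_def by simp
    also have "\<dots> \<le> K * (ennreal (2 powr p * 2) * ennreal (2 powr p * (e j + e k)))"
    proof (intro mult_left_mono)
      have "(\<integral>\<^sup>+x. ennreal (norm (?f' x) powr p) \<partial>lebesgue)
          \<le> (\<integral>\<^sup>+x. ennreal (2 powr p * (?dg j x
              + ?dg k x)) \<partial>lebesgue)"
      proof (intro nn_integral_mono ennreal_leI)
        fix x
        show "norm (?f' x) powr p \<le> 2 powr p * (?dg j x
              + ?dg k x)"
          using norm_add_powr_le[OF p, of "gradient (\<phi> j) x - ext_gradient \<Omega> u x" "ext_gradient \<Omega> u x - gradient (\<phi> k) x"]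
          by (simp add: norm_minus_commute[of "ext_gradient \<Omega> u x"])
      qed
      also have "\<dots> = ennreal (2 powr p * (?G j
          + ?G k))"
        using intg[of j] intg[of k] by (subst nn_integral_eq_integral) auto
      finally have 1: "(\<integral>\<^sup>+x. ennreal (norm (?f' x) powr p) \<partial>lebesgue)
        \<le> ennreal (2 powr p * (?G j
          + ?G k))" .
      have "(\<integral>\<^sup>+x. ennreal (\<bar>?f x\<bar> powr p) \<partial>lebesgue)
          \<le> (\<integral>\<^sup>+x. ennreal (2 powr p * (?du j x + ?du k x)) \<partial>lebesgue)"
      proof (intro nn_integral_mono ennreal_leI)
        fix x
        show "\<bar>?f x\<bar> powr p \<le> 2 powr p * (?du j x + ?du k x)"
          using norm_add_powr_le[OF p, of "\<phi> j x - u x" "u x - \<phi> k x"]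
          by (simp add: abs_minus_commute[of "u x"])
      qed
      also have "\<dots> = ennreal (2 powr p * (?U j + ?U k))"
        using intu[of j] intu[of k] by (subst nn_integral_eq_integral) auto
      finally have 2: "(\<integral>\<^sup>+x. ennreal (\<bar>?f x\<bar> powr p) \<partial>lebesgue)
        \<le> ennreal (2 powr p * (?U j + ?U k))" .
      show "(\<integral>\<^sup>+x. ennreal (norm (?f' x) powr p) \<partial>lebesgue) + (\<integral>\<^sup>+x. ennreal (\<bar>?f x\<bar> powr p) \<partial>lebesgue)
          \<le> ennreal (2 powr p * (e j + e k))"
        using add_mono[OF 1 2] by (simp add: e_def algebra_simps flip: ennreal_plus)
    qed auto
    also have "\<dots> = ennreal (B * (e j + e k))"
      unfolding K'(2) B_def using K'(1) e0[of j] e0[of k] by (simp add: mult_ac flip: ennreal_mult)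
    finally show ?thesis .
  qed
  have "AE x in lebesgue. (\<lambda>k. \<phi> k x) \<longlonglongrightarrow> u x"
    using ap by (simp add: approximates_def)
  from AE_lebesgue_pair[OF this]
  have ae: "AE z in ?LL. (\<lambda>j. ?g (\<phi> j) z) \<longlonglongrightarrow> ?g u z"
  proof eventually_elim
    case (elim z)
    then show ?case unfolding gagliardo_def divide_inverse
      by (intro tendsto_mult tendsto_diff tendsto_const) auto
  qed
  have lim: "(\<integral>\<^sup>+z. ennreal (\<bar>?g u z - ?g (\<phi> k) z\<bar> powr p) \<partial>?LL) \<le> ennreal (B * e k)" for k
  proof (rule nn_integral_le_of_AE_tendsto[OF _ _ cauchy])
    show "(\<lambda>z. ennreal (\<bar>?g (\<phi> j) z - ?g (\<phi> k) z\<bar> powr p)) \<in> borel_measurable ?LL" for j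
      by measurable
    show "AE z in ?LL. (\<lambda>j. ennreal (\<bar>?g (\<phi> j) z - ?g (\<phi> k) z\<bar> powr p))
        \<longlonglongrightarrow> ennreal (\<bar>?g u z - ?g (\<phi> k) z\<bar> powr p)"
      using ae
    proof eventually_elim
      case (elim z)
      have "(\<lambda>j. \<bar>?g (\<phi> j) z - ?g (\<phi> k) z\<bar> powr p)
          \<longlonglongrightarrow> \<bar>?g u z - ?g (\<phi> k) z\<bar> powr p"
        by (rule tendsto_powr2[OF tendsto_rabs[OF tendsto_diff[OF elim tendsto_const]] tendsto_const])
          (use p0 in auto)
      then show ?case by (rule tendsto_ennrealI)
    qed
    have "(\<lambda>j. B * (e j + e k)) \<longlonglongrightarrow> B * (0 + e k)"
      by (intro tendsto_intros e)
    then show "(\<lambda>j. ennreal (B * (e j + e k))) \<longlonglongrightarrow> ennreal (B * e k)"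
      by (intro tendsto_ennrealI) simp
  qed
  have intT: "integrable ?LL (\<lambda>z. \<bar>?g (\<phi> k) z\<bar> powr p)" for k
    by (rule test_function_gagliardo_integrable[OF \<phi> p s])
  have intD: "integrable ?LL (\<lambda>z. \<bar>?g (\<phi> k) z - ?g u z\<bar> powr p)" for k
  proof (rule integrableI_bounded)
    show "(\<lambda>z. \<bar>?g (\<phi> k) z - ?g u z\<bar> powr p) \<in> borel_measurable ?LL"
      by measurable
    show "(\<integral>\<^sup>+z. ennreal (norm (\<bar>?g (\<phi> k) z - ?g u z\<bar> powr p)) \<partial>?LL) < \<infinity>"
      by (subst abs_minus_commute) (use le_less_trans[OF lim[of k]] in simp)
  qed
  show int: "integrable ?LL (\<lambda>z. \<bar>?g u z\<bar> powr p)"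
  proof -
    have "integrable ?LL (\<lambda>z. norm (?g (\<phi> 0) z - (?g (\<phi> 0) z - ?g u z)) powr p)"
      by (rule integrable_norm_diff_powr[OF p]) (use intT[of 0] intD[of 0] in \<open>simp_all\<close>)
    then show ?thesis by simp
  qed
  show "(\<lambda>k. \<integral>z. \<bar>?g (\<phi> k) z\<bar> powr p \<partial>?LL) \<longlonglongrightarrow> (\<integral>z. \<bar>?g u z\<bar> powr p \<partial>?LL)"
  proof -
    have "(\<lambda>k. \<integral>z. norm (?g (\<phi> k) z) powr p \<partial>?LL) \<longlonglongrightarrow> (\<integral>z. norm (?g u z) powr p \<partial>?LL)"
    proof (rule tendsto_integral_norm_powr[OF p gm])
      have le: "(\<integral>z. \<bar>?g (\<phi> k) z - ?g u z\<bar> powr p \<partial>?LL) \<le> B * e k" for k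
      proof -
        have "ennreal (\<integral>z. \<bar>?g (\<phi> k) z - ?g u z\<bar> powr p \<partial>?LL)
            = (\<integral>\<^sup>+z. ennreal (\<bar>?g (\<phi> k) z - ?g u z\<bar> powr p) \<partial>?LL)"
          by (rule nn_integral_eq_integral[OF intD, symmetric]) simp
        also have "\<dots> \<le> ennreal (B * e k)"
          by (subst abs_minus_commute) (rule lim)
        finally show ?thesis
          using B e0[of k] by (simp add: ennreal_le_iff)
      qed
      have Be: "(\<lambda>k. B * e k) \<longlonglongrightarrow> 0"
        by (rule tendsto_mult_right_zero[OF e])
      show "(\<lambda>k. \<integral>z. norm (?g (\<phi> k) z - ?g u z) powr p \<partial>?LL) \<longlonglongrightarrow> 0"
        by (rule tendsto_sandwich[OF always_eventually always_eventually tendsto_const Be])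
          (use le in simp_all)
    qed (use intT int in simp_all)
    then show ?thesis by simp
  qed
qed

section \<open>Smoothed combinations of two functions\<close>

text \<open>
  The \<open>\<ell>\<^sup>p\<close> norm of \<open>(f, g)\<close> with both absolute values replaced by \<open>\<surd>(t\<^sup>2 + e\<^sup>2)\<close>. For \<open>e > 0\<close> this is a smooth
  function of \<open>f\<close> and \<open>g\<close>; subtracting its value at \<open>f = g = 0\<close> keeps the support compact.
\<close>

definition lp_combination :: "real \<Rightarrow> real \<Rightarrow> ('a \<Rightarrow> real) \<Rightarrow> ('a \<Rightarrow> real) \<Rightarrow> 'a \<Rightarrow> real" where
  "lp_combination p e f g x =
     lp_norm p (sqrt ((f x)\<^sup>2 + e\<^sup>2)) (sqrt ((g x)\<^sup>2 + e\<^sup>2)) - lp_norm p e e"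

lemma lp_combination_test_function:
  assumes \<phi>: "\<phi> \<in> test_functions U" and \<psi>: "\<psi> \<in> test_functions U" and e: "e > 0"
  shows "lp_combination p e \<phi> \<psi> \<in> test_functions U"
proof -
  have e2: "(r::real)\<^sup>2 + e\<^sup>2 > 0" for r
    using e by (intro add_nonneg_pos) auto
  have root: "sqrt A powr p = A powr (p / 2)" if "A > 0" for A
    using that by (simp add: powr_half_sqrt[symmetric] powr_powr)
  have eq: "lp_combination p e \<phi> \<psi> = (\<lambda>x. (((\<phi> x * \<phi> x + e\<^sup>2) powr (p / 2)
      + (\<psi> x * \<psi> x + e\<^sup>2) powr (p / 2)) powr (1 / p)) + - lp_norm p e e)"
    by (simp add: lp_combination_def lp_norm_def root[OF e2] fun_eq_iff flip: power2_eq_square)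
  have sq: "(r::real) * r + e\<^sup>2 > 0" for r
    using e2[of r] by (simp add: power2_eq_square)
  have "Ck k (lp_combination p e \<phi> \<psi>)" for k
    unfolding eq using \<phi> \<psi> sq
    by (intro Ck_add Ck_const Ck_powr Ck_mult) (auto simp: test_functions_def less_imp_neq[OF sq, symmetric] intro!: add_pos_pos)
  moreover have "{x. lp_combination p e \<phi> \<psi> x \<noteq> 0} \<subseteq> {x. \<phi> x \<noteq> 0} \<union> {x. \<psi> x \<noteq> 0}"
    using e by (auto simp: lp_combination_def)
  then have sub: "supp (lp_combination p e \<phi> \<psi>) \<subseteq> supp \<phi> \<union> supp \<psi>"
    using closure_mono by (simp flip: closure_Un)
  moreover have T: "compact (supp \<phi> \<union> supp \<psi>)"
    "supp \<phi> \<union> supp \<psi> \<subseteq> U"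
    using \<phi> \<psi> unfolding test_functions_def by (blast intro: compact_Un)+
  moreover have "compact (supp (lp_combination p e \<phi> \<psi>))"
    using compact_Int_closed[OF T(1) closed_closure[of "{x. lp_combination p e \<phi> \<psi> x \<noteq> 0}"]]
    unfolding Int_absorb1[OF sub] .
  ultimately show ?thesis
    unfolding test_functions_def mem_Collect_eq by blast
qed

lemma sqrt_sum_squares_Lipschitz: "\<bar>sqrt (a\<^sup>2 + e\<^sup>2) - sqrt (b\<^sup>2 + e\<^sup>2)\<bar> \<le> \<bar>a - b\<bar>"
proof -
  have "\<bar>norm (a, e) - norm (b, e)\<bar> \<le> norm ((a, e) - (b, e))"
    by (rule norm_triangle_ineq3)
  then show ?thesis by (simp add: norm_Pair)
qed

text \<open>
  The smoothing \<open>t \<mapsto> \<surd>(t\<^sup>2 + e\<^sup>2)\<close> does not increase distances, so the convexity estimate for the \<open>\<ell>\<^sup>p\<close> norm is preserved.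
\<close>

lemma lp_combination_diff_powr_le:
  assumes p: "p > 1"
  shows "\<bar>lp_combination p e f g x - lp_combination p e f g y\<bar> powr p
    \<le> \<bar>f x - f y\<bar> powr p + \<bar>g x - g y\<bar> powr p"
proof -
  let ?r = "\<lambda>t. sqrt (t\<^sup>2 + e\<^sup>2)"
  have "\<bar>lp_combination p e f g x - lp_combination p e f g y\<bar> powr p
      \<le> \<bar>?r (f x) - ?r (f y)\<bar> powr p + \<bar>?r (g x) - ?r (g y)\<bar> powr p"
    using lp_norm_diff_powr_le(1)[OF p, of "?r (f x)" "?r (g x)" "?r (f y)" "?r (g y)"]
    by (simp add: lp_combination_def)
  also have "\<dots> \<le> \<bar>f x - f y\<bar> powr p + \<bar>g x - g y\<bar> powr p"
    using p by (intro add_mono powr_mono2 sqrt_sum_squares_Lipschitz) auto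
  finally show ?thesis .
qed

text \<open>
  The convexity estimate for the gradient is the infinitesimal form of the one for differences: apply the latter
  to \<open>x\<close> and \<open>x + t h\<close>, where \<open>h\<close> is the direction of the gradient of \<open>w\<close>, and let \<open>t\<close> tend to 0.
\<close>

lemma norm_gradient_powr_le:
  fixes w f g :: "'a::euclidean_space \<Rightarrow> real"
  assumes p: "p > 1"
    and le: "\<And>x y. \<bar>w x - w y\<bar> powr p \<le> \<bar>f x - f y\<bar> powr p + \<bar>g x - g y\<bar> powr p"
    and d: "(w has_derivative (\<lambda>h. w' \<bullet> h)) (at x)" "(f has_derivative (\<lambda>h. f' \<bullet> h)) (at x)"
      "(g has_derivative (\<lambda>h. g' \<bullet> h)) (at x)"
  shows "norm w' powr p \<le> norm f' powr p + norm g' powr p"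
proof -
  define h where "h = sgn w'"
  have h: "norm h \<le> 1" "w' \<bullet> h = norm w'"
    by (simp add: h_def norm_sgn)
      (cases "w' = 0", simp_all add: h_def sgn_div_norm dot_square_norm power2_eq_square)
  let ?q = "\<lambda>k t. \<bar>(k (x + t *\<^sub>R h) - k x) / t\<bar> powr p"
  have lim: "(?q k \<longlongrightarrow> \<bar>k' \<bullet> h\<bar> powr p) (at 0)"
    if "(k has_derivative (\<lambda>h. k' \<bullet> h)) (at x)" for k k'
    by (rule tendsto_powr2[OF tendsto_rabs[OF difference_quotient_tendsto[OF that]] tendsto_const])
      (use p in auto)
  have "\<bar>w' \<bullet> h\<bar> powr p \<le> \<bar>f' \<bullet> h\<bar> powr p + \<bar>g' \<bullet> h\<bar> powr p"
  proof (rule tendsto_le[OF _ tendsto_add[OF lim[OF d(2)] lim[OF d(3)]] lim[OF d(1)]])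
    show "\<forall>\<^sub>F t in at 0. ?q w t \<le> ?q f t + ?q g t"
    proof (rule always_eventually, rule allI)
      fix t :: real
      have "\<bar>w (x + t *\<^sub>R h) - w x\<bar> powr p / \<bar>t\<bar> powr p
          \<le> (\<bar>f (x + t *\<^sub>R h) - f x\<bar> powr p + \<bar>g (x + t *\<^sub>R h) - g x\<bar> powr p) / \<bar>t\<bar> powr p"
        by (intro divide_right_mono le) auto
      then show "?q w t \<le> ?q f t + ?q g t"
        by (simp add: abs_divide powr_divide add_divide_distrib)
    qed
  qed simp
  also have "\<dots> \<le> norm f' powr p + norm g' powr p"
  proof -
    have "\<bar>k \<bullet> h\<bar> \<le> norm k" for k
      using Cauchy_Schwarz_ineq2[of k h] h(1) by (meson mult_left_le norm_ge_zero order_trans)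
    then show ?thesis
      using p by (intro add_mono powr_mono2) auto
  qed
  finally show ?thesis using h(2) by simp
qed

lemma lp_norm_tendsto:
  assumes p: "p > 1" and "(f \<longlongrightarrow> a) net" "(g \<longlongrightarrow> b) net"
  shows "((\<lambda>k. lp_norm p (f k) (g k)) \<longlongrightarrow> lp_norm p a b) net"
  unfolding lp_norm_def
  by (intro tendsto_powr2 tendsto_add tendsto_rabs tendsto_const assms always_eventually)
    (use p in auto)

lemma lp_norm_diagonal_tendsto_0:
  assumes "p > 1"
  shows "(\<lambda>k. lp_norm p (inverse (real (Suc k))) (inverse (real (Suc k)))) \<longlonglongrightarrow> 0"
  using lp_norm_tendsto[OF assms LIMSEQ_inverse_real_of_nat LIMSEQ_inverse_real_of_nat]
    lp_norm_eq_0_iff[OF assms, of 0 0] by simp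

lemma lp_combination_tendsto:
  assumes p: "p > 1" and "(\<lambda>k. f k x) \<longlonglongrightarrow> a" "(\<lambda>k. g k x) \<longlonglongrightarrow> b"
  shows "(\<lambda>k. lp_combination p (inverse (real (Suc k))) (f k) (g k) x) \<longlonglongrightarrow> lp_norm p a b"
proof -
  note e = LIMSEQ_inverse_real_of_nat
  have "(\<lambda>k. lp_combination p (inverse (real (Suc k))) (f k) (g k) x)
      \<longlonglongrightarrow> lp_norm p (sqrt (a\<^sup>2 + 0\<^sup>2)) (sqrt (b\<^sup>2 + 0\<^sup>2)) - 0"
    unfolding lp_combination_def
    by (intro tendsto_diff lp_norm_tendsto[OF p] lp_norm_diagonal_tendsto_0[OF p] tendsto_intros assms e)
  then show ?thesis by (simp add: lp_norm_def)
qed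

text \<open>
  Used for convergence of the masses: the smoothing contributes an error that vanishes uniformly with \<open>e\<close>, and the
  \<open>\<ell>\<^sup>p\<close> norm itself is Lipschitz.
\<close>

lemma lp_combination_near_lp_norm:
  assumes p: "p > 1" and e: "e > 0"
  shows "\<bar>lp_combination p e f g x - lp_norm p a b\<bar> powr p
    \<le> 2 powr p * ((2 * lp_norm p e e) powr p + (\<bar>f x - a\<bar> powr p + \<bar>g x - b\<bar> powr p))"
proof -
  let ?r = "\<lambda>t. sqrt (t\<^sup>2 + e\<^sup>2)" and ?n = "lp_norm p (f x) (g x)"
  have abs: "?n = lp_norm p \<bar>f x\<bar> \<bar>g x\<bar>" by (simp add: lp_norm_def)
  have r: "\<bar>?r t - \<bar>t\<bar>\<bar> \<le> e" for t
  proof -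
    have "\<bar>t\<bar> \<le> ?r t" by (rule real_le_rsqrt) simp
    moreover have "?r t \<le> \<bar>t\<bar> + e"
      using sqrt_sum_squares_le_sum_abs[of t e] e by simp
    ultimately show ?thesis by simp
  qed
  have "\<bar>lp_norm p (?r (f x)) (?r (g x)) - ?n\<bar> powr p \<le> \<bar>e\<bar> powr p + \<bar>e\<bar> powr p"
    unfolding abs
    by (rule order_trans[OF lp_norm_diff_powr_le(1)[OF p]], intro add_mono powr_mono2)
      (use r p e in auto)
  then have "\<bar>lp_norm p (?r (f x)) (?r (g x)) - ?n\<bar> powr p \<le> lp_norm p e e powr p"
    using lp_norm_powr[OF p] by simp
  then have "\<bar>lp_norm p (?r (f x)) (?r (g x)) - ?n\<bar> \<le> lp_norm p e e"
    using powr_less_mono2[of p "lp_norm p e e"] p lp_norm_nonneg[of p e e] by (meson not_le less_trans zero_less_one)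
  then have "\<bar>lp_combination p e f g x - ?n\<bar> \<le> 2 * lp_norm p e e"
    using lp_norm_nonneg[of p e e] by (simp add: lp_combination_def)
  then have 1: "\<bar>lp_combination p e f g x - ?n\<bar> powr p \<le> (2 * lp_norm p e e) powr p"
    using p by (intro powr_mono2) auto
  have 2: "\<bar>?n - lp_norm p a b\<bar> powr p \<le> \<bar>f x - a\<bar> powr p + \<bar>g x - b\<bar> powr p"
    by (rule lp_norm_diff_powr_le(1)[OF p])
  have "\<bar>lp_combination p e f g x - lp_norm p a b\<bar> powr p
      \<le> 2 powr p * (\<bar>lp_combination p e f g x - ?n\<bar> powr p + \<bar>?n - lp_norm p a b\<bar> powr p)"
    using norm_add_powr_le[OF p, of "lp_combination p e f g x - ?n" "?n - lp_norm p a b"] by simp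
  also have "\<dots> \<le> 2 powr p * ((2 * lp_norm p e e) powr p + (\<bar>f x - a\<bar> powr p + \<bar>g x - b\<bar> powr p))"
    by (intro mult_left_mono add_mono 1 2) auto
  finally show ?thesis .
qed

lemma integral_lebesgue_on_AE_vanishing:
  fixes h :: "'a::euclidean_space \<Rightarrow> real"
  assumes \<Omega>: "open \<Omega>" and [measurable]: "h \<in> borel_measurable lebesgue"
    and ae: "AE x in lebesgue. x \<notin> \<Omega> \<longrightarrow> h x = 0"
  shows "integral\<^sup>L (lebesgue_on \<Omega>) h = integral\<^sup>L lebesgue h"
proof -
  have [measurable]: "\<Omega> \<in> sets lebesgue" using \<Omega> by simp
  have "integral\<^sup>L (lebesgue_on \<Omega>) h = (\<integral>x. indicator \<Omega> x *\<^sub>R h x \<partial>lebesgue)"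
    by (intro integral_restrict_space) simp
  also have "\<dots> = integral\<^sup>L lebesgue h"
  proof (rule integral_cong_AE)
    show "AE x in lebesgue. indicator \<Omega> x *\<^sub>R h x = h x"
      using ae by eventually_elim (auto split: split_indicator)
  qed measurable
  finally show ?thesis .
qed

lemma ennreal_liminf_add_le:
  fixes a b :: "nat \<Rightarrow> ennreal"
  shows "liminf a + liminf b \<le> liminf (\<lambda>k. a k + b k)"
proof -
  have inc: "incseq (\<lambda>n. INF k\<in>{n..}. c k)" for c :: "nat \<Rightarrow> ennreal"
    by (intro monoI INF_superset_mono) auto
  have "liminf a + liminf b = (SUP n. (INF k\<in>{n..}. a k) + (INF k\<in>{n..}. b k))"
    unfolding liminf_SUP_INF by (rule ennreal_SUP_add[OF inc inc, symmetric])
  also have "\<dots> \<le> (SUP n. INF k\<in>{n..}. a k + b k)"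
    by (intro SUP_mono' INF_greatest add_mono INF_lower)
  finally show ?thesis by (simp add: liminf_SUP_INF)
qed

text \<open>
  Fatou's lemma for a sum of integrals over different measure spaces, as needed for a double integral plus a
  single one.
\<close>

lemma nn_integral_add_le_of_AE_tendsto:
  fixes f :: "'b \<Rightarrow> ennreal" and g :: "'c \<Rightarrow> ennreal"
  assumes "\<And>k. fk k \<in> borel_measurable M" "\<And>k. gk k \<in> borel_measurable M'"
    and ae: "AE x in M. (\<lambda>k. fk k x) \<longlonglongrightarrow> f x" "AE x in M'. (\<lambda>k. gk k x) \<longlonglongrightarrow> g x"
    and le: "\<And>k. integral\<^sup>N M (fk k) + integral\<^sup>N M' (gk k) \<le> c k" and c: "c \<longlonglongrightarrow> c0"
  shows "integral\<^sup>N M f + integral\<^sup>N M' g \<le> c0"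
proof -
  have "integral\<^sup>N M f + integral\<^sup>N M' g \<le> liminf (\<lambda>k. integral\<^sup>N M (fk k)) + liminf (\<lambda>k. integral\<^sup>N M' (gk k))"
    by (intro add_mono fatou_AE_tendsto assms)
  also have "\<dots> \<le> liminf (\<lambda>k. integral\<^sup>N M (fk k) + integral\<^sup>N M' (gk k))"
    by (rule ennreal_liminf_add_le)
  also have "\<dots> \<le> liminf c"
    by (intro Liminf_mono always_eventually allI le)
  also have "\<dots> = c0"
    using c by (simp add: lim_imp_Liminf)
  finally show ?thesis .
qed

section \<open>Simplicity of the first eigenvalue\<close>

text \<open>
  For \<open>\<theta> < 1\<close> the weight is less singular at the origin than the Hardy weight, so it is dominated by any multiple of
  the latter up to a constant; for \<open>\<theta> = 1\<close> the two have the same order and the constants are compared directly.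
\<close>

lemma hardy_weight_bound:
  fixes p \<theta> \<mu> c :: real
  assumes p: "p > 1" and \<theta>: "0 < \<theta>" "\<theta> \<le> 1" and \<mu>: "0 < \<mu>" and c: "c > 0" "\<theta> = 1 \<Longrightarrow> \<mu> \<le> c"
  shows "\<exists>K\<ge>0. \<forall>r>0. \<mu> / r powr (p * \<theta>) \<le> c / r powr p + K"
proof (cases "\<theta> = 1")
  case True
  then show ?thesis using c(2) by (intro exI[of _ 0]) (auto intro: divide_right_mono)
next
  case False
  define \<delta> where "\<delta> = p * (1 - \<theta>)"
  have \<delta>: "\<delta> > 0" using p \<theta> False by (simp add: \<delta>_def)
  \<comment> \<open>Below the radius \<open>R\<close> the factor \<open>r\<^bsup>p(1-\<theta>)\<^esup>\<close> is at most \<open>c/\<mu>\<close>; above it the weight is bounded.\<close>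
  define R where "R = (c / \<mu>) powr (1 / \<delta>)"
  have R: "R > 0" using c \<mu> by (simp add: R_def)
  have R\<delta>: "R powr \<delta> = c / \<mu>" using c \<mu> \<delta> by (simp add: R_def powr_powr)
  show ?thesis
  proof (intro exI[of _ "\<mu> / R powr (p * \<theta>)"] conjI allI impI)
    show "0 \<le> \<mu> / R powr (p * \<theta>)" using \<mu> by simp
    fix r :: real assume r: "r > 0"
    show "\<mu> / r powr (p * \<theta>) \<le> c / r powr p + \<mu> / R powr (p * \<theta>)"
    proof (cases "r \<le> R")
      case True
      then have "r powr \<delta> \<le> c / \<mu>"
        using powr_mono2[of \<delta> r R] r \<delta> by (simp add: R\<delta>)
      then have "\<mu> * r powr \<delta> \<le> c" using \<mu> by (simp add: field_simps)
      then have "\<mu> * r powr \<delta> / r powr p \<le> c / r powr p" by (rule divide_right_mono) simp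
      moreover have "r powr \<delta> / r powr p = 1 / r powr (p * \<theta>)"
        using r by (simp add: \<delta>_def algebra_simps powr_diff)
      ultimately have "\<mu> / r powr (p * \<theta>) \<le> c / r powr p"
        by (metis times_divide_eq_right mult.right_neutral)
      then show ?thesis using \<mu> by (intro add_increasing2) auto
    next
      case False
      then have "R powr (p * \<theta>) \<le> r powr (p * \<theta>)"
        using R p \<theta> by (intro powr_mono2) auto
      then have "\<mu> / r powr (p * \<theta>) \<le> \<mu> / R powr (p * \<theta>)"
        using \<mu> R r by (intro divide_left_mono) auto
      then show ?thesis using c by (intro add_increasing) auto
    qed
  qed
qed

locale hardy_sobolev_problem =
  fixes \<Omega> :: "'a::euclidean_space set" and p s \<theta> \<mu> :: real
  assumes s: "0 < s" "s < 1" and p: "1 < p" "p < real DIM('a)"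
    and \<theta>: "s \<le> \<theta>" "\<theta> \<le> 1"
    and \<Omega>: "open \<Omega>" "bounded \<Omega>"
    and \<mu>: "0 < \<mu>" "\<mu> < mu0 DIM('a) p s \<theta>"
begin

abbreviation "E \<equiv> energy p s \<theta> \<mu> \<Omega>"
abbreviation "\<Lambda> \<equiv> lambda1 p s \<theta> \<mu> \<Omega>"
abbreviation "X \<equiv> X_space p \<Omega>"
abbreviation "mass a \<equiv> \<integral>x. \<bar>a x\<bar> powr p \<partial>(lebesgue :: 'a measure)"
abbreviation "hardy a \<equiv> \<integral>x. \<bar>a x\<bar> powr p / norm x powr (p * \<theta>) \<partial>(lebesgue :: 'a measure)"
abbreviation "dirichlet a \<equiv> \<integral>x. norm (ext_gradient \<Omega> a x) powr p \<partial>lebesgue"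
abbreviation "smooth_dirichlet a \<equiv> \<integral>x. norm (gradient a x) powr p \<partial>(lebesgue :: 'a measure)"
abbreviation "LL \<equiv> lebesgue \<Otimes>\<^sub>M (lebesgue :: 'a measure)"
abbreviation "nonlocal a \<equiv> \<integral>z. \<bar>gagliardo p s a z\<bar> powr p \<partial>LL"

lemma p_pos: "p > 0"
  using p by simp

lemma weight_measurable [measurable]:
  assumes [measurable]: "u \<in> borel_measurable (lebesgue :: 'a measure)"
  shows "(\<lambda>x. \<bar>u x\<bar> powr p / norm x powr a) \<in> borel_measurable lebesgue"
proof -
  have [measurable]: "(\<lambda>x::'a. x) \<in> borel_measurable lebesgue"
    by (intro measurable_completion) simp
  show ?thesis by measurable
qed

lemma X_space_integral_Lp:
  assumes u: "u \<in> X"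
  shows "(\<integral>x. \<bar>u x\<bar> powr p \<partial>lebesgue_on \<Omega>) = mass u"
proof (rule integral_lebesgue_on_AE_vanishing[OF \<Omega>(1)])
  have [measurable]: "u \<in> borel_measurable lebesgue" by (rule X_space_Lp(1)[OF u \<Omega>(1)])
  show "(\<lambda>x. \<bar>u x\<bar> powr p) \<in> borel_measurable lebesgue" by measurable
  show "AE x in lebesgue. x \<notin> \<Omega> \<longrightarrow> \<bar>u x\<bar> powr p = 0"
    using X_space_vanishes_outside[OF u] by eventually_elim auto
qed

lemma energy_X_space:
  assumes u: "u \<in> X"
  shows "E u = dirichlet u + nonlocal u
    - \<mu> * hardy u"
proof -
  have "(\<integral>x. norm (weak_gradient \<Omega> u x) powr p \<partial>lebesgue_on \<Omega>)
      = (\<integral>x. indicator \<Omega> x *\<^sub>R norm (weak_gradient \<Omega> u x) powr p \<partial>lebesgue)"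
    using \<Omega> by (intro integral_restrict_space) simp
  also have "\<dots> = dirichlet u"
    by (intro Bochner_Integration.integral_cong) (auto simp: ext_gradient_def split: split_indicator)
  finally have 1: "(\<integral>x. norm (weak_gradient \<Omega> u x) powr p \<partial>lebesgue_on \<Omega>)
      = dirichlet u" .
  have 2: "(\<lambda>(x, y). \<bar>u x - u y\<bar> powr p / norm (x - y) powr (real DIM('a) + s * p))
      = (\<lambda>z. \<bar>gagliardo p s u z\<bar> powr p)"
    by (auto simp: fun_eq_iff gagliardo_powr[OF p(1)])
  have 3: "(\<integral>x. \<bar>u x\<bar> powr p / norm x powr (p * \<theta>) \<partial>lebesgue_on \<Omega>)
      = hardy u"
  proof (rule integral_lebesgue_on_AE_vanishing[OF \<Omega>(1)])
    show "(\<lambda>x. \<bar>u x\<bar> powr p / norm x powr (p * \<theta>)) \<in> borel_measurable lebesgue"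
      by (rule weight_measurable[OF X_space_Lp(1)[OF u \<Omega>(1)]])
    show "AE x in lebesgue. x \<notin> \<Omega> \<longrightarrow> \<bar>u x\<bar> powr p / norm x powr (p * \<theta>) = 0"
      using X_space_vanishes_outside[OF u] by eventually_elim auto
  qed
  show ?thesis unfolding energy_def 1 2 3 ..
qed

text \<open>
  The singular term is absorbed by the local part of the energy, up to a multiple of the mass. Here the bound
  \<open>\<mu> < mu0\<close> enters: for \<open>\<theta> = 1\<close> it says that \<open>\<mu>\<close> lies below the sharp Hardy constant.
\<close>

lemma ex_hardy_remainder:
  "\<exists>K\<ge>0. \<forall>u\<in>X. integrable lebesgue (\<lambda>x. \<bar>u x\<bar> powr p / norm x powr (p * \<theta>)) \<and>
     \<mu> * hardy u
       \<le> dirichlet u + K * mass u"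
proof -
  define c where "c = C_H DIM('a) p"
  have c: "c > 0" using p by (simp add: c_def C_H_def)
  have cM: "c * (p / (real DIM('a) - p)) powr p = 1"
    using p by (simp add: c_def C_H_def flip: powr_mult)
  have "\<theta> = 1 \<Longrightarrow> \<mu> \<le> c"
    using \<mu> s by (simp add: mu0_def c_def)
  then obtain K where K: "K \<ge> 0" "\<And>r. r > 0 \<Longrightarrow> \<mu> / r powr (p * \<theta>) \<le> c / r powr p + K"
    using hardy_weight_bound[OF p(1) _ \<theta>(2) \<mu>(1) c] s \<theta> by auto
  show ?thesis
  proof (intro exI[of _ K] conjI ballI K(1))
    fix u assume u: "u \<in> X"
    note L = X_space_Lp[OF u \<Omega>(1)]
    note [measurable] = L(1)
    have hardy: "(\<integral>\<^sup>+x. ennreal (\<bar>u x\<bar> powr p / norm x powr p) \<partial>lebesgue)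
        \<le> ennreal ((p / (real DIM('a) - p)) powr p * dirichlet u)"
      by (rule hardy_inequality_X_space[OF u \<Omega>(1) p])
    have inth: "integrable lebesgue (\<lambda>x. \<bar>u x\<bar> powr p / norm x powr p)"
    proof (rule integrableI_bounded)
      show "(\<integral>\<^sup>+x. ennreal (norm (\<bar>u x\<bar> powr p / norm x powr p)) \<partial>lebesgue) < \<infinity>"
        using le_less_trans[OF hardy] by simp
    qed measurable
    have "ennreal (\<integral>x. \<bar>u x\<bar> powr p / norm x powr p \<partial>lebesgue)
        \<le> ennreal ((p / (real DIM('a) - p)) powr p * dirichlet u)"
      using hardy nn_integral_eq_integral[OF inth] by simp
    then have "(\<integral>x. \<bar>u x\<bar> powr p / norm x powr p \<partial>lebesgue)
        \<le> (p / (real DIM('a) - p)) powr p * dirichlet u"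
      by (subst (asm) ennreal_le_iff) auto
    from mult_left_mono[OF this less_imp_le[OF c]]
    have ch: "c * (\<integral>x. \<bar>u x\<bar> powr p / norm x powr p \<partial>lebesgue) \<le> dirichlet u"
      by (simp add: mult.assoc[symmetric] cM)
    have pt: "\<mu> * (\<bar>u x\<bar> powr p / norm x powr (p * \<theta>))
        \<le> c * (\<bar>u x\<bar> powr p / norm x powr p) + K * \<bar>u x\<bar> powr p" for x
    proof (cases "x = 0")
      case False
      then have "\<bar>u x\<bar> powr p * (\<mu> / norm x powr (p * \<theta>)) \<le> \<bar>u x\<bar> powr p * (c / norm x powr p + K)"
        by (intro mult_left_mono K) auto
      then show ?thesis by (simp add: algebra_simps)
    qed (use K(1) in simp)
    have int: "integrable lebesgue (\<lambda>x. c * (\<bar>u x\<bar> powr p / norm x powr p) + K * \<bar>u x\<bar> powr p)"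
      by (intro Bochner_Integration.integrable_add integrable_mult_right inth L)
    have int\<mu>: "integrable lebesgue (\<lambda>x. \<mu> * (\<bar>u x\<bar> powr p / norm x powr (p * \<theta>)))"
    proof (rule Bochner_Integration.integrable_bound[OF int])
      show "(\<lambda>x. \<mu> * (\<bar>u x\<bar> powr p / norm x powr (p * \<theta>))) \<in> borel_measurable lebesgue"
        by (intro borel_measurable_times borel_measurable_const weight_measurable L(1))
      show "AE x in lebesgue. norm (\<mu> * (\<bar>u x\<bar> powr p / norm x powr (p * \<theta>)))
          \<le> norm (c * (\<bar>u x\<bar> powr p / norm x powr p) + K * \<bar>u x\<bar> powr p)"
      proof (rule AE_I2)
        fix x
        have "0 \<le> \<mu> * (\<bar>u x\<bar> powr p / norm x powr (p * \<theta>))" using \<mu>(1) by simp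
        with pt[of x] show "norm (\<mu> * (\<bar>u x\<bar> powr p / norm x powr (p * \<theta>)))
          \<le> norm (c * (\<bar>u x\<bar> powr p / norm x powr p) + K * \<bar>u x\<bar> powr p)"
          unfolding real_norm_def by linarith
      qed
    qed
    then show "integrable lebesgue (\<lambda>x. \<bar>u x\<bar> powr p / norm x powr (p * \<theta>))"
      using integrable_mult_right[of "1 / \<mu>", OF int\<mu>] \<mu>(1) by simp
    have "\<mu> * hardy u
        = (\<integral>x. \<mu> * (\<bar>u x\<bar> powr p / norm x powr (p * \<theta>)) \<partial>lebesgue)"
      by (rule integral_mult_right_zero[symmetric])
    also have "\<dots> \<le> (\<integral>x. c * (\<bar>u x\<bar> powr p / norm x powr p) + K * \<bar>u x\<bar> powr p \<partial>lebesgue)"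
      by (rule integral_mono[OF int\<mu> int pt])
    also have "\<dots> = c * (\<integral>x. \<bar>u x\<bar> powr p / norm x powr p \<partial>lebesgue) + K * mass u"
      using inth L(2) by (simp del: times_divide_eq_right)
    finally show "\<mu> * hardy u
       \<le> dirichlet u + K * mass u"
      using ch by linarith
  qed
qed

lemma hardy_term_integrable:
  "u \<in> X \<Longrightarrow> integrable lebesgue (\<lambda>x. \<bar>u x\<bar> powr p / norm x powr (p * \<theta>))"
  using ex_hardy_remainder by blast

lemma ex_energy_lower_bound: "\<exists>K\<ge>0. \<forall>u\<in>X. - K * mass u \<le> E u"
proof -
  obtain K where K: "K \<ge> 0" "\<forall>u\<in>X. integrable lebesgue (\<lambda>x. \<bar>u x\<bar> powr p / norm x powr (p * \<theta>)) \<and>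
     \<mu> * hardy u
       \<le> dirichlet u + K * mass u"
    using ex_hardy_remainder by blast
  have "- K * mass u \<le> E u" if u: "u \<in> X" for u
  proof -
    have "0 \<le> nonlocal u" by simp
    then show ?thesis
      using conjunct2[OF bspec[OF K(2) u]] unfolding energy_X_space[OF u] mult_minus_left by linarith
  qed
  with K(1) show ?thesis by blast
qed

lemma energy_test_function:
  assumes \<phi>: "\<phi> \<in> test_functions \<Omega>"
  shows "E \<phi> = smooth_dirichlet \<phi> + nonlocal \<phi>
    - \<mu> * hardy \<phi>"
proof -
  have \<phi>X: "\<phi> \<in> X" by (rule test_function_X_space[OF \<phi> \<Omega>(1) p_pos])
  have "AE x in lebesgue. x \<in> \<Omega> \<longrightarrow> weak_gradient \<Omega> \<phi> x = gradient \<phi> x"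
    by (rule AE_weak_gradient_eq[OF \<Omega>(1) C1_has_weak_gradient[OF test_function_C1[OF \<phi>] \<Omega>(1)]])
  then have ae: "AE x in lebesgue. norm (ext_gradient \<Omega> \<phi> x) powr p = norm (gradient \<phi> x) powr p"
    by eventually_elim (use test_function_outside(2)[OF \<phi>] in \<open>auto simp: ext_gradient_def split: split_indicator\<close>)
  have [measurable]: "ext_gradient \<Omega> \<phi> \<in> borel_measurable lebesgue" "gradient \<phi> \<in> borel_measurable lebesgue"
    using X_space_Lp(3)[OF \<phi>X \<Omega>(1)] test_function_Lp(3)[OF \<phi> p_pos] by auto
  have "dirichlet \<phi> = smooth_dirichlet \<phi>"
    by (rule integral_cong_AE[OF _ _ ae]) measurable
  then show ?thesis using energy_X_space[OF \<phi>X] by simp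
qed

lemma energy_scale:
  assumes \<phi>: "\<phi> \<in> test_functions \<Omega>" and c: "c > 0"
  shows "E (\<lambda>x. c * \<phi> x) = c powr p * E \<phi>"
proof -
  have "((\<lambda>x. c * \<phi> x) has_derivative (\<lambda>h. (c *\<^sub>R gradient \<phi> x) \<bullet> h)) (at x)" for x
    using has_derivative_mult_right[OF test_function_has_derivative[OF \<phi>], of c x] by simp
  then have g: "gradient (\<lambda>x. c * \<phi> x) x = c *\<^sub>R gradient \<phi> x" for x
    by (rule gradient_eqI)
  have 1: "norm (gradient (\<lambda>x. c * \<phi> x) x) powr p = c powr p * norm (gradient \<phi> x) powr p" for x
    using c by (simp add: g powr_mult)
  have 2: "\<bar>gagliardo p s (\<lambda>x. c * \<phi> x) z\<bar> powr p = c powr p * \<bar>gagliardo p s \<phi> z\<bar> powr p" for z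
  proof -
    have "gagliardo p s (\<lambda>x. c * \<phi> x) z = c * gagliardo p s \<phi> z"
      by (simp add: gagliardo_def right_diff_distrib)
    then show ?thesis using c by (simp add: abs_mult powr_mult)
  qed
  have 3: "\<bar>c * \<phi> x\<bar> powr p / r = c powr p * (\<bar>\<phi> x\<bar> powr p / r)" for x r
    using c by (simp add: abs_mult powr_mult)
  show ?thesis
    unfolding energy_test_function[OF \<phi>] energy_test_function[OF test_function_scale[OF \<phi>]] 1 2 3
      integral_mult_right_zero
    by (simp add: algebra_simps)
qed

text \<open>
  Normalising the mass shows that the energy is at least the infimum, which is a genuine lower bound because the
  admissible energies are bounded below.
\<close>

lemma lambda1_le_energy:
  assumes \<phi>: "\<phi> \<in> test_functions \<Omega>"
  shows "\<Lambda> * mass \<phi> \<le> E \<phi>"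
proof -
  obtain K where K: "K \<ge> 0" "\<And>u. u \<in> X \<Longrightarrow> - K * mass u \<le> E u"
    using ex_energy_lower_bound by blast
  define m where "m = mass \<phi>"
  have \<phi>X: "\<phi> \<in> X" by (rule test_function_X_space[OF \<phi> \<Omega>(1) p_pos])
  have m0: "m \<ge> 0" by (simp add: m_def)
  show ?thesis
  proof (cases "m = 0")
    case True
    then show ?thesis using K(2)[OF \<phi>X] by (simp add: m_def)
  next
    case False
    with m0 have m: "m > 0" by simp
    define c where "c = m powr (- 1 / p)"
    have c: "c > 0" "c powr p = 1 / m"
    proof -
      show "c > 0" using m by (simp add: c_def)
      have "c powr p = m powr - 1"
        unfolding c_def powr_powr using p_pos by simp
      then show "c powr p = 1 / m" using m by (simp add: powr_minus_divide)
    qed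
    let ?v = "\<lambda>x. c * \<phi> x"
    have v: "?v \<in> X"
      by (rule test_function_X_space[OF test_function_scale[OF \<phi>] \<Omega>(1) p_pos])
    have "(\<integral>x. \<bar>?v x\<bar> powr p \<partial>lebesgue_on \<Omega>) = (\<integral>x. c powr p * \<bar>\<phi> x\<bar> powr p \<partial>lebesgue)"
      unfolding X_space_integral_Lp[OF v] using c(1) by (simp add: abs_mult powr_mult)
    also have "\<dots> = 1" using m c(2) by (simp add: m_def)
    finally have v1: "(\<integral>x. \<bar>?v x\<bar> powr p \<partial>lebesgue_on \<Omega>) = 1" .
    let ?S = "{E u | u. u \<in> X \<and> (\<integral>x. \<bar>u x\<bar> powr p \<partial>lebesgue_on \<Omega>) = 1}"
    have "bdd_below ?S"
    proof (rule bdd_belowI)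
      fix t assume "t \<in> ?S"
      then obtain u where "t = E u" "u \<in> X" "(\<integral>x. \<bar>u x\<bar> powr p \<partial>lebesgue_on \<Omega>) = 1"
        by blast
      then show "- K \<le> t"
        using K(2)[of u] X_space_integral_Lp[of u] by simp
    qed
    moreover have "E ?v \<in> ?S" using v v1 by blast
    ultimately have "\<Lambda> \<le> E ?v"
      unfolding lambda1_def by (intro cInf_lower)
    also have "\<dots> = E \<phi> / m"
      using energy_scale[OF \<phi> c(1)] c(2) by simp
    finally show ?thesis using m by (simp add: field_simps m_def[symmetric])
  qed
qed

text \<open>
  The heart of the argument. The deficit \<open>D\<close> measures how far the convexity estimate for the nonlocal energy is from
  equality. Comparing \<open>E w\<^sub>k\<close> with the energies of the approximations bounds \<open>\<integral>D\<close> plus the Hardy term of \<open>w\<^sub>k\<close> by a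
  quantity that converges to the Hardy term of the limit. By Fatou's lemma the limiting deficit has integral zero, so
  almost every pair of points is an equality case of the reverse triangle inequality.
\<close>

lemma minimizers_parallel:
  assumes u: "u \<in> X" "E u = \<Lambda> * mass u"
    and v: "v \<in> X" "E v = \<Lambda> * mass v"
  shows "AE z in LL. u (fst z) * v (snd z) = v (fst z) * u (snd z)"
proof -
  obtain \<phi> where ap\<phi>: "approximates p \<Omega> \<phi> u" using ex_approximates[OF u(1) \<Omega>(1) p(1)] by blast
  obtain \<psi> where ap\<psi>: "approximates p \<Omega> \<psi> v" using ex_approximates[OF v(1) \<Omega>(1) p(1)] by blast
  have \<phi>: "\<phi> k \<in> test_functions \<Omega>" and \<psi>: "\<psi> k \<in> test_functions \<Omega>" for k
    using ap\<phi> ap\<psi> by (simp_all add: approximates_def)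
  define e where "e = (\<lambda>k. inverse (real (Suc k)))"
  have e: "e k > 0" for k by (simp add: e_def)
  define w where "w = (\<lambda>k. lp_combination p (e k) (\<phi> k) (\<psi> k))"
  define W where "W = (\<lambda>x. lp_norm p (u x) (v x))"
  have w: "w k \<in> test_functions \<Omega>" for k
    unfolding w_def by (rule lp_combination_test_function[OF \<phi> \<psi> e])
  have w_le: "\<bar>w k x - w k y\<bar> powr p \<le> \<bar>\<phi> k x - \<phi> k y\<bar> powr p + \<bar>\<psi> k x - \<psi> k y\<bar> powr p" for k x y
    unfolding w_def by (rule lp_combination_diff_powr_le[OF p(1)])
  note Lu = X_space_Lp[OF u(1) \<Omega>(1)] and Lv = X_space_Lp[OF v(1) \<Omega>(1)]
  note T\<phi> = test_function_Lp[OF \<phi> p_pos] and T\<psi> = test_function_Lp[OF \<psi> p_pos]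
    and Tw = test_function_Lp[OF w p_pos]
  note [measurable] = Lu(1) Lv(1) T\<phi>(1) T\<psi>(1) Tw(1)
  have Wm [measurable]: "W \<in> borel_measurable lebesgue"
    unfolding W_def lp_norm_def by measurable
  have Wp: "\<bar>W x\<bar> powr p = \<bar>u x\<bar> powr p + \<bar>v x\<bar> powr p" for x
    using lp_norm_powr[OF p(1)] lp_norm_nonneg[of p "u x" "v x"] by (simp add: W_def)
  note gm [measurable] = gagliardo_measurable[OF T\<phi>(1)] gagliardo_measurable[OF T\<psi>(1)]
    gagliardo_measurable[OF Tw(1)] gagliardo_measurable[OF Lu(1)] gagliardo_measurable[OF Lv(1)]
    gagliardo_measurable[OF Wm]
  have aew: "AE x in lebesgue. (\<lambda>k. \<phi> k x) \<longlonglongrightarrow> u x \<and> (\<lambda>k. \<psi> k x) \<longlonglongrightarrow> v x \<and> (\<lambda>k. w k x) \<longlonglongrightarrow> W x"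
  proof -
    have "AE x in lebesgue. (\<lambda>k. \<phi> k x) \<longlonglongrightarrow> u x" "AE x in lebesgue. (\<lambda>k. \<psi> k x) \<longlonglongrightarrow> v x"
      using ap\<phi> ap\<psi> by (simp_all add: approximates_def)
    then show ?thesis
      by eventually_elim (auto simp: w_def W_def e_def simp del: of_nat_Suc intro: lp_combination_tendsto[OF p(1)])
  qed

  \<comment> \<open>No sign of \<open>\<Lambda>\<close> is assumed, so the masses have to converge; a one-sided limit would not suffice.\<close>
  have massW: "integrable lebesgue (\<lambda>x. \<bar>W x\<bar> powr p)"
    unfolding Wp by (intro Bochner_Integration.integrable_add Lu Lv)
  have mass: "(\<lambda>k. \<integral>x. \<bar>w k x\<bar> powr p \<partial>lebesgue) \<longlonglongrightarrow> mass u + mass v"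
  proof -
    let ?d\<phi> = "\<lambda>k x. \<bar>\<phi> k x - u x\<bar> powr p" and ?d\<psi> = "\<lambda>k x. \<bar>\<psi> k x - v x\<bar> powr p"
      and ?dw = "\<lambda>k x. \<bar>w k x - W x\<bar> powr p"
    define d where "d = (\<lambda>k. (\<integral>x. ?d\<phi> k x \<partial>lebesgue) + (\<integral>x. ?d\<psi> k x \<partial>lebesgue))"
    define \<eta> where "\<eta> = (\<lambda>k. (2 * lp_norm p (e k) (e k)) powr p)"
    let ?bd = "\<lambda>k. 2 powr p * (\<eta> k * measure lebesgue \<Omega> + d k)"
    have d: "d \<longlonglongrightarrow> 0"
      using ap\<phi> ap\<psi> unfolding d_def approximates_def by (auto intro: tendsto_add_zero)
    have \<eta>: "\<eta> \<longlonglongrightarrow> 0"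
    proof -
      have "(\<lambda>k. 2 * lp_norm p (e k) (e k)) \<longlonglongrightarrow> 2 * 0"
        unfolding e_def by (intro tendsto_intros lp_norm_diagonal_tendsto_0[OF p(1)])
      then have "\<eta> \<longlonglongrightarrow> (2 * 0) powr p"
        unfolding \<eta>_def by (rule tendsto_powr2[OF _ tendsto_const]) (use p_pos lp_norm_nonneg in auto)
      then show ?thesis by simp
    qed
    have fin: "emeasure lebesgue \<Omega> < \<infinity>"
      using \<Omega> emeasure_bounded_finite[of \<Omega>] by simp
    have int\<phi>: "integrable lebesgue (\<lambda>x. ?d\<phi> k x)" for k
      using integrable_norm_diff_powr[OF p(1) T\<phi>(1) Lu(1), of k] T\<phi>(2)[of k] Lu(2) by simp
    have int\<psi>: "integrable lebesgue (\<lambda>x. ?d\<psi> k x)" for k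
      using integrable_norm_diff_powr[OF p(1) T\<psi>(1) Lv(1), of k] T\<psi>(2)[of k] Lv(2) by simp
    have intw: "integrable lebesgue (\<lambda>x. ?dw k x)" for k
      using integrable_norm_diff_powr[OF p(1) Tw(1) Wm, of k] Tw(2)[of k] massW by simp
    have le: "(\<integral>x. ?dw k x \<partial>lebesgue) \<le> ?bd k" for k
    proof -
      let ?b = "\<lambda>x. 2 powr p * (\<eta> k * indicator \<Omega> x + (?d\<phi> k x + ?d\<psi> k x))"
      have intind: "integrable lebesgue (\<lambda>x. \<eta> k * indicator \<Omega> x :: real)"
        using fin \<Omega> by (intro integrable_mult_right integrable_real_indicator) auto
      have intb: "integrable lebesgue ?b"
        by (intro integrable_mult_right Bochner_Integration.integrable_add intind int\<phi> int\<psi>)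
      have "(\<integral>x. ?dw k x \<partial>lebesgue) \<le> (\<integral>x. ?b x \<partial>lebesgue)"
      proof (rule integral_mono_AE[OF intw intb])
        show "AE x in lebesgue. ?dw k x \<le> ?b x"
          using X_space_vanishes_outside[OF u(1)] X_space_vanishes_outside[OF v(1)]
        proof eventually_elim
          case (elim x)
          show ?case
          proof (cases "x \<in> \<Omega>")
            case True
            then show ?thesis
              using lp_combination_near_lp_norm[OF p(1) e, of k "\<phi> k" "\<psi> k" x "u x" "v x"]
              by (simp add: w_def W_def \<eta>_def)
          next
            case False
            then have "w k x = 0" "W x = 0"
              using test_function_outside(1)[OF w] elim by (auto simp: W_def lp_norm_def)
            then show ?thesis by (simp add: \<eta>_def)
          qed
        qed
      qed
      also have "(\<integral>x. ?b x \<partial>lebesgue) = ?bd k"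
        using intind int\<phi>[of k] int\<psi>[of k] fin \<Omega> by (simp add: d_def)
      finally show ?thesis .
    qed
    have "(\<lambda>k. ?bd k) \<longlonglongrightarrow> 2 powr p * (0 * measure lebesgue \<Omega> + 0)"
      by (intro tendsto_intros d \<eta>)
    then have lim0: "(\<lambda>k. ?bd k) \<longlonglongrightarrow> 0"
      by simp
    have "(\<lambda>k. \<integral>x. norm (w k x) powr p \<partial>lebesgue) \<longlonglongrightarrow> (\<integral>x. norm (W x) powr p \<partial>lebesgue)"
    proof (rule tendsto_integral_norm_powr[OF p(1) Tw(1) Wm])
      show "(\<lambda>k. \<integral>x. norm (w k x - W x) powr p \<partial>lebesgue) \<longlonglongrightarrow> 0"
        by (rule tendsto_sandwich[OF always_eventually always_eventually tendsto_const lim0])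
          (use le in simp_all)
    qed (use Tw(2) massW in simp_all)
    moreover have "(\<integral>x. norm (W x) powr p \<partial>lebesgue) = mass u + mass v"
      using Lu(2) Lv(2) by (simp add: Wp)
    ultimately show ?thesis by simp
  qed

  define D where "D = (\<lambda>a b c (z :: 'a \<times> 'a). \<bar>gagliardo p s a z\<bar> powr p + \<bar>gagliardo p s b z\<bar> powr p - \<bar>gagliardo p s c z\<bar> powr p)"
  let ?Dk = "\<lambda>k. D (\<phi> k) (\<psi> k) (w k)"
  define h where "h = (\<lambda>a x. \<mu> * (\<bar>a x\<bar> powr p / norm (x::'a) powr (p * \<theta>)))"
  define R where "R = (\<lambda>k. smooth_dirichlet (\<phi> k) + smooth_dirichlet (\<psi> k)
      + (nonlocal (\<phi> k) + nonlocal (\<psi> k))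
      - \<Lambda> * mass (w k))"
  have hm: "h a \<in> borel_measurable lebesgue" if "a \<in> borel_measurable lebesgue" for a
    unfolding h_def by (intro borel_measurable_times borel_measurable_const weight_measurable that)
  have h0: "h a x \<ge> 0" for a x
    using \<mu>(1) by (simp add: h_def)
  have G_le: "\<bar>gagliardo p s c z\<bar> powr p \<le> \<bar>gagliardo p s a z\<bar> powr p + \<bar>gagliardo p s b z\<bar> powr p"
    if "\<And>x y. \<bar>c x - c y\<bar> powr p \<le> \<bar>a x - a y\<bar> powr p + \<bar>b x - b y\<bar> powr p" for a b c :: "'a \<Rightarrow> real" and z
    by (cases z) (simp add: gagliardo_powr[OF p(1)] divide_right_mono that flip: add_divide_distrib)
  have D0: "?Dk k z \<ge> 0" for k z
    unfolding D_def using G_le[of "w k" "\<phi> k" "\<psi> k" z, OF w_le] by simp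
  have intG: "integrable LL (\<lambda>z. \<bar>gagliardo p s a z\<bar> powr p)" if "a \<in> test_functions \<Omega>" for a
    by (rule test_function_gagliardo_integrable[OF that p(1) s])
  have key: "(\<integral>\<^sup>+z. ennreal (?Dk k z) \<partial>LL) + (\<integral>\<^sup>+x. ennreal (h (w k) x) \<partial>lebesgue) \<le> ennreal (R k)" for k
  proof -
    have inth: "integrable lebesgue (h (w k))"
      unfolding h_def by (intro integrable_mult_right hardy_term_integrable test_function_X_space[OF w \<Omega>(1) p_pos])
    have intD: "integrable LL (?Dk k)"
      unfolding D_def by (intro Bochner_Integration.integrable_diff Bochner_Integration.integrable_add intG \<phi> \<psi> w)
    have "smooth_dirichlet (w k)
        \<le> (\<integral>x. norm (gradient (\<phi> k) x) powr p + norm (gradient (\<psi> k) x) powr p \<partial>lebesgue)"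
    proof (rule integral_mono)
      show "norm (gradient (w k) x) powr p \<le> norm (gradient (\<phi> k) x) powr p + norm (gradient (\<psi> k) x) powr p" for x
        by (rule norm_gradient_powr_le[OF p(1) w_le test_function_has_derivative[OF w]
              test_function_has_derivative[OF \<phi>] test_function_has_derivative[OF \<psi>]])
    qed (use Tw(4) T\<phi>(4) T\<psi>(4) in auto)
    also have "\<dots> = smooth_dirichlet (\<phi> k) + smooth_dirichlet (\<psi> k)"
      using T\<phi>(4)[of k] T\<psi>(4)[of k] by simp
    finally have grad: "smooth_dirichlet (w k)
        \<le> smooth_dirichlet (\<phi> k) + smooth_dirichlet (\<psi> k)" .
    have D_int: "(\<integral>z. ?Dk k z \<partial>LL) = nonlocal (\<phi> k)
        + nonlocal (\<psi> k) - nonlocal (w k)"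
      unfolding D_def using intG[OF \<phi>, of k] intG[OF \<psi>, of k] intG[OF w, of k] by simp
    have h_int: "(\<integral>x. h (w k) x \<partial>lebesgue) = \<mu> * hardy (w k)"
      unfolding h_def by (rule integral_mult_right_zero)
    have "(\<integral>z. ?Dk k z \<partial>LL) + (\<integral>x. h (w k) x \<partial>lebesgue) \<le> R k"
      using lambda1_le_energy[OF w, of k] grad
      unfolding D_int h_int R_def energy_test_function[OF w] by linarith
    then show ?thesis
      using D0 h0 by (simp add: nn_integral_eq_integral[OF intD] nn_integral_eq_integral[OF inth]
          integral_nonneg ennreal_leI flip: ennreal_plus)
  qed
  \<comment> \<open>Since \<open>u\<close> and \<open>v\<close> satisfy \<open>E u = \<Lambda> \<integral>|u|\<^sup>p\<close> and \<open>E v = \<Lambda> \<integral>|v|\<^sup>p\<close>, only their Hardy terms remain in the limit.\<close>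
  define R0 where "R0 = (\<integral>x. h u x \<partial>lebesgue) + (\<integral>x. h v x \<partial>lebesgue)"
  have R_lim: "R \<longlonglongrightarrow> R0"
  proof -
    have "R \<longlonglongrightarrow> dirichlet u + dirichlet v
      + (nonlocal u + nonlocal v)
      - \<Lambda> * (mass u + mass v)"
      (is "_ \<longlonglongrightarrow> ?lim")
      unfolding R_def
      by (intro tendsto_intros mass approximates_Lp_limits(1)[OF u(1) \<Omega>(1) p(1) ap\<phi>]
          approximates_Lp_limits(1)[OF v(1) \<Omega>(1) p(1) ap\<psi>]
          approximates_gagliardo(2)[OF u(1) \<Omega>(1) p(1) s ap\<phi>]
          approximates_gagliardo(2)[OF v(1) \<Omega>(1) p(1) s ap\<psi>])
    moreover have "?lim = R0"
      using u(2) v(2) unfolding energy_X_space[OF u(1)] energy_X_space[OF v(1)] R0_def h_def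
        integral_mult_right_zero distrib_left
      by linarith
    ultimately show ?thesis by simp
  qed
  have "(\<integral>\<^sup>+z. ennreal (D u v W z) \<partial>LL) + (\<integral>\<^sup>+x. ennreal (h W x) \<partial>lebesgue) \<le> ennreal R0"
  proof (rule nn_integral_add_le_of_AE_tendsto[OF _ _ _ _ key tendsto_ennrealI[OF R_lim]])
    show "(\<lambda>z. ennreal (?Dk k z)) \<in> borel_measurable LL" for k
      unfolding D_def by measurable
    show "(\<lambda>x. ennreal (h (w k) x)) \<in> borel_measurable lebesgue" for k
      using hm[OF Tw(1)] by measurable
    have powr_lim: "(\<lambda>k. \<bar>f k\<bar> powr p) \<longlonglongrightarrow> \<bar>a\<bar> powr p" if "f \<longlonglongrightarrow> a" for f and a :: real
      by (rule tendsto_powr2[OF tendsto_rabs[OF that] tendsto_const]) (use p_pos in auto)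
    show "AE x in lebesgue. (\<lambda>k. ennreal (h (w k) x)) \<longlonglongrightarrow> ennreal (h W x)"
      using aew
      by eventually_elim (auto simp: h_def divide_inverse intro!: tendsto_ennrealI tendsto_mult tendsto_const powr_lim)
    show "AE z in LL. (\<lambda>k. ennreal (?Dk k z)) \<longlonglongrightarrow> ennreal (D u v W z)"
      using AE_lebesgue_pair[OF aew]
    proof eventually_elim
      case (elim z)
      have G: "(\<lambda>k. gagliardo p s (f k) z) \<longlonglongrightarrow> gagliardo p s a z"
        if "(\<lambda>k. f k (fst z)) \<longlonglongrightarrow> a (fst z)" "(\<lambda>k. f k (snd z)) \<longlonglongrightarrow> a (snd z)" for f a
        unfolding gagliardo_def divide_inverse by (intro tendsto_mult tendsto_diff tendsto_const that)
      show ?case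
        unfolding D_def
        by (intro tendsto_ennrealI tendsto_diff tendsto_add powr_lim G) (use elim in auto)
    qed
  qed
  moreover have "(\<integral>\<^sup>+x. ennreal (h W x) \<partial>lebesgue) = ennreal R0"
  proof -
    have ih: "integrable lebesgue (h u)" "integrable lebesgue (h v)"
      unfolding h_def by (intro integrable_mult_right hardy_term_integrable u v)+
    have hW: "h W x = h u x + h v x" for x
      unfolding h_def Wp by (simp add: add_divide_distrib distrib_left)
    show ?thesis
      unfolding hW R0_def using ih h0 by (subst nn_integral_eq_integral) auto
  qed
  ultimately have "ennreal R0 + (\<integral>\<^sup>+z. ennreal (D u v W z) \<partial>LL) \<le> ennreal R0 + 0"
    by (simp only: add.commute[of "ennreal R0"] add_0_left)
  then have "(\<integral>\<^sup>+z. ennreal (D u v W z) \<partial>LL) = 0"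
    unfolding ennreal_add_left_cancel_le by simp
  then have "AE z in LL. ennreal (D u v W z) = 0"
    by (subst (asm) nn_integral_0_iff_AE) (auto simp: D_def)
  then show ?thesis
  proof eventually_elim
    case (elim z)
    obtain x y where z: "z = (x, y)" by (cases z)
    have W_le: "\<bar>W x - W y\<bar> powr p \<le> \<bar>u x - u y\<bar> powr p + \<bar>v x - v y\<bar> powr p"
      unfolding W_def by (rule lp_norm_diff_powr_le(1)[OF p(1)])
    show ?case
    proof (cases "x = y")
      case False
      then have n: "norm (x - y) powr (real DIM('a) + s * p) > 0" by simp
      have "D u v W z = (\<bar>u x - u y\<bar> powr p + \<bar>v x - v y\<bar> powr p - \<bar>W x - W y\<bar> powr p)
          / norm (x - y) powr (real DIM('a) + s * p)"
        unfolding D_def z gagliardo_powr[OF p(1)] by (simp add: add_divide_distrib diff_divide_distrib)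
      with elim have "\<bar>u x - u y\<bar> powr p + \<bar>v x - v y\<bar> powr p - \<bar>W x - W y\<bar> powr p \<le> 0"
        using n by (simp add: ennreal_eq_0_iff divide_le_0_iff)
      with W_le have "\<bar>W x - W y\<bar> powr p = \<bar>u x - u y\<bar> powr p + \<bar>v x - v y\<bar> powr p"
        by linarith
      from lp_norm_diff_powr_le(2)[OF p(1) this[unfolded W_def]]
      show ?thesis by (simp add: z)
    qed (simp add: z mult.commute)
  qed
qed

text \<open>
  The weak formulation tested with the eigenfunction itself.
\<close>

lemma eigenfunction_energy:
  assumes "eigenfunction p s \<theta> \<mu> \<Omega> ev u"
  shows "E u = ev * mass u"
proof -
  have u: "u \<in> X" using assms by (simp add: eigenfunction_def)
  have sq: "\<bar>t\<bar> powr (p - 2) * t * t = \<bar>t\<bar> powr p" for t :: real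
  proof (cases "t = 0")
    case False
    have "\<bar>t\<bar> powr p = \<bar>t\<bar> powr (p - 2) * t\<^sup>2"
      using powr_add[of "\<bar>t\<bar>" "p - 2" 2] False by simp
    then show ?thesis by (simp add: power2_eq_square)
  qed simp
  have n: "norm g powr (p - 2) * (g \<bullet> g) = norm g powr p" for g :: 'a
    using sq[of "norm g"] by (simp add: dot_square_norm power2_eq_square mult.assoc)
  have F: "F p t * t = \<bar>t\<bar> powr p" for t
    unfolding F_def by (rule sq)
  show ?thesis
    using assms u unfolding eigenfunction_def energy_def X_space_integral_Lp[OF u, symmetric]
    by (auto simp: n F mult.commute[of s p] dest!: bspec[of X _ u])
qed

lemma first_eigenfunctions_proportional:
  assumes u: "eigenfunction p s \<theta> \<mu> \<Omega> \<Lambda> u" and v: "eigenfunction p s \<theta> \<mu> \<Omega> \<Lambda> v"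
  shows "\<exists>c. c \<noteq> 0 \<and> (AE x in lebesgue. u x = c * v x)"
proof -
  interpret L: sigma_finite_measure "lebesgue :: 'a measure" by (rule sigma_finite_lebesgue)
  interpret LL: pair_sigma_finite "lebesgue :: 'a measure" "lebesgue :: 'a measure" ..
  have uX: "u \<in> X" and vX: "v \<in> X" and u0: "\<not> (AE x in lebesgue. u x = 0)" and v0: "\<not> (AE x in lebesgue. v x = 0)"
    using u v by (auto simp: eigenfunction_def)
  have "AE x in lebesgue. AE y in lebesgue. u x * v y = v x * u y"
    using LL.AE_pair[OF minimizers_parallel[OF uX eigenfunction_energy[OF u] vX eigenfunction_energy[OF v]]]
    by simp
  then have "\<exists>x. (AE y in lebesgue. u x * v y = v x * u y) \<and> v x \<noteq> 0"
    using v0 by (metis (mono_tags, lifting) eventually_mono)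
  then obtain x where x: "AE y in lebesgue. u x * v y = v x * u y" "v x \<noteq> 0"
    by blast
  have ae: "AE y in lebesgue. u y = (u x / v x) * v y"
    using x(1) by eventually_elim (use x(2) in \<open>simp add: field_simps\<close>)
  moreover have "u x / v x \<noteq> 0"
    using ae u0 by auto
  ultimately show ?thesis by blast
qed

end

theorem theorem4p3:
  fixes \<Omega> :: "'a::euclidean_space set" and p s \<theta> \<mu> :: real
  assumes "0 < s" "s < 1" "1 < p" "p < real DIM('a)"
    and "s \<le> \<theta>" "\<theta> \<le> 1"
    and "open \<Omega>" "connected \<Omega>" "bounded \<Omega>" "\<Omega> \<noteq> {}"
    and "0 < \<mu>" "\<mu> < mu0 DIM('a) p s \<theta>"
  shows "\<forall>u v. eigenfunction p s \<theta> \<mu> \<Omega> (lambda1 p s \<theta> \<mu> \<Omega>) u \<and>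
               eigenfunction p s \<theta> \<mu> \<Omega> (lambda1 p s \<theta> \<mu> \<Omega>) v \<longrightarrow>
               (\<exists>c. c \<noteq> 0 \<and> (AE x in lebesgue. u x = c * v x))"
proof -
  interpret hardy_sobolev_problem \<Omega> p s \<theta> \<mu>
    by unfold_locales (use assms in auto)
  show ?thesis using first_eigenfunctions_proportional by blast
qed

end
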